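(* For each countable limit ordinal $\lambda$ there is a countable linear order whose Scott complexity is $\Sigma_{\lambda+1}$.
   Context: All structures are countable. A Scott sentence for a countable structure $\mathcal{A}$ is a sentence $\varphi$ of $\mathcal{L}_{\omega_1\omega}$ such that for every countable $\mathcal{B}$, $\mathcal{B}\models\varphi$ iff $\mathcal{B}\cong\mathcal{A}$. The Scott complexity of $\mathcal{A}$ is the least complexity, among the infinitary classes $\Sigma_\alpha$, d-$\Sigma_\alpha$ (a conjunction of a $\Sigma_\alpha$ and a $\Pi_\alpha$ sentence) and $\Pi_\alpha$, of a Scott sentence for $\mathcal{A}$. *)

theory Defs
  imports Main
begin

unbundle cardinal_syntax

section \<open>Countable ordinals\<close>

text \<open>A countable ordinal is an isomorphism class of well-orders whose field is a set of natural
  numbers. The field may be finite or empty, so every ordinal below \<open>\<omega>\<^sub>1\<close>, including \<open>0\<close>, occurs.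
  The relation \<open>r =o s\<close> of the library already says that \<open>r\<close> and \<open>s\<close> are well-orders.\<close>

quotient_type cord = "nat rel" / partial: "\<lambda>r s. r =o s"
proof (rule part_equivpI)
  show "\<exists>r :: nat rel. r =o r"
    by (rule exI[of _ "{}"]) (simp add: ordIso_reflexive well_order_on_empty)
  show "symp (\<lambda>r s :: nat rel. r =o s)"
    by (rule sympI) (rule ordIso_symmetric)
  show "transp (\<lambda>r s :: nat rel. r =o s)"
    by (rule transpI) (rule ordIso_transitive)
qed

instantiation cord :: wellorder
begin

lift_definition less_eq_cord :: "cord \<Rightarrow> cord \<Rightarrow> bool" is "\<lambda>r s. r \<le>o s"
proof -
  fix r r' s s' :: "nat rel"
  assume rr: "r =o r'" and ss: "s =o s'"
  show "r \<le>o s \<longleftrightarrow> r' \<le>o s'"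
  proof
    show "r' \<le>o s'" if "r \<le>o s"
      using ordIso_ordLeq_trans[OF ordIso_symmetric[OF rr] ordLeq_ordIso_trans[OF that ss]] .
    show "r \<le>o s" if "r' \<le>o s'"
      using ordIso_ordLeq_trans[OF rr ordLeq_ordIso_trans[OF that ordIso_symmetric[OF ss]]] .
  qed
qed

lift_definition less_cord :: "cord \<Rightarrow> cord \<Rightarrow> bool" is "\<lambda>r s. r <o s"
proof -
  fix r r' s s' :: "nat rel"
  assume rr: "r =o r'" and ss: "s =o s'"
  show "r <o s \<longleftrightarrow> r' <o s'"
  proof
    show "r' <o s'" if "r <o s"
      using ordIso_ordLess_trans[OF ordIso_symmetric[OF rr] ordLess_ordIso_trans[OF that ss]] .
    show "r <o s" if "r' <o s'"
      using ordIso_ordLess_trans[OF rr ordLess_ordIso_trans[OF that ordIso_symmetric[OF ss]]] .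
  qed
qed

instance
proof
  fix x y z :: cord
  have wo: "Well_order r \<and> Well_order s" if "r =o s" for r s :: "nat rel"
    using that by (auto simp: ordIso_def)
  show "x < y \<longleftrightarrow> x \<le> y \<and> \<not> y \<le> x"
  proof transfer
    fix r s :: "nat rel"
    assume "r =o r" and "s =o s"
    then have "Well_order r" and "Well_order s" using wo by blast+
    then show "r <o s \<longleftrightarrow> r \<le>o s \<and> \<not> s \<le>o r"
      using not_ordLeq_iff_ordLess ordLess_imp_ordLeq by metis
  qed
  show "x \<le> x"
    by transfer (rule ordIso_imp_ordLeq)
  show "x \<le> z" if "x \<le> y" "y \<le> z"
    using that by transfer (rule ordLeq_transitive)
  show "x = y" if "x \<le> y" "y \<le> x"
    using that by transfer (simp add: ordIso_iff_ordLeq)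
  show "x \<le> y \<or> y \<le> x"
  proof transfer
    fix r s :: "nat rel"
    assume "r =o r" and "s =o s"
    then show "r \<le>o s \<or> s \<le>o r"
      using wo ordLeq_total by metis
  qed
next
  fix P :: "cord \<Rightarrow> bool" and a :: cord
  assume step: "\<And>x. (\<And>y. y < x \<Longrightarrow> P y) \<Longrightarrow> P x"
  have less: "{(x, y). x < (y :: cord)} = inv_image ordLess rep_cord"
    by (auto simp: less_cord.rep_eq in_inv_image)
  have "wf {(x, y). x < (y :: cord)}"
    unfolding less by (rule wf_inv_image) (rule wf_ordLess)
  then show "P a"
    by (rule wf_induct_rule) (rule step, simp)
qed

end

lemma cord_no_max: "\<exists>\<beta>. \<alpha> < (\<beta> :: cord)"
proof transfer
  fix r :: "nat rel"
  assume "r =o r"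
  then have wo: "Well_order r" by (simp add: ordIso_def)
  define d where "d = dir_image r Suc"
  define s where "s = d \<union> insert 0 (Suc ` Field r) \<times> {0}"
  have inj: "inj_on Suc (Field r)" by simp
  have wod: "Well_order d" and iso: "r =o d"
    unfolding d_def using Well_order_dir_image[OF wo inj] dir_image_ordIso[OF wo inj] by auto
  have Fd: "Field d = Suc ` Field r" by (simp add: d_def dir_image_Field)
  have Fs: "Field s = insert 0 (Field d)" unfolding s_def Fd[symmetric] by (auto simp: Field_def)
  have d0: "(0, x) \<notin> d" "(x, 0) \<notin> d" for x by (auto simp: d_def dir_image_def)
  have sub: "d \<subseteq> Field d \<times> Field d" by (auto simp: Field_def)
  have lin: "refl_on (Field d) d" "trans d" "antisym d" "total_on (Field d) d" "wf (d - Id)"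
    using wod by (auto simp: order_on_defs)
  have n0: "0 \<notin> Field d" using Fd by auto
  have s_iff: "(x, y) \<in> s \<longleftrightarrow> (x, y) \<in> d \<or> (y = 0 \<and> (x = 0 \<or> x \<in> Field d))" for x y
    by (auto simp: s_def Fd)
  have "s \<subseteq> Field s \<times> Field s" by (auto simp: Field_def)
  moreover have "refl_on (Field s) s"
    using lin(1) by (auto simp: refl_on_def Fs s_iff)
  moreover have "trans s"
    using lin(2) sub d0 by (auto simp: trans_def s_iff)
  moreover have "antisym s"
    using lin(3) d0 n0 by (auto simp: antisym_def s_iff)
  moreover have "total_on (Field s) s"
    using lin(4) by (auto simp: total_on_def Fs s_iff)
  moreover have "wf (s - Id)"
  proof (rule wfUNIVI)
    fix P :: "nat \<Rightarrow> bool" and x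
    assume st: "\<forall>x. (\<forall>y. (y, x) \<in> s - Id \<longrightarrow> P y) \<longrightarrow> P x"
    have pos: "x \<noteq> 0 \<longrightarrow> P x" for x
    proof (induction x rule: wf_induct_rule[OF lin(5)])
      case (1 x)
      show ?case
      proof
        assume "x \<noteq> 0"
        have "P y" if "(y, x) \<in> s - Id" for y
        proof -
          have "(y, x) \<in> d - Id" using that \<open>x \<noteq> 0\<close> by (auto simp: s_iff)
          moreover have "y \<noteq> 0" using calculation d0(1) by (metis DiffD1)
          ultimately show ?thesis using 1 by blast
        qed
        then show "P x" using st by blast
      qed
    qed
    have "P y" if "(y, 0) \<in> s - Id" for y
      using that pos by auto
    then have "P 0" using st by auto
    with pos show "P x" by (cases "x = 0") auto
  qed
  ultimately have wos: "Well_order s" by (simp add: order_on_defs)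
  have us: "underS s 0 = Field d"
  proof (rule set_eqI)
    fix x
    show "x \<in> underS s 0 \<longleftrightarrow> x \<in> Field d"
      using n0 d0 by (cases "x = 0") (simp_all add: underS_def s_iff)
  qed
  have "Restr s (Field d) = d"
    using n0 sub by (auto simp: s_iff simp del: not_gr_zero)
  then have "d <o s"
    using underS_Restr_ordLess[OF wos, of 0] us Fs by auto
  then have "r <o s" using iso ordIso_ordLess_trans by blast
  moreover have "s =o s" using wos by (rule ordIso_reflexive)
  ultimately show "\<exists>\<beta>\<in>{r :: nat rel. r =o r}. r <o \<beta>" by blast
qed

definition cord_succ :: "cord \<Rightarrow> cord"
  where "cord_succ \<alpha> = (LEAST \<beta>. \<alpha> < \<beta>)"

lemma less_cord_succ: "\<alpha> < cord_succ \<alpha>"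
  unfolding cord_succ_def using cord_no_max LeastI_ex by blast

definition limit_cord :: "cord \<Rightarrow> bool"
  where "limit_cord \<mu> \<longleftrightarrow> (\<exists>\<alpha>. \<alpha> < \<mu>) \<and> (\<forall>\<alpha><\<mu>. cord_succ \<alpha> < \<mu>)"


section \<open>Countable structures with one binary relation\<close>

text \<open>Up to isomorphism, a countable structure has a set of natural numbers as its domain. Only the
  restriction of the relation to the domain matters.\<close>

type_synonym struct = "nat set \<times> nat rel"

definition structure_ok :: "struct \<Rightarrow> bool"
  where "structure_ok A \<longleftrightarrow> fst A \<noteq> {}"

definition isomorphic :: "struct \<Rightarrow> struct \<Rightarrow> bool"
  where "isomorphic A B \<longleftrightarrow> (\<exists>f. bij_betw f (fst A) (fst B) \<and>
    (\<forall>x\<in>fst A. \<forall>y\<in>fst A. (x, y) \<in> snd A \<longleftrightarrow> (f x, f y) \<in> snd B))"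


section \<open>The logic \<open>\<L>\<^bsub>\<omega>\<^sub>1\<omega>\<^esub>\<close>\<close>

text \<open>Variables are natural numbers. \<open>Conj I F\<close> and \<open>Disj I F\<close> are the conjunction and the disjunction
  of the family \<open>F i\<close> for \<open>i \<in> I\<close>; the index set may be empty, finite or infinite, and the values of
  \<open>F\<close> outside \<open>I\<close> play no role.\<close>

datatype fm =
    Eq nat nat
  | Rel nat nat
  | Neg fm
  | Conj "nat set" "nat \<Rightarrow> fm"
  | Disj "nat set" "nat \<Rightarrow> fm"
  | Ex nat fm
  | All nat fm

primrec free_vars :: "fm \<Rightarrow> nat set" where
  "free_vars (Eq x y) = {x, y}"
| "free_vars (Rel x y) = {x, y}"
| "free_vars (Neg \<phi>) = free_vars \<phi>"
| "free_vars (Conj I F) = (\<Union>i\<in>I. free_vars (F i))"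
| "free_vars (Disj I F) = (\<Union>i\<in>I. free_vars (F i))"
| "free_vars (Ex x \<phi>) = free_vars \<phi> - {x}"
| "free_vars (All x \<phi>) = free_vars \<phi> - {x}"

primrec sat :: "struct \<Rightarrow> (nat \<Rightarrow> nat) \<Rightarrow> fm \<Rightarrow> bool" where
  "sat A v (Eq x y) \<longleftrightarrow> v x = v y"
| "sat A v (Rel x y) \<longleftrightarrow> (v x, v y) \<in> snd A"
| "sat A v (Neg \<phi>) \<longleftrightarrow> \<not> sat A v \<phi>"
| "sat A v (Conj I F) \<longleftrightarrow> (\<forall>i\<in>I. sat A v (F i))"
| "sat A v (Disj I F) \<longleftrightarrow> (\<exists>i\<in>I. sat A v (F i))"
| "sat A v (Ex x \<phi>) \<longleftrightarrow> (\<exists>a\<in>fst A. sat A (v(x := a)) \<phi>)"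
| "sat A v (All x \<phi>) \<longleftrightarrow> (\<forall>a\<in>fst A. sat A (v(x := a)) \<phi>)"

text \<open>Each quantifier binds one variable, so every subformula of a sentence has only finitely many
  free variables; this need not be required separately.\<close>

definition is_sentence :: "fm \<Rightarrow> bool"
  where "is_sentence \<phi> \<longleftrightarrow> free_vars \<phi> = {}"

definition models :: "struct \<Rightarrow> fm \<Rightarrow> bool"
  where "models A \<phi> \<longleftrightarrow> (\<forall>v. range v \<subseteq> fst A \<longrightarrow> sat A v \<phi>)"


section \<open>The infinitary hierarchy\<close>

inductive finitary_qf :: "fm \<Rightarrow> bool" where
  "finitary_qf (Eq x y)"
| "finitary_qf (Rel x y)"
| "finitary_qf \<phi> \<Longrightarrow> finitary_qf (Neg \<phi>)"
| "finite I \<Longrightarrow> (\<And>i. i \<in> I \<Longrightarrow> finitary_qf (F i)) \<Longrightarrow> finitary_qf (Conj I F)"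
| "finite I \<Longrightarrow> (\<And>i. i \<in> I \<Longrightarrow> finitary_qf (F i)) \<Longrightarrow> finitary_qf (Disj I F)"

text \<open>\<open>\<Sigma>\<^sub>0 = \<Pi>\<^sub>0\<close> consists of the finitary quantifier-free formulas. For \<open>\<alpha> > 0\<close>, a \<open>\<Sigma>\<^sub>\<alpha>\<close> formula is a
  countable disjunction of formulas \<open>\<exists>y\<^sub>1 \<dots> y\<^sub>k \<psi>\<close> with \<open>\<psi>\<close> in \<open>\<Pi>\<^sub>\<beta>\<close> for some \<open>\<beta> < \<alpha>\<close>, and \<open>\<Pi>\<^sub>\<alpha>\<close> is dual.
  The tuple of variables, here a list, and the ordinal \<open>\<beta>\<close> may vary with the disjunct.\<close>

inductive is_Sigma :: "cord \<Rightarrow> fm \<Rightarrow> bool" and is_Pi :: "cord \<Rightarrow> fm \<Rightarrow> bool" where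
  Sigma_zero: "(\<And>\<beta>. \<alpha> \<le> \<beta>) \<Longrightarrow> finitary_qf \<phi> \<Longrightarrow> is_Sigma \<alpha> \<phi>"
| Pi_zero: "(\<And>\<beta>. \<alpha> \<le> \<beta>) \<Longrightarrow> finitary_qf \<phi> \<Longrightarrow> is_Pi \<alpha> \<phi>"
| Sigma_pos: "\<gamma> < \<alpha> \<Longrightarrow> (\<And>i. i \<in> I \<Longrightarrow> \<exists>\<beta><\<alpha>. is_Pi \<beta> (\<psi> i)) \<Longrightarrow>
    is_Sigma \<alpha> (Disj I (\<lambda>i. foldr Ex (ys i) (\<psi> i)))"
| Pi_pos: "\<gamma> < \<alpha> \<Longrightarrow> (\<And>i. i \<in> I \<Longrightarrow> \<exists>\<beta><\<alpha>. is_Sigma \<beta> (\<psi> i)) \<Longrightarrow>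
    is_Pi \<alpha> (Conj I (\<lambda>i. foldr All (ys i) (\<psi> i)))"

datatype complexity = Sigma_class cord | Pi_class cord | dSigma_class cord

fun in_class :: "complexity \<Rightarrow> fm \<Rightarrow> bool" where
  "in_class (Sigma_class \<alpha>) \<phi> \<longleftrightarrow> is_Sigma \<alpha> \<phi>"
| "in_class (Pi_class \<alpha>) \<phi> \<longleftrightarrow> is_Pi \<alpha> \<phi>"
| "in_class (dSigma_class \<alpha>) \<phi> \<longleftrightarrow>
    (\<exists>\<psi> \<chi>. is_Sigma \<alpha> \<psi> \<and> is_Pi \<alpha> \<chi> \<and> \<phi> = Conj {0, 1} (\<lambda>i. if i = 0 then \<psi> else \<chi>))"

fun class_index :: "complexity \<Rightarrow> cord" where
  "class_index (Sigma_class \<alpha>) = \<alpha>"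
| "class_index (Pi_class \<alpha>) = \<alpha>"
| "class_index (dSigma_class \<alpha>) = \<alpha>"

text \<open>\<open>\<Sigma>\<^sub>\<alpha>\<close> and \<open>\<Pi>\<^sub>\<alpha>\<close> are incomparable, both lie below d-\<open>\<Sigma>\<^sub>\<alpha>\<close>, and all three lie below every class of
  larger index. For \<open>\<alpha> = 0\<close> the three classes coincide up to equivalence, but the only quantifier-free
  sentences are the trivially true and false ones, so no structure has a Scott sentence there.\<close>

definition class_le :: "complexity \<Rightarrow> complexity \<Rightarrow> bool"
  where "class_le c c' \<longleftrightarrow> c = c' \<or> class_index c < class_index c' \<or> c' = dSigma_class (class_index c)"


section \<open>Scott sentences and Scott complexity\<close>

definition is_Scott_sentence :: "struct \<Rightarrow> fm \<Rightarrow> bool"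
  where "is_Scott_sentence A \<phi> \<longleftrightarrow>
    is_sentence \<phi> \<and> (\<forall>B. structure_ok B \<longrightarrow> (models B \<phi> \<longleftrightarrow> isomorphic B A))"

definition has_Scott_sentence_in :: "struct \<Rightarrow> complexity \<Rightarrow> bool"
  where "has_Scott_sentence_in A c \<longleftrightarrow> (\<exists>\<phi>. in_class c \<phi> \<and> is_Scott_sentence A \<phi>)"

definition has_Scott_complexity :: "struct \<Rightarrow> complexity \<Rightarrow> bool"
  where "has_Scott_complexity A c \<longleftrightarrow>
    has_Scott_sentence_in A c \<and> (\<forall>c'. has_Scott_sentence_in A c' \<longrightarrow> class_le c c')"

end

theory Submission
  imports Defs Complex_Main "HOL-Library.Countable_Set" "HOL-Library.Poly_Mapping"
    "HOL-Library.Dual_Ordered_Lattice" "HOL-Library.Product_Lexorder"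
begin

text \<open>A structure \<open>A\<close> has a \<open>\<Sigma>\<^bsub>\<mu>+1\<^esub>\<close> Scott sentence as soon as some parameter \<open>a\<close> makes all types over \<open>a\<close>
  stabilise below \<open>\<mu>\<close>, at a level that is itself read off from a type of fixed level. It has no Scott sentence
  of smaller complexity, and no \<open>\<Pi>\<^bsub>\<mu>+1\<^esub>\<close> one, if some non-isomorphic \<open>B\<close> realises only tuples that agree with
  a tuple of \<open>A\<close> at every level below \<open>\<mu>\<close>.

  For the order, take the tree of finite sequences of rationals. Around every node of level \<open>k\<close> there is a
  dense set of separators, each a block of \<open>k + 2\<close> points followed by a gadget \<open>\<int>\<^sup>\<gamma>\<close>; the finite blocks
  let a bounded level see at which node two points part. The gadgets at level \<open>k\<close> have exponent \<open>b k\<close> at the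
  nodes on the path of the leaf \<open>0\<close> and \<open>b k + 1\<close> elsewhere, where \<open>b\<close> is cofinal in \<open>\<mu>\<close>. With the leaf \<open>0\<close>
  as a parameter, the level at which a point leaves the path of \<open>0\<close> bounds the exponents that matter.
  Without it, levels below \<open>b k\<close> cannot tell the two exponents apart from level \<open>k\<close> of the tree on, so the
  leaf \<open>0\<close> looks like many others, and deleting it gives \<open>B\<close>.\<close>

section \<open>Back-and-forth relations\<close>

text \<open>The back-and-forth relation is the symmetric one. Its level \<alpha> preserves both
  Sigma and Pi formulas of level \<alpha>, and a type of level \<beta> is defined by a Pi formula
  whose level may exceed \<beta> slightly. Since \<mu> is a limit, this loss stays below \<mu> and
  the coarse bookkeeping costs nothing. The obstacle is that the exponents are unbounded in \<mu>:
  no single level below \<mu> settles all types over the parameter, so the level must be computed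
  from the tuple, and this inside a model not known in advance. The blocks answer this. They show
  the tree level of a point at a finite back-and-forth level, whatever the exponent of its gadget.
  Powers of the integers serve as gadgets because differences of their points live in an ordered
  group. Level \<delta> sees only the leading term of a difference: exactly at exponents below
  \<delta>, and with a bounded count of units at \<delta> itself. So two exponents that are both at
  least \<delta> look alike at level \<delta>, while a difference of one unit at exponent \<delta>
  is recognised at that level.\<close>

lemma less_cord_succ_iff: "\<beta> < cord_succ \<alpha> \<longleftrightarrow> \<beta> \<le> (\<alpha> :: cord)"
  unfolding cord_succ_def
  by (metis LeastI_ex Least_le cord_no_max leD leI order_le_less_trans)

lemma cord_cases:
  fixes \<beta> :: cord
  obtains (zero) "\<And>\<gamma>. \<beta> \<le> \<gamma>" | (succ) \<gamma> where "\<beta> = cord_succ \<gamma>" | (limit) "limit_cord \<beta>"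
proof (cases "\<exists>\<alpha>. \<alpha> < \<beta>")
  case False
  then show ?thesis using zero by (metis not_less)
next
  case True
  show ?thesis
  proof (cases "limit_cord \<beta>")
    case False
    then obtain \<alpha> where "\<alpha> < \<beta>" "\<not> cord_succ \<alpha> < \<beta>"
      using True by (auto simp: limit_cord_def)
    then have "\<beta> = cord_succ \<alpha>"
      by (metis Least_le cord_succ_def linorder_neqE order.strict_iff_not)
    then show ?thesis by (rule succ)
  qed (rule limit)
qed

lemma limit_cord_succ: "limit_cord \<mu> \<Longrightarrow> \<alpha> < \<mu> \<Longrightarrow> cord_succ \<alpha> < \<mu>"
  by (simp add: limit_cord_def)

text \<open>An ordinal below \<mu> is the class of a proper initial segment of any well-order
  representing \<mu>, and such segments are indexed by natural numbers.\<close>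

lemma countable_lessThan_cord: "countable {..<(\<mu> :: cord)}"
proof -
  define r where "r = rep_cord \<mu>"
  have rr: "r =o r" and \<mu>: "\<mu> = abs_cord r"
    unfolding r_def using Quotient3_rep_reflp[OF Quotient3_cord] Quotient3_abs_rep[OF Quotient3_cord]
    by auto
  have "{..<\<mu>} \<subseteq> (\<lambda>a. abs_cord (Restr r (underS r a))) ` UNIV"
  proof
    fix \<gamma> assume "\<gamma> \<in> {..<\<mu>}"
    then have "rep_cord \<gamma> <o r" by (simp add: less_cord.rep_eq r_def)
    moreover have "rep_cord \<gamma> =o rep_cord \<gamma>"
      using Quotient3_rep_reflp[OF Quotient3_cord] by blast
    moreover from this have wo: "Well_order (rep_cord \<gamma>)" by (simp add: ordIso_def)
    moreover from rr have "Well_order r" by (simp add: ordIso_def)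
    ultimately have "\<exists>a\<in>Field r. rep_cord \<gamma> =o Restr r (underS r a)"
      using ordLess_iff_ordIso_Restr[of r "rep_cord \<gamma>"] by simp
    then obtain a where a: "rep_cord \<gamma> =o Restr r (underS r a)" ..
    have "\<gamma> = abs_cord (Restr r (underS r a))"
      using Quotient3_rel_abs[OF Quotient3_cord a] Quotient3_abs_rep[OF Quotient3_cord] by simp
    then show "\<gamma> \<in> (\<lambda>a. abs_cord (Restr r (underS r a))) ` UNIV" by blast
  qed
  then show ?thesis by (rule countable_subset) simp
qed

definition atomic_eq :: "'a set \<times> 'a rel \<Rightarrow> 'b set \<times> 'b rel \<Rightarrow> 'a list \<Rightarrow> 'b list \<Rightarrow> bool" where
  "atomic_eq A B as bs \<longleftrightarrow> length as = length bs \<and> (\<forall>i<length as. \<forall>j<length as.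
    (as ! i = as ! j \<longleftrightarrow> bs ! i = bs ! j) \<and> ((as ! i, as ! j) \<in> snd A \<longleftrightarrow> (bs ! i, bs ! j) \<in> snd B))"

text \<open>Both sides move by tuples of any length, so one round matches one block of like
  quantifiers. The element types are arbitrary: most of the work takes place in structures of
  points, before these are coded by natural numbers.\<close>

inductive bf :: "'a set \<times> 'a rel \<Rightarrow> 'b set \<times> 'b rel \<Rightarrow> cord \<Rightarrow> 'a list \<Rightarrow> 'b list \<Rightarrow> bool"
  for A B where
  bfI: "atomic_eq A B as bs \<Longrightarrow>
    (\<And>\<beta> cs. \<beta> < \<alpha> \<Longrightarrow> set cs \<subseteq> fst A \<Longrightarrow>
      \<exists>ds. length ds = length cs \<and> set ds \<subseteq> fst B \<and> bf A B \<beta> (as @ cs) (bs @ ds)) \<Longrightarrow>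
    (\<And>\<beta> ds. \<beta> < \<alpha> \<Longrightarrow> set ds \<subseteq> fst B \<Longrightarrow>
      \<exists>cs. length cs = length ds \<and> set cs \<subseteq> fst A \<and> bf A B \<beta> (as @ cs) (bs @ ds)) \<Longrightarrow>
    bf A B \<alpha> as bs"

lemma bf_atomic: "bf A B \<alpha> as bs \<Longrightarrow> atomic_eq A B as bs"
  by (erule bf.cases) simp

lemma bf_length: "bf A B \<alpha> as bs \<Longrightarrow> length as = length bs"
  by (drule bf_atomic) (simp add: atomic_eq_def)

lemma bf_forth:
  assumes "bf A B \<alpha> as bs" "\<beta> < \<alpha>" "set cs \<subseteq> fst A"
  obtains ds where "length ds = length cs" "set ds \<subseteq> fst B" "bf A B \<beta> (as @ cs) (bs @ ds)"
  using assms by (blast elim: bf.cases)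

lemma bf_back:
  assumes "bf A B \<alpha> as bs" "\<beta> < \<alpha>" "set ds \<subseteq> fst B"
  obtains cs where "length cs = length ds" "set cs \<subseteq> fst A" "bf A B \<beta> (as @ cs) (bs @ ds)"
  using assms by (blast elim: bf.cases)

lemma bf_mono: "bf A B \<alpha> as bs \<Longrightarrow> \<beta> \<le> \<alpha> \<Longrightarrow> bf A B \<beta> as bs"
  by (rule bfI) (auto dest: bf_atomic elim: bf_forth[OF _ less_le_trans] bf_back[OF _ less_le_trans])

lemma bf_sym: "bf A B \<alpha> as bs \<Longrightarrow> bf B A \<alpha> bs as"
proof (induction rule: bf.induct)
  case (bfI as bs \<alpha>)
  show ?case
  proof (rule bf.bfI)
    show "atomic_eq B A bs as" using bfI(1) by (auto simp: atomic_eq_def)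
  qed (use bfI in blast)+
qed

lemma atomic_eq_trans:
  "atomic_eq A B as bs \<Longrightarrow> atomic_eq B C bs cs \<Longrightarrow> atomic_eq A C as cs"
  by (auto simp: atomic_eq_def)

lemma bf_trans: "bf A B \<alpha> as bs \<Longrightarrow> bf B C \<alpha> bs cs \<Longrightarrow> bf A C \<alpha> as cs"
proof (induction \<alpha> arbitrary: as bs cs rule: less_induct)
  case (less \<alpha>)
  show ?case
  proof (rule bfI)
    show "atomic_eq A C as cs" using atomic_eq_trans[OF bf_atomic bf_atomic] less.prems by blast
  next
    fix \<beta> xs assume "\<beta> < \<alpha>" "set xs \<subseteq> fst A"
    then show "\<exists>zs. length zs = length xs \<and> set zs \<subseteq> fst C \<and> bf A C \<beta> (as @ xs) (cs @ zs)"
      using less by (metis bf_forth)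
  next
    fix \<beta> zs assume "\<beta> < \<alpha>" "set zs \<subseteq> fst C"
    then show "\<exists>xs. length xs = length zs \<and> set xs \<subseteq> fst A \<and> bf A C \<beta> (as @ xs) (cs @ zs)"
      using less by (metis bf_back)
  qed
qed

text \<open>\<open>ks\<close> may drop, repeat and permute positions, so agreement passes to any
  subtuple. In the induction, the entries appended in a round are addressed by the positions behind
  \<open>as\<close>.\<close>

lemma bf_reindex:
  assumes "bf A B \<alpha> as bs" "set ks \<subseteq> {..<length as}"
  shows "bf A B \<alpha> (map ((!) as) ks) (map ((!) bs) ks)"
  using assms
proof (induction \<alpha> arbitrary: as bs ks rule: less_induct)
  case (less \<alpha>)
  have len: "length as = length bs" using less.prems bf_length by blast
  have app: "map ((!) (xs @ ys)) (ks @ [length xs..<length xs + length ys]) = map ((!) xs) ks @ ys"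
    if "set ks \<subseteq> {..<length xs}" for xs ys :: "'x list"
  proof -
    have "map ((!) (xs @ ys)) [length xs..<length xs + length ys] = ys"
      by (rule nth_equalityI) auto
    moreover have "map ((!) (xs @ ys)) ks = map ((!) xs) ks"
      using that by (auto simp: nth_append)
    ultimately show ?thesis by simp
  qed
  show ?case
  proof (rule bfI)
    show "atomic_eq A B (map ((!) as) ks) (map ((!) bs) ks)"
      using bf_atomic[OF less.prems(1)] less.prems(2)
      by (auto simp: atomic_eq_def subset_iff)
  next
    fix \<beta> cs assume \<beta>: "\<beta> < \<alpha>" and "set cs \<subseteq> fst A"
    then obtain ds where ds: "length ds = length cs" "set ds \<subseteq> fst B" "bf A B \<beta> (as @ cs) (bs @ ds)"
      using bf_forth less.prems by metis
    let ?ks = "ks @ [length as..<length as + length cs]"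
    have e: "map ((!) (as @ cs)) ?ks = map ((!) as) ks @ cs" "map ((!) (bs @ ds)) ?ks = map ((!) bs) ks @ ds"
      using app[of as cs] app[of bs ds] less.prems(2) len ds(1) by simp_all
    have "bf A B \<beta> (map ((!) (as @ cs)) ?ks) (map ((!) (bs @ ds)) ?ks)"
      by (rule less.IH[OF \<beta> ds(3)]) (use less.prems(2) in auto)
    with ds show "\<exists>ds. length ds = length cs \<and> set ds \<subseteq> fst B \<and>
        bf A B \<beta> (map ((!) as) ks @ cs) (map ((!) bs) ks @ ds)" unfolding e by blast
  next
    fix \<beta> ds assume \<beta>: "\<beta> < \<alpha>" and "set ds \<subseteq> fst B"
    then obtain cs where cs: "length cs = length ds" "set cs \<subseteq> fst A" "bf A B \<beta> (as @ cs) (bs @ ds)"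
      using bf_back less.prems by metis
    let ?ks = "ks @ [length as..<length as + length cs]"
    have e: "map ((!) (as @ cs)) ?ks = map ((!) as) ks @ cs" "map ((!) (bs @ ds)) ?ks = map ((!) bs) ks @ ds"
      using app[of as cs] app[of bs ds] less.prems(2) len cs(1) by simp_all
    have "bf A B \<beta> (map ((!) (as @ cs)) ?ks) (map ((!) (bs @ ds)) ?ks)"
      by (rule less.IH[OF \<beta> cs(3)]) (use less.prems(2) in auto)
    with cs show "\<exists>cs. length cs = length ds \<and> set cs \<subseteq> fst A \<and>
        bf A B \<beta> (map ((!) as) ks @ cs) (map ((!) bs) ks @ ds)" unfolding e by blast
  qed
qed

lemma bf_iso:
  assumes h: "bij_betw h (fst A) (fst B)"
    and R: "\<And>x y. x \<in> fst A \<Longrightarrow> y \<in> fst A \<Longrightarrow> (x, y) \<in> snd A \<longleftrightarrow> (h x, h y) \<in> snd B"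
    and "set as \<subseteq> fst A"
  shows "bf A B \<alpha> as (map h as)"
  using assms(3)
proof (induction \<alpha> arbitrary: as rule: less_induct)
  case (less \<alpha>)
  have inj: "x \<in> fst A \<Longrightarrow> y \<in> fst A \<Longrightarrow> h x = h y \<longleftrightarrow> x = y" for x y
    using h by (auto simp: bij_betw_def inj_on_def)
  show ?case
  proof (rule bfI)
    show "atomic_eq A B as (map h as)"
      using less.prems by (auto simp: atomic_eq_def subset_iff inj R)
  next
    fix \<beta> cs assume "\<beta> < \<alpha>" "set cs \<subseteq> fst A"
    then show "\<exists>ds. length ds = length cs \<and> set ds \<subseteq> fst B \<and> bf A B \<beta> (as @ cs) (map h as @ ds)"
      using less.IH[of \<beta> "as @ cs"] less.prems h
      by (intro exI[of _ "map h cs"]) (auto simp: bij_betw_def)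
  next
    fix \<beta> ds assume b: "\<beta> < \<alpha>" "set ds \<subseteq> fst B"
    define cs where "cs = map (inv_into (fst A) h) ds"
    have "set cs \<subseteq> fst A" "ds = map h cs"
      using h b(2) by (auto simp: cs_def bij_betw_def inv_into_into f_inv_into_f subset_iff intro!: map_idI[symmetric])
    then show "\<exists>cs. length cs = length ds \<and> set cs \<subseteq> fst A \<and> bf A B \<beta> (as @ cs) (map h as @ ds)"
      using less.IH[OF b(1), of "as @ cs"] less.prems by (intro exI[of _ cs]) auto
  qed
qed

text \<open>A reply of level \<beta> < \<mu> is found by playing from level
  \<open>cord_succ \<beta>\<close>, which is again below \<mu>.\<close>

lemma bf_limit:
  assumes "limit_cord \<mu>" and bf: "\<And>\<beta>. \<beta> < \<mu> \<Longrightarrow> bf A B \<beta> as bs"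
  shows "bf A B \<mu> as bs"
proof (rule bfI)
  obtain \<beta> where "\<beta> < \<mu>" using assms(1) by (auto simp: limit_cord_def)
  then show "atomic_eq A B as bs" using bf bf_atomic by blast
qed (meson assms limit_cord_succ less_cord_succ bf_forth bf_back)+

section \<open>Truth of formulas and back-and-forth equivalence\<close>

primrec upds :: "(nat \<Rightarrow> nat) \<Rightarrow> nat list \<Rightarrow> nat list \<Rightarrow> nat \<Rightarrow> nat" where
  "upds v [] cs = v"
| "upds v (y # ys) cs = upds (v(y := hd cs)) ys (tl cs)"

lemma sat_foldr_Ex:
  "sat A v (foldr Ex ys \<psi>) \<longleftrightarrow> (\<exists>cs. length cs = length ys \<and> set cs \<subseteq> fst A \<and> sat A (upds v ys cs) \<psi>)"
proof (induction ys arbitrary: v)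
  case (Cons y ys)
  have "(\<exists>cs. length cs = length (y # ys) \<and> set cs \<subseteq> fst A \<and> sat A (upds v (y # ys) cs) \<psi>) \<longleftrightarrow>
    (\<exists>a cs. length cs = length ys \<and> a \<in> fst A \<and> set cs \<subseteq> fst A \<and> sat A (upds (v(y := a)) ys cs) \<psi>)"
    (is "?L = ?R")
  proof
    assume ?L
    then obtain cs where cs: "length cs = length (y # ys)" "set cs \<subseteq> fst A" "sat A (upds v (y # ys) cs) \<psi>"
      by blast
    then obtain a cs' where "cs = a # cs'" by (cases cs) auto
    with cs show ?R by auto
  next
    assume ?R
    then obtain a cs where "length cs = length ys" "a \<in> fst A" "set cs \<subseteq> fst A"
      "sat A (upds (v(y := a)) ys cs) \<psi>" by blast
    then show ?L by (intro exI[of _ "a # cs"]) auto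
  qed
  moreover have "sat A v (foldr Ex (y # ys) \<psi>) \<longleftrightarrow> (\<exists>a\<in>fst A. \<exists>cs. length cs = length ys \<and>
      set cs \<subseteq> fst A \<and> sat A (upds (v(y := a)) ys cs) \<psi>)"
    by (simp only: foldr.simps o_apply sat.simps Cons)
  ultimately show ?case by blast
qed simp

lemma sat_foldr_All:
  "sat A v (foldr All ys \<psi>) \<longleftrightarrow> (\<forall>cs. length cs = length ys \<and> set cs \<subseteq> fst A \<longrightarrow> sat A (upds v ys cs) \<psi>)"
proof -
  have "sat A v (foldr All ys \<psi>) \<longleftrightarrow> \<not> sat A v (foldr Ex ys (Neg \<psi>))"
    by (induction ys arbitrary: v) auto
  then show ?thesis by (simp add: sat_foldr_Ex) blast
qed

lemma free_vars_foldr [simp]: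
  "free_vars (foldr Ex ys \<psi>) = free_vars \<psi> - set ys"
  "free_vars (foldr All ys \<psi>) = free_vars \<psi> - set ys"
  by (induction ys) auto

lemma upds_notin: "x \<notin> set ys \<Longrightarrow> upds v ys cs x = v x"
  by (induction ys arbitrary: v cs) auto

text \<open>The position \<open>i\<close> is chosen before \<open>v\<close> and \<open>cs\<close>,
  so that \<open>covers_upds\<close> can use the same one for both structures. With a repeated
  variable the last occurrence counts, as for nested quantifiers.\<close>

lemma upds_in: "x \<in> set ys \<Longrightarrow> \<exists>i<length ys. \<forall>v cs. length cs = length ys \<longrightarrow> upds v ys cs x = cs ! i"
proof (induction ys)
  case (Cons y ys)
  show ?case
  proof (cases "x \<in> set ys")
    case True
    then obtain i where "i < length ys" "\<forall>v cs. length cs = length ys \<longrightarrow> upds v ys cs x = cs ! i"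
      using Cons by blast
    then show ?thesis
      by (intro exI[of _ "Suc i"]) (auto simp: nth_tl)
  next
    case False
    then show ?thesis using Cons.prems
      by (intro exI[of _ 0]) (auto simp: upds_notin intro!: hd_conv_nth)
  qed
qed simp

lemma upds_upt: "length cs = k \<Longrightarrow> map (upds v [n..<n + k] cs) [0..<n + k] = map v [0..<n] @ cs"
proof -
  have *: "upds v [n..<n + length cs] cs (n + i) = cs ! i" if "i < length cs" for i
    using that
  proof (induction cs arbitrary: v n i)
    case (Cons c cs)
    have eq: "[n..<n + length (c # cs)] = n # [Suc n..<Suc n + length cs]"
      using upt_conv_Cons[of n "n + length (c # cs)"] by simp
    show ?case
    proof (cases i)
      case 0
      then show ?thesis unfolding eq by (simp add: upds_notin del: upt_Suc)
    next
      case (Suc j)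
      have "upds (v(n := c)) [Suc n..<Suc n + length cs] cs (Suc n + j) = cs ! j"
        by (rule Cons.IH) (use Suc Cons.prems in simp)
      then show ?thesis unfolding eq Suc by (simp only: upds.simps list.sel nth_Cons_Suc add_Suc_right add_Suc)
    qed
  qed simp
  assume k: "length cs = k"
  show ?thesis
  proof (rule nth_equalityI)
    fix i assume "i < length (map (upds v [n..<n + k] cs) [0..<n + k])"
    then show "map (upds v [n..<n + k] cs) [0..<n + k] ! i = (map v [0..<n] @ cs) ! i"
      using *[of "i - n"] k by (cases "i < n") (simp_all add: nth_append upds_notin)
  qed (simp add: k)
qed

text \<open>Formulas speak about variables and \<open>bf\<close> about tuples; this is the link.
  Several variables may share a position, and positions may be left over.\<close>

definition covers :: "nat set \<Rightarrow> (nat \<Rightarrow> nat) \<Rightarrow> (nat \<Rightarrow> nat) \<Rightarrow> nat list \<Rightarrow> nat list \<Rightarrow> bool" where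
  "covers V v w as bs \<longleftrightarrow> (\<forall>x\<in>V. \<exists>i<length as. v x = as ! i \<and> w x = bs ! i)"

lemma covers_upds:
  assumes "covers (V - set ys) v w as bs" "length as = length bs"
    and "length cs = length ys" "length ds = length ys"
  shows "covers V (upds v ys cs) (upds w ys ds) (as @ cs) (bs @ ds)"
  unfolding covers_def
proof
  fix x assume x: "x \<in> V"
  show "\<exists>i<length (as @ cs). upds v ys cs x = (as @ cs) ! i \<and> upds w ys ds x = (bs @ ds) ! i"
  proof (cases "x \<in> set ys")
    case True
    then obtain i where "i < length ys" "\<forall>v cs. length cs = length ys \<longrightarrow> upds v ys cs x = cs ! i"
      using upds_in by blast
    then show ?thesis using assms
      by (intro exI[of _ "length as + i"]) (auto simp: nth_append)
  next
    case False
    then obtain i where "i < length as" "v x = as ! i" "w x = bs ! i"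
      using x assms(1) by (auto simp: covers_def)
    then show ?thesis using False assms(2) by (intro exI[of _ i]) (auto simp: upds_notin nth_append)
  qed
qed

lemma finitary_qf_sat:
  assumes "finitary_qf \<phi>" "atomic_eq A B as bs" "covers (free_vars \<phi>) v w as bs"
  shows "sat A v \<phi> \<longleftrightarrow> sat B w \<phi>"
  using assms
proof (induction rule: finitary_qf.induct)
  case (4 I F)
  then have "sat A v (F i) \<longleftrightarrow> sat B w (F i)" if "i \<in> I" for i
    using that by (auto simp: covers_def)
  then show ?case by auto
next
  case (5 I F)
  then have "sat A v (F i) \<longleftrightarrow> sat B w (F i)" if "i \<in> I" for i
    using that by (auto simp: covers_def)
  then show ?case by auto
qed (fastforce simp: atomic_eq_def covers_def)+

text \<open>The quantifier block of a disjunct or conjunct corresponds to one round, played at the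
  level \<beta> < \<alpha> of its matrix. As \<open>bf\<close> is symmetric, truth values agree
  outright, and Sigma and Pi are handled by the same argument.\<close>

lemma bf_sat:
  shows "is_Sigma \<alpha> \<phi> \<Longrightarrow> bf A B \<alpha> as bs \<Longrightarrow> covers (free_vars \<phi>) v w as bs \<Longrightarrow> sat A v \<phi> \<longleftrightarrow> sat B w \<phi>"
    and "is_Pi \<alpha> \<phi> \<Longrightarrow> bf A B \<alpha> as bs \<Longrightarrow> covers (free_vars \<phi>) v w as bs \<Longrightarrow> sat A v \<phi> \<longleftrightarrow> sat B w \<phi>"
proof (induction arbitrary: as bs v w and as bs v w rule: is_Sigma_is_Pi.inducts)
  case (Sigma_zero \<alpha> \<phi>)
  then show ?case using finitary_qf_sat bf_atomic by blast
next
  case (Pi_zero \<alpha> \<phi>)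
  then show ?case using finitary_qf_sat bf_atomic by blast
next
  case (Sigma_pos \<gamma> \<alpha> I \<psi> ys)
  have "sat A v (foldr Ex (ys i) (\<psi> i)) \<longleftrightarrow> sat B w (foldr Ex (ys i) (\<psi> i))" if i: "i \<in> I" for i
  proof -
    obtain \<beta> where \<beta>: "\<beta> < \<alpha>" and IH: "\<And>as bs v w. bf A B \<beta> as bs \<Longrightarrow>
        covers (free_vars (\<psi> i)) v w as bs \<Longrightarrow> sat A v (\<psi> i) \<longleftrightarrow> sat B w (\<psi> i)"
      using Sigma_pos.IH[OF i] by blast
    have cov: "covers (free_vars (\<psi> i) - set (ys i)) v w as bs"
      using Sigma_pos.prems(2) i by (auto simp: covers_def)
    show ?thesis unfolding sat_foldr_Ex
      by (metis (no_types, lifting) IH cov covers_upds bf_forth[OF Sigma_pos.prems(1) \<beta>]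
        bf_back[OF Sigma_pos.prems(1) \<beta>] bf_length[OF Sigma_pos.prems(1)])
  qed
  then show ?case by auto
next
  case (Pi_pos \<gamma> \<alpha> I \<psi> ys)
  have "sat A v (foldr All (ys i) (\<psi> i)) \<longleftrightarrow> sat B w (foldr All (ys i) (\<psi> i))" if i: "i \<in> I" for i
  proof -
    obtain \<beta> where \<beta>: "\<beta> < \<alpha>" and IH: "\<And>as bs v w. bf A B \<beta> as bs \<Longrightarrow>
        covers (free_vars (\<psi> i)) v w as bs \<Longrightarrow> sat A v (\<psi> i) \<longleftrightarrow> sat B w (\<psi> i)"
      using Pi_pos.IH[OF i] by blast
    have cov: "covers (free_vars (\<psi> i) - set (ys i)) v w as bs"
      using Pi_pos.prems(2) i by (auto simp: covers_def)
    show ?thesis unfolding sat_foldr_All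
      by (metis (no_types, lifting) IH cov covers_upds bf_forth[OF Pi_pos.prems(1) \<beta>]
        bf_back[OF Pi_pos.prems(1) \<beta>] bf_length[OF Pi_pos.prems(1)])
  qed
  then show ?case by auto
qed

section \<open>Definability of back-and-forth types\<close>

lemma Pi_Conj_countable:
  fixes J :: "'t set"
  assumes "countable J" "\<gamma> < \<alpha>" "\<And>t. t \<in> J \<Longrightarrow> \<exists>\<beta><\<alpha>. is_Sigma \<beta> (\<psi> t)"
  obtains \<phi> where "is_Pi \<alpha> \<phi>" "free_vars \<phi> = (\<Union>t\<in>J. free_vars (\<psi> t) - set (ys t))"
    "\<And>A v. sat A v \<phi> \<longleftrightarrow> (\<forall>t\<in>J. sat A v (foldr All (ys t) (\<psi> t)))"
proof
  define h where "h = inv_into J (to_nat_on J)"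
  have h: "h (to_nat_on J t) = t" if "t \<in> J" for t
    using assms(1) that by (simp add: h_def inj_on_to_nat_on)
  let ?\<phi> = "Conj (to_nat_on J ` J) (\<lambda>i. foldr All (ys (h i)) (\<psi> (h i)))"
  show "is_Pi \<alpha> ?\<phi>"
    using assms(2,3) by (intro Pi_pos) (auto simp: h)
  show "free_vars ?\<phi> = (\<Union>t\<in>J. free_vars (\<psi> t) - set (ys t))"
    by (simp add: h)
  show "sat A v ?\<phi> \<longleftrightarrow> (\<forall>t\<in>J. sat A v (foldr All (ys t) (\<psi> t)))" for A v
    by (simp add: h)
qed

lemma Sigma_Disj_countable:
  fixes J :: "'t set"
  assumes "countable J" "\<gamma> < \<alpha>" "\<And>t. t \<in> J \<Longrightarrow> \<exists>\<beta><\<alpha>. is_Pi \<beta> (\<psi> t)"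
  obtains \<phi> where "is_Sigma \<alpha> \<phi>" "free_vars \<phi> = (\<Union>t\<in>J. free_vars (\<psi> t) - set (ys t))"
    "\<And>A v. sat A v \<phi> \<longleftrightarrow> (\<exists>t\<in>J. sat A v (foldr Ex (ys t) (\<psi> t)))"
proof
  define h where "h = inv_into J (to_nat_on J)"
  have h: "h (to_nat_on J t) = t" if "t \<in> J" for t
    using assms(1) that by (simp add: h_def inj_on_to_nat_on)
  let ?\<phi> = "Disj (to_nat_on J ` J) (\<lambda>i. foldr Ex (ys (h i)) (\<psi> (h i)))"
  show "is_Sigma \<alpha> ?\<phi>"
    using assms(2,3) by (intro Sigma_pos) (auto simp: h)
  show "free_vars ?\<phi> = (\<Union>t\<in>J. free_vars (\<psi> t) - set (ys t))"
    by (simp add: h)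
  show "sat A v ?\<phi> \<longleftrightarrow> (\<exists>t\<in>J. sat A v (foldr Ex (ys t) (\<psi> t)))" for A v
    by (simp add: h)
qed

definition defines_bf :: "'a set \<times> 'a rel \<Rightarrow> cord \<Rightarrow> 'a list \<Rightarrow> fm \<Rightarrow> bool" where
  "defines_bf A \<beta> as \<phi> \<longleftrightarrow> free_vars \<phi> \<subseteq> {..<length as} \<and>
    (\<forall>B w. sat B w \<phi> \<longleftrightarrow> bf A B \<beta> as (map w [0..<length as]))"

lemma defines_bfD:
  assumes "defines_bf A \<beta> as \<phi>"
  shows "free_vars \<phi> \<subseteq> {..<length as}" "sat B w \<phi> \<longleftrightarrow> bf A B \<beta> as (map w [0..<length as])"
proof -
  show "free_vars \<phi> \<subseteq> {..<length as}"
    using assms unfolding defines_bf_def by (rule conjunct1)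
  have "\<forall>B w. sat B w \<phi> \<longleftrightarrow> bf A B \<beta> as (map w [0..<length as])"
    using assms unfolding defines_bf_def by (rule conjunct2)
  then have "\<forall>w. sat B w \<phi> \<longleftrightarrow> bf A B \<beta> as (map w [0..<length as])" by (rule spec)
  then show "sat B w \<phi> \<longleftrightarrow> bf A B \<beta> as (map w [0..<length as])" by (rule spec)
qed

lemma atomic_diagram:
  obtains \<phi> where "finitary_qf \<phi>" "free_vars \<phi> \<subseteq> {..<length as}"
    "\<And>B w. sat B w \<phi> \<longleftrightarrow> atomic_eq A B as (map w [0..<length as])"
proof
  define lit where "lit b \<phi> = (if b then \<phi> else Neg \<phi>)" for b \<phi>
  have lit: "sat B w (lit b \<phi>) \<longleftrightarrow> (b \<longleftrightarrow> sat B w \<phi>)" for B w b \<phi>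
    by (simp add: lit_def)
  let ?\<phi> = "Conj {..<length as} (\<lambda>i. Conj {..<length as} (\<lambda>j. Conj {0, 1} (\<lambda>k::nat.
    if k = 0 then lit (as ! i = as ! j) (Eq i j) else lit ((as ! i, as ! j) \<in> snd A) (Rel i j))))"
  show "finitary_qf ?\<phi>"
    by (auto intro!: finitary_qf.intros simp: lit_def)
  show "free_vars ?\<phi> \<subseteq> {..<length as}"
    by (auto simp: lit_def split: if_splits)
  show "sat B w ?\<phi> \<longleftrightarrow> atomic_eq A B as (map w [0..<length as])" for B w
    by (auto simp: atomic_eq_def lit)
qed

text \<open>This keeps the defining formulas low: a successor has a single relevant smaller level,
  and only at a limit are all of them taken.\<close>

lemma bf_iff_cofinal:
  assumes cof: "\<Gamma> \<subseteq> {..<\<beta>}" "\<And>\<gamma>. \<gamma> < \<beta> \<Longrightarrow> \<exists>\<gamma>'\<in>\<Gamma>. \<gamma> \<le> \<gamma>'" and ex: "\<gamma>0 < \<beta>"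
  shows "bf A B \<beta> as bs \<longleftrightarrow> (\<forall>\<gamma>\<in>\<Gamma>.
    (\<forall>ds. set ds \<subseteq> fst B \<longrightarrow> (\<exists>cs. length cs = length ds \<and> set cs \<subseteq> fst A \<and> bf A B \<gamma> (as @ cs) (bs @ ds))) \<and>
    (\<forall>cs. set cs \<subseteq> fst A \<longrightarrow> (\<exists>ds. length ds = length cs \<and> set ds \<subseteq> fst B \<and> bf A B \<gamma> (as @ cs) (bs @ ds))))"
    (is "_ \<longleftrightarrow> ?R")
proof
  assume "bf A B \<beta> as bs"
  then show ?R using cof(1) by (meson bf_back bf_forth lessThan_iff subsetD)
next
  assume R: ?R
  obtain \<gamma>1 where "\<gamma>1 \<in> \<Gamma>" using cof(2) ex by blast
  \<comment> \<open>The empty tuple as a move returns the given tuples at level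
    \<open>\<gamma>1\<close>; this is where atomic agreement comes from.\<close>
  have "\<exists>cs. length cs = length [] \<and> set cs \<subseteq> fst A \<and> bf A B \<gamma>1 (as @ cs) (bs @ [])"
    using R[THEN bspec, OF \<open>\<gamma>1 \<in> \<Gamma>\<close>, THEN conjunct1, rule_format, of "[]"] by simp
  then have "bf A B \<gamma>1 as bs" by auto
  then show "bf A B \<beta> as bs"
  proof (intro bfI)
    show "atomic_eq A B as bs" using \<open>bf A B \<gamma>1 as bs\<close> by (rule bf_atomic)
  next
    fix \<gamma> cs assume "\<gamma> < \<beta>" and cs: "set cs \<subseteq> fst A"
    then obtain \<gamma>' where \<gamma>': "\<gamma>' \<in> \<Gamma>" "\<gamma> \<le> \<gamma>'" using cof(2) by blast
    then show "\<exists>ds. length ds = length cs \<and> set ds \<subseteq> fst B \<and> bf A B \<gamma> (as @ cs) (bs @ ds)"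
      using R[THEN bspec, OF \<gamma>'(1), THEN conjunct2, rule_format, OF cs] bf_mono[OF _ \<gamma>'(2)] by metis
  next
    fix \<gamma> ds assume "\<gamma> < \<beta>" and ds: "set ds \<subseteq> fst B"
    then obtain \<gamma>' where \<gamma>': "\<gamma>' \<in> \<Gamma>" "\<gamma> \<le> \<gamma>'" using cof(2) by blast
    then show "\<exists>cs. length cs = length ds \<and> set cs \<subseteq> fst A \<and> bf A B \<gamma> (as @ cs) (bs @ ds)"
      using R[THEN bspec, OF \<gamma>'(1), THEN conjunct1, rule_format, OF ds] bf_mono[OF _ \<gamma>'(2)] by metis
  qed
qed

text \<open>The clauses of \<open>bf\<close> are written out. \<open>X \<gamma> k\<close> says that
  the last k variables are matched by some tuple of \<open>A\<close>, a countable disjunction;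
  \<open>Y \<gamma> cs\<close> says that some tuple matches \<open>cs\<close>. Either costs one
  Sigma step over \<open>g \<gamma>\<close>, and the conjunction over all \<gamma>, k and
  \<open>cs\<close> is the Pi step to \<delta>.\<close>

lemma Scott_formula_step:
  assumes A: "countable (fst A)"
    and \<Gamma>: "countable \<Gamma>" "\<Gamma> \<subseteq> {..<\<beta>}" "\<And>\<gamma>. \<gamma> < \<beta> \<Longrightarrow> \<exists>\<gamma>'\<in>\<Gamma>. \<gamma> \<le> \<gamma>'" "\<gamma>0 < \<beta>"
    and g: "\<And>\<gamma>. \<gamma> \<in> \<Gamma> \<Longrightarrow> cord_succ (g \<gamma>) < \<delta>"
    and \<Phi>: "\<And>\<gamma> as. \<gamma> \<in> \<Gamma> \<Longrightarrow> set as \<subseteq> fst A \<Longrightarrow> is_Pi (g \<gamma>) (\<Phi> \<gamma> as) \<and> defines_bf A \<gamma> as (\<Phi> \<gamma> as)"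
    and as: "set as \<subseteq> fst A"
  obtains \<phi> where "is_Pi \<delta> \<phi>" "defines_bf A \<beta> as \<phi>"
proof -
  let ?n = "length as"
  define C where "C k = {cs. length cs = k \<and> set cs \<subseteq> fst A}" for k
  have cC: "countable (C k)" for k
    by (rule countable_subset[OF _ countable_lists[OF A]]) (auto simp: C_def)
  have cC': "countable (lists (fst A))" using A by (rule countable_lists)
  have ex\<Gamma>: "\<exists>\<gamma>. \<gamma> \<in> \<Gamma>" using \<Gamma>(3,4) by blast
  then have \<delta>: "g (SOME \<gamma>. \<gamma> \<in> \<Gamma>) < \<delta>"
    using g less_cord_succ less_trans someI_ex by metis
  have "\<exists>\<chi>. is_Sigma (cord_succ (g \<gamma>)) \<chi> \<and> free_vars \<chi> \<subseteq> {..<?n + k} \<and>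
      (\<forall>B w. sat B w \<chi> \<longleftrightarrow> (\<exists>cs\<in>C k. bf A B \<gamma> (as @ cs) (map w [0..<?n + k])))" if "\<gamma> \<in> \<Gamma>" for \<gamma> k
  proof -
    have "\<exists>\<beta><cord_succ (g \<gamma>). is_Pi \<beta> (\<Phi> \<gamma> (as @ cs))" if "cs \<in> C k" for cs
      using \<Phi>[OF \<open>\<gamma> \<in> \<Gamma>\<close>, of "as @ cs"] as that less_cord_succ by (auto simp: C_def)
    then obtain \<chi> where \<chi>: "is_Sigma (cord_succ (g \<gamma>)) \<chi>"
      "free_vars \<chi> = (\<Union>cs\<in>C k. free_vars (\<Phi> \<gamma> (as @ cs)) - set [])"
      "\<And>A v. sat A v \<chi> \<longleftrightarrow> (\<exists>cs\<in>C k. sat A v (foldr Ex [] (\<Phi> \<gamma> (as @ cs))))"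
      using Sigma_Disj_countable[OF cC less_cord_succ, of k "g \<gamma>" "\<lambda>cs. \<Phi> \<gamma> (as @ cs)" "\<lambda>_. []"]
      by metis
    have \<Phi>': "free_vars (\<Phi> \<gamma> (as @ cs)) \<subseteq> {..<?n + k}"
      "sat B w (\<Phi> \<gamma> (as @ cs)) \<longleftrightarrow> bf A B \<gamma> (as @ cs) (map w [0..<?n + k])"
      if "cs \<in> C k" for cs B w
      using defines_bfD[of A \<gamma> "as @ cs" "\<Phi> \<gamma> (as @ cs)"] \<Phi>[OF \<open>\<gamma> \<in> \<Gamma>\<close>, of "as @ cs"] as that
      by (auto simp: C_def)
    have "free_vars \<chi> \<subseteq> {..<?n + k}" unfolding \<chi>(2) using \<Phi>'(1) by blast
    moreover have "sat B w \<chi> \<longleftrightarrow> (\<exists>cs\<in>C k. bf A B \<gamma> (as @ cs) (map w [0..<?n + k]))" for B w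
      unfolding \<chi>(3) using \<Phi>'(2) by simp
    ultimately show ?thesis using \<chi>(1) by blast
  qed
  then obtain X where X: "\<And>\<gamma> k. \<gamma> \<in> \<Gamma> \<Longrightarrow> is_Sigma (cord_succ (g \<gamma>)) (X \<gamma> k) \<and> free_vars (X \<gamma> k) \<subseteq> {..<?n + k} \<and>
      (\<forall>B w. sat B w (X \<gamma> k) \<longleftrightarrow> (\<exists>cs\<in>C k. bf A B \<gamma> (as @ cs) (map w [0..<?n + k])))"
    by metis
  have "\<exists>\<chi>. is_Sigma (cord_succ (g \<gamma>)) \<chi> \<and> free_vars \<chi> \<subseteq> {..<?n} \<and>
      (\<forall>B w. sat B w \<chi> \<longleftrightarrow> (\<exists>ds. length ds = length cs \<and> set ds \<subseteq> fst B \<and>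
        bf A B \<gamma> (as @ cs) (map w [0..<?n] @ ds)))" if "\<gamma> \<in> \<Gamma>" "cs \<in> lists (fst A)" for \<gamma> cs
  proof -
    have \<Phi>': "is_Pi (g \<gamma>) (\<Phi> \<gamma> (as @ cs)) \<and> defines_bf A \<gamma> (as @ cs) (\<Phi> \<gamma> (as @ cs))"
      using that(2) as by (intro \<Phi>[OF that(1)]) auto
    then have "\<exists>\<beta><cord_succ (g \<gamma>). is_Pi \<beta> (\<Phi> \<gamma> (as @ cs))"
      using less_cord_succ by blast
    then obtain \<chi> where \<chi>: "is_Sigma (cord_succ (g \<gamma>)) \<chi>"
      "free_vars \<chi> = (\<Union>i\<in>{()}. free_vars (\<Phi> \<gamma> (as @ cs)) - set [?n..<?n + length cs])"
      "\<And>A v. sat A v \<chi> \<longleftrightarrow> (\<exists>i\<in>{()}. sat A v (foldr Ex [?n..<?n + length cs] (\<Phi> \<gamma> (as @ cs))))"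
      using Sigma_Disj_countable[of "{()}" "g \<gamma>" "cord_succ (g \<gamma>)" "\<lambda>_. \<Phi> \<gamma> (as @ cs)"
        "\<lambda>_. [?n..<?n + length cs]"] less_cord_succ by (metis countable_finite finite.emptyI finite.insertI)
    have "sat B w \<chi> \<longleftrightarrow> (\<exists>ds. length ds = length cs \<and> set ds \<subseteq> fst B \<and>
        bf A B \<gamma> (as @ cs) (map w [0..<?n] @ ds))" for B w
    proof -
      have "sat B w \<chi> \<longleftrightarrow> (\<exists>ds. length ds = length cs \<and> set ds \<subseteq> fst B \<and>
          bf A B \<gamma> (as @ cs) (map (upds w [?n..<?n + length cs] ds) [0..<?n + length cs]))"
        using defines_bfD(2)[OF conjunct2[OF \<Phi>']] by (simp add: \<chi>(3) sat_foldr_Ex)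
      then show ?thesis by (metis upds_upt)
    qed
    moreover have "free_vars \<chi> \<subseteq> {..<?n}"
      using \<Phi>' by (auto simp: \<chi>(2) defines_bf_def)
    ultimately show ?thesis using \<chi>(1) by blast
  qed
  then obtain Y where Y: "\<And>\<gamma> cs. \<gamma> \<in> \<Gamma> \<Longrightarrow> cs \<in> lists (fst A) \<Longrightarrow>
      is_Sigma (cord_succ (g \<gamma>)) (Y \<gamma> cs) \<and> free_vars (Y \<gamma> cs) \<subseteq> {..<?n} \<and>
      (\<forall>B w. sat B w (Y \<gamma> cs) \<longleftrightarrow> (\<exists>ds. length ds = length cs \<and> set ds \<subseteq> fst B \<and>
        bf A B \<gamma> (as @ cs) (map w [0..<?n] @ ds)))"
    by metis
  \<comment> \<open>\<open>Inl k\<close> stands for the moves of length k in \<open>B\<close>,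
    \<open>Inr cs\<close> for the move \<open>cs\<close> in \<open>A\<close>.\<close>
  let ?J = "\<Gamma> \<times> (Inl ` (UNIV :: nat set) \<union> Inr ` lists (fst A))"
  define \<psi> where "\<psi> = (\<lambda>(\<gamma>, t). case t of Inl k \<Rightarrow> X \<gamma> k | Inr cs \<Rightarrow> Y \<gamma> cs)"
  define ys where "ys = (\<lambda>(\<gamma> :: cord, t). case t of Inl k \<Rightarrow> [?n..<?n + k] | Inr (cs :: 'a list) \<Rightarrow> [])"
  have cJ: "countable ?J" using \<Gamma>(1) cC' by (intro countable_SIGMA countable_Un countable_image) auto
  have "\<exists>\<beta><\<delta>. is_Sigma \<beta> (\<psi> t)" if "t \<in> ?J" for t
  proof -
    obtain \<gamma> s where s: "t = (\<gamma>, s)" "\<gamma> \<in> \<Gamma>" "s \<in> Inl ` UNIV \<union> Inr ` lists (fst A)"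
      using \<open>t \<in> ?J\<close> by (cases t) auto
    then have "is_Sigma (cord_succ (g \<gamma>)) (\<psi> t)"
      using conjunct1[OF X[OF s(2)]] conjunct1[OF Y[OF s(2)]] unfolding s(1) \<psi>_def
      by (elim UnE imageE) (simp only: prod.case sum.case)+
    then show ?thesis using g[OF s(2)] by blast
  qed
  note sig = this
  obtain \<phi> where \<phi>: "is_Pi \<delta> \<phi>" "free_vars \<phi> = (\<Union>t\<in>?J. free_vars (\<psi> t) - set (ys t))"
    "\<And>A v. sat A v \<phi> \<longleftrightarrow> (\<forall>t\<in>?J. sat A v (foldr All (ys t) (\<psi> t)))"
  proof (rule Pi_Conj_countable[where \<psi> = \<psi> and ys = ys, OF cJ \<delta> sig])
    fix \<phi>
    assume "is_Pi \<delta> \<phi>" "free_vars \<phi> = (\<Union>t\<in>?J. free_vars (\<psi> t) - set (ys t))"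
      "\<And>A v. sat A v \<phi> \<longleftrightarrow> (\<forall>t\<in>?J. sat A v (foldr All (ys t) (\<psi> t)))"
    then show thesis by (rule that)
  qed
  have "free_vars \<phi> \<subseteq> {..<?n}"
  proof
    fix x assume "x \<in> free_vars \<phi>"
    then obtain \<gamma> t where t: "\<gamma> \<in> \<Gamma>" "t \<in> Inl ` (UNIV :: nat set) \<union> Inr ` lists (fst A)"
      "x \<in> free_vars (\<psi> (\<gamma>, t)) - set (ys (\<gamma>, t))" by (auto simp: \<phi>(2))
    show "x \<in> {..<?n}"
    proof (cases t)
      case (Inl k)
      then show ?thesis using t X[of \<gamma> k] by (auto simp: \<psi>_def ys_def)
    next
      case (Inr cs)
      then show ?thesis using t Y[of \<gamma> cs] by (auto simp: \<psi>_def ys_def)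
    qed
  qed
  moreover have "sat B w \<phi> \<longleftrightarrow> bf A B \<beta> as (map w [0..<?n])" for B w
  proof -
    let ?bs = "map w [0..<?n]"
    have 1: "(\<forall>k. sat B w (foldr All [?n..<?n + k] (X \<gamma> k))) \<longleftrightarrow>
      (\<forall>ds. set ds \<subseteq> fst B \<longrightarrow> (\<exists>cs. length cs = length ds \<and> set cs \<subseteq> fst A \<and> bf A B \<gamma> (as @ cs) (?bs @ ds)))"
      if "\<gamma> \<in> \<Gamma>" for \<gamma>
    proof -
      have "sat B w (foldr All [?n..<?n + k] (X \<gamma> k)) \<longleftrightarrow> (\<forall>ds. length ds = k \<and> set ds \<subseteq> fst B \<longrightarrow>
        (\<exists>cs\<in>C k. bf A B \<gamma> (as @ cs) (?bs @ ds)))" for k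
        unfolding sat_foldr_All X[OF that, THEN conjunct2, THEN conjunct2, rule_format]
        by (metis add_diff_cancel_left' length_upt upds_upt)
      then show ?thesis by (auto simp: C_def)
    qed
    have 2: "(\<forall>cs\<in>lists (fst A). sat B w (Y \<gamma> cs)) \<longleftrightarrow>
      (\<forall>cs. set cs \<subseteq> fst A \<longrightarrow> (\<exists>ds. length ds = length cs \<and> set ds \<subseteq> fst B \<and> bf A B \<gamma> (as @ cs) (?bs @ ds)))"
      if "\<gamma> \<in> \<Gamma>" for \<gamma>
      using Y[OF that, THEN conjunct2, THEN conjunct2, rule_format, of _ B w] by (simp add: lists_eq_set)
    have "sat B w \<phi> \<longleftrightarrow> (\<forall>\<gamma>\<in>\<Gamma>. (\<forall>k. sat B w (foldr All [?n..<?n + k] (X \<gamma> k))) \<and>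
      (\<forall>cs\<in>lists (fst A). sat B w (Y \<gamma> cs)))"
      unfolding \<phi>(3) \<psi>_def ys_def by (simp add: ball_Un)
    also have "\<dots> \<longleftrightarrow> bf A B \<beta> as ?bs"
      
    proof -
      have "(\<forall>\<gamma>\<in>\<Gamma>. (\<forall>k. sat B w (foldr All [?n..<?n + k] (X \<gamma> k))) \<and> (\<forall>cs\<in>lists (fst A). sat B w (Y \<gamma> cs))) \<longleftrightarrow>
        (\<forall>\<gamma>\<in>\<Gamma>.
          (\<forall>ds. set ds \<subseteq> fst B \<longrightarrow> (\<exists>cs. length cs = length ds \<and> set cs \<subseteq> fst A \<and> bf A B \<gamma> (as @ cs) (?bs @ ds))) \<and>
          (\<forall>cs. set cs \<subseteq> fst A \<longrightarrow> (\<exists>ds. length ds = length cs \<and> set ds \<subseteq> fst B \<and> bf A B \<gamma> (as @ cs) (?bs @ ds))))"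
        by (rule ball_cong[OF refl]) (simp only: 1 2)
      also have "\<dots> \<longleftrightarrow> bf A B \<beta> as ?bs"
        by (rule bf_iff_cofinal[OF \<Gamma>(2-4), symmetric])
      finally show ?thesis .
    qed
    finally show ?thesis .
  qed
  ultimately show thesis using \<phi>(1) that by (simp add: defines_bf_def)
qed

text \<open>One bound \<open>g\<close> serves all tuples, and its exact value is immaterial as long
  as it stays below the given limit \<nu>. Level zero costs one level, a successor two, a limit
  none.\<close>

lemma Scott_formula:
  assumes A: "countable (fst A)"
  shows "limit_cord \<nu> \<Longrightarrow> \<beta> < \<nu> \<Longrightarrow>
    \<exists>g<\<nu>. \<forall>as. set as \<subseteq> fst A \<longrightarrow> (\<exists>\<phi>. is_Pi g \<phi> \<and> defines_bf A \<beta> as \<phi>)"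
proof (induction \<beta> arbitrary: \<nu> rule: less_induct)
  case (less \<beta>)
  show ?case
  proof (cases \<beta> rule: cord_cases)
    case zero
    have "\<exists>\<phi>. is_Pi (cord_succ \<beta>) \<phi> \<and> defines_bf A \<beta> as \<phi>" for as
    proof -
      obtain \<phi> where \<phi>: "finitary_qf \<phi>" "free_vars \<phi> \<subseteq> {..<length as}"
        "\<And>B w. sat B w \<phi> \<longleftrightarrow> atomic_eq A B as (map w [0..<length as])"
        using atomic_diagram by metis
      have bf0: "bf A B \<beta> as bs \<longleftrightarrow> atomic_eq A B as bs" for B :: struct and bs
        using zero by (auto dest: bf_atomic intro!: bfI simp: not_less[symmetric])
      have "is_Sigma \<beta> \<phi>" using zero \<phi>(1) by (rule Sigma_zero)
      then have "is_Pi (cord_succ \<beta>) (Conj {0} (\<lambda>i. foldr All ((\<lambda>_. []) i) ((\<lambda>_. \<phi>) i)))"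
        using less_cord_succ by (intro Pi_pos) blast+
      then show ?thesis
        using \<phi>(2,3) by (intro exI conjI) (auto simp: defines_bf_def bf0)
    qed
    then show ?thesis using less.prems limit_cord_succ by blast
  next
    case (succ \<gamma>)
    then have \<gamma>: "\<gamma> < \<beta>" using less_cord_succ by simp
    then have "\<gamma> < \<nu>" using less.prems by simp
    then obtain g where g: "g < \<nu>" "\<forall>as. set as \<subseteq> fst A \<longrightarrow> (\<exists>\<phi>. is_Pi g \<phi> \<and> defines_bf A \<gamma> as \<phi>)"
      using less.IH[OF \<gamma> less.prems(1)] by blast
    then obtain \<Phi> where \<Phi>: "\<And>as. set as \<subseteq> fst A \<Longrightarrow> is_Pi g (\<Phi> as) \<and> defines_bf A \<gamma> as (\<Phi> as)"
      by metis
    have "\<exists>\<phi>. is_Pi (cord_succ (cord_succ g)) \<phi> \<and> defines_bf A \<beta> as \<phi>" if "set as \<subseteq> fst A" for as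
    proof -
      have "\<exists>\<gamma>'\<in>{\<gamma>}. \<gamma>'' \<le> \<gamma>'" if "\<gamma>'' < \<beta>" for \<gamma>''
        using that by (simp add: succ less_cord_succ_iff)
      note cof = this
      obtain \<phi> where "is_Pi (cord_succ (cord_succ g)) \<phi>" "defines_bf A \<beta> as \<phi>"
        by (rule Scott_formula_step[OF A, of "{\<gamma>}" \<beta> \<gamma> "\<lambda>_. g" "cord_succ (cord_succ g)" "\<lambda>_. \<Phi>" as])
          (use \<gamma> \<Phi> less_cord_succ \<open>set as \<subseteq> fst A\<close> cof in auto)
      then show ?thesis by blast
    qed
    then show ?thesis using g(1) less.prems(1) limit_cord_succ by blast
  next
    case limit
    \<comment> \<open>The induction hypothesis is used with \<beta> itself as the limit, so all
      bounds lie below \<beta> and the conjunction has level \<beta>.\<close>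
    have "\<exists>g<\<beta>. \<forall>as. set as \<subseteq> fst A \<longrightarrow> (\<exists>\<phi>. is_Pi g \<phi> \<and> defines_bf A \<gamma> as \<phi>)" if "\<gamma> < \<beta>" for \<gamma>
      using less.IH[OF that limit that] .
    then obtain g \<Phi> where g: "\<And>\<gamma>. \<gamma> < \<beta> \<Longrightarrow> g \<gamma> < \<beta>" and
      \<Phi>: "\<And>\<gamma> as. \<gamma> < \<beta> \<Longrightarrow> set as \<subseteq> fst A \<Longrightarrow> is_Pi (g \<gamma>) (\<Phi> \<gamma> as) \<and> defines_bf A \<gamma> as (\<Phi> \<gamma> as)"
      by metis
    obtain \<gamma>0 where \<gamma>0: "\<gamma>0 < \<beta>" using limit by (auto simp: limit_cord_def)
    have "\<exists>\<phi>. is_Pi \<beta> \<phi> \<and> defines_bf A \<beta> as \<phi>" if "set as \<subseteq> fst A" for as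
    proof -
      obtain \<phi> where "is_Pi \<beta> \<phi>" "defines_bf A \<beta> as \<phi>"
        by (rule Scott_formula_step[OF A, of "{..<\<beta>}" \<beta> \<gamma>0 g \<beta> \<Phi> as])
          (use \<gamma>0 g \<Phi> limit limit_cord_succ countable_lessThan_cord \<open>set as \<subseteq> fst A\<close> in auto)
      then show ?thesis by blast
    qed
    then show ?thesis using less.prems by blast
  qed
qed

text \<open>\<open>P\<close> describes the approximations. Any two pairs of the resulting map lie in
  one approximation, which is what a binary relation needs in order to pass from approximations to
  \<open>g\<close>.\<close>

lemma back_and_forth:
  fixes P :: "('a \<times> 'b) set \<Rightarrow> bool"
  assumes X: "countable X" and Y: "countable Y" and P0: "P F0" "F0 \<subseteq> X \<times> Y"
    and extend_right: "\<And>F x. P F \<Longrightarrow> x \<in> X \<Longrightarrow> \<exists>y\<in>Y. P (insert (x, y) F)"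
    and extend_left: "\<And>F y. P F \<Longrightarrow> y \<in> Y \<Longrightarrow> \<exists>x\<in>X. P (insert (x, y) F)"
    and inj: "\<And>F x y x' y'. P F \<Longrightarrow> (x, y) \<in> F \<Longrightarrow> (x', y') \<in> F \<Longrightarrow> x = x' \<longleftrightarrow> y = y'"
  obtains g where "bij_betw g X Y" "\<And>x y. (x, y) \<in> F0 \<Longrightarrow> g x = y"
    "\<And>x x'. x \<in> X \<Longrightarrow> x' \<in> X \<Longrightarrow> \<exists>F. P F \<and> (x, g x) \<in> F \<and> (x', g x') \<in> F"
proof -
  have ext: "\<exists>F'. P F' \<and> F \<subseteq> F' \<and> F' \<subseteq> X \<times> Y \<and> (\<forall>x\<in>X. to_nat_on X x = n \<longrightarrow> x \<in> fst ` F') \<and>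
      (\<forall>y\<in>Y. to_nat_on Y y = n \<longrightarrow> y \<in> snd ` F')" if "P F" "F \<subseteq> X \<times> Y" for F n
  proof -
    obtain F1 where F1: "P F1" "F \<subseteq> F1" "F1 \<subseteq> X \<times> Y" "\<forall>x\<in>X. to_nat_on X x = n \<longrightarrow> x \<in> fst ` F1"
    proof (cases "\<exists>x\<in>X. to_nat_on X x = n")
      case True
      then obtain x where x: "x \<in> X" "to_nat_on X x = n" by blast
      have "x' = x" if "x' \<in> X" "to_nat_on X x' = n" for x'
        by (rule inj_onD[OF inj_on_to_nat_on[OF X]]) (use that x in auto)
      moreover obtain y where "y \<in> Y" "P (insert (x, y) F)" using extend_right[OF \<open>P F\<close> x(1)] by blast
      ultimately show ?thesis
        using \<open>F \<subseteq> X \<times> Y\<close> x(1) by (intro that[of "insert (x, y) F"]) (simp_all add: subset_insertI)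
    next
      case False
      then show ?thesis using \<open>P F\<close> \<open>F \<subseteq> X \<times> Y\<close> by (intro that[of F]) auto
    qed
    show ?thesis
    proof (cases "\<exists>y\<in>Y. to_nat_on Y y = n")
      case True
      then obtain y where y: "y \<in> Y" "to_nat_on Y y = n" by blast
      have "y' = y" if "y' \<in> Y" "to_nat_on Y y' = n" for y'
        by (rule inj_onD[OF inj_on_to_nat_on[OF Y]]) (use that y in auto)
      moreover obtain x where "x \<in> X" "P (insert (x, y) F1)" using extend_left[OF F1(1) y(1)] by blast
      ultimately have "P (insert (x, y) F1) \<and> F \<subseteq> insert (x, y) F1 \<and> insert (x, y) F1 \<subseteq> X \<times> Y \<and>
          (\<forall>x'\<in>X. to_nat_on X x' = n \<longrightarrow> x' \<in> fst ` insert (x, y) F1) \<and>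
          (\<forall>y'\<in>Y. to_nat_on Y y' = n \<longrightarrow> y' \<in> snd ` insert (x, y) F1)"
        using F1 y(1) by (simp add: subset_insertI2)
      then show ?thesis by blast
    next
      case False
      then show ?thesis using F1 by blast
    qed
  qed
  have "\<exists>S. \<forall>n. (P (S n) \<and> S n \<subseteq> X \<times> Y \<and> (n = 0 \<longrightarrow> S n = F0)) \<and> (S n \<subseteq> S (Suc n) \<and>
      (\<forall>x\<in>X. to_nat_on X x = n \<longrightarrow> x \<in> fst ` S (Suc n)) \<and> (\<forall>y\<in>Y. to_nat_on Y y = n \<longrightarrow> y \<in> snd ` S (Suc n)))"
  proof (rule dependent_nat_choice)
    show "\<exists>F. P F \<and> F \<subseteq> X \<times> Y \<and> (0 = 0 \<longrightarrow> F = F0)" using P0 by blast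
  next
    fix F and n :: nat assume "P F \<and> F \<subseteq> X \<times> Y \<and> (n = 0 \<longrightarrow> F = F0)"
    then obtain F' where "P F' \<and> F \<subseteq> F' \<and> F' \<subseteq> X \<times> Y \<and> (\<forall>x\<in>X. to_nat_on X x = n \<longrightarrow> x \<in> fst ` F') \<and>
      (\<forall>y\<in>Y. to_nat_on Y y = n \<longrightarrow> y \<in> snd ` F')" using ext[of F n] by blast
    then show "\<exists>F'. (P F' \<and> F' \<subseteq> X \<times> Y \<and> (Suc n = 0 \<longrightarrow> F' = F0)) \<and> (F \<subseteq> F' \<and>
      (\<forall>x\<in>X. to_nat_on X x = n \<longrightarrow> x \<in> fst ` F') \<and> (\<forall>y\<in>Y. to_nat_on Y y = n \<longrightarrow> y \<in> snd ` F'))"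
      by (intro exI[of _ F']) simp
  qed
  then obtain S where S_all: "\<forall>n. (P (S n) \<and> S n \<subseteq> X \<times> Y \<and> (n = 0 \<longrightarrow> S n = F0)) \<and> (S n \<subseteq> S (Suc n) \<and>
      (\<forall>x\<in>X. to_nat_on X x = n \<longrightarrow> x \<in> fst ` S (Suc n)) \<and> (\<forall>y\<in>Y. to_nat_on Y y = n \<longrightarrow> y \<in> snd ` S (Suc n)))" ..
  have S: "P (S n)" "S n \<subseteq> X \<times> Y" "S 0 = F0" "S n \<subseteq> S (Suc n)"
    "x \<in> X \<Longrightarrow> x \<in> fst ` S (Suc (to_nat_on X x))" "y \<in> Y \<Longrightarrow> y \<in> snd ` S (Suc (to_nat_on Y y))" for n x y
    using S_all by simp_all
  have mono: "m \<le> n \<Longrightarrow> S m \<subseteq> S n" for m n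
    using S(4) by (rule lift_Suc_mono_le)
  have common: "\<exists>n. p \<in> S n \<and> q \<in> S n" if "p \<in> S k" "q \<in> S l" for p q k l
    using that mono[of k "max k l"] mono[of l "max k l"] by auto
  have func: "x = x' \<longleftrightarrow> y = y'" if "(x, y) \<in> S k" "(x', y') \<in> S l" for x y x' y' k l
    using common[OF that] inj[OF S(1)] by blast
  define g where "g x = (SOME y. \<exists>n. (x, y) \<in> S n)" for x
  have g: "\<exists>n. (x, g x) \<in> S n" if "x \<in> X" for x
  proof -
    have "\<exists>y n. (x, y) \<in> S n" using S(5)[OF that] by force
    then show ?thesis unfolding g_def by (rule someI_ex)
  qed
  have g_eq: "g x = y" if "(x, y) \<in> S n" for x y n
    using g[of x] func that S(2)[of n] by blast
  show thesis
  proof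
    show "bij_betw g X Y"
      unfolding bij_betw_def
    proof
      show "inj_on g X" using g func by (metis inj_onI)
      have "g ` X \<subseteq> Y" using g S(2) by blast
      moreover have "Y \<subseteq> g ` X"
      proof
        fix y assume "y \<in> Y"
        then obtain x where "(x, y) \<in> S (Suc (to_nat_on Y y))" using S(6) by force
        then show "y \<in> g ` X" using g_eq S(2) by blast
      qed
      ultimately show "g ` X = Y" by blast
    qed
    show "g x = y" if "(x, y) \<in> F0" for x y
      using that g_eq S(3) by metis
    show "\<exists>F. P F \<and> (x, g x) \<in> F \<and> (x', g x') \<in> F" if "x \<in> X" "x' \<in> X" for x x'
      using that g common S(1) by meson
  qed
qed

text \<open>The level \<open>c'\<close> is allowed to depend on the tuple only through its \<open>\<beta>0\<close>-type: a new element of an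
  unknown model is first matched at level \<open>\<beta>0\<close>, and this already bounds the level that determines
  its type completely.\<close>

lemma isomorphic_if_bf:
  fixes A :: "'a set \<times> 'a rel" and B :: "'b set \<times> 'b rel"
  assumes \<mu>: "limit_cord \<mu>" and cA: "countable (fst A)" and cB: "countable (fst B)"
    and a: "a \<in> fst A" and b: "b \<in> fst B" and bf: "\<And>\<beta>. \<beta> < \<mu> \<Longrightarrow> bf A B \<beta> [a] [b]"
    and \<beta>0: "\<beta>0 < \<mu>"
    and stable: "\<And>cs. set cs \<subseteq> fst A \<Longrightarrow> \<exists>\<beta><\<mu>. \<forall>cs' cs''. set cs' \<subseteq> fst A \<longrightarrow> set cs'' \<subseteq> fst A \<longrightarrow>
      bf A A \<beta>0 (a # cs) (a # cs') \<longrightarrow> bf A A \<beta>0 (a # cs) (a # cs'') \<longrightarrow> bf A A \<beta> (a # cs') (a # cs'') \<longrightarrow>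
      (\<forall>\<gamma><\<mu>. bf A A \<gamma> (a # cs') (a # cs''))"
  shows "\<exists>f. bij_betw f (fst A) (fst B) \<and> (\<forall>x\<in>fst A. \<forall>y\<in>fst A. (x, y) \<in> snd A \<longleftrightarrow> (f x, f y) \<in> snd B)"
proof -
  define T where "T cs ds \<longleftrightarrow> set cs \<subseteq> fst A \<and> set ds \<subseteq> fst B \<and> (\<forall>\<beta><\<mu>. bf A B \<beta> (a # cs) (b # ds))" for cs ds
  \<comment> \<open>Let \<open>cs'\<close> agree with \<open>ds\<close> at level \<beta>, and let
    some other \<open>cs''\<close> do better. Then \<open>cs'\<close> and \<open>cs''\<close> agree
    at level \<beta> inside \<open>A\<close>, stability raises this to \<gamma>, and the better
    agreement passes to \<open>cs'\<close>.\<close>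
  have good: "\<exists>\<beta><\<mu>. \<forall>\<gamma><\<mu>. \<forall>cs' ds. set cs' \<subseteq> fst A \<longrightarrow> bf A A \<beta>0 (a # cs) (a # cs') \<longrightarrow>
      bf A B \<beta> (a # cs') (b # ds) \<longrightarrow>
      (\<exists>cs''. set cs'' \<subseteq> fst A \<and> bf A B (max \<beta> \<gamma>) (a # cs'') (b # ds)) \<longrightarrow> bf A B \<gamma> (a # cs') (b # ds)"
    if "set cs \<subseteq> fst A" for cs
  proof -
    obtain \<beta> where \<beta>: "\<beta> < \<mu>" and st: "\<And>cs' cs'' \<gamma>. set cs' \<subseteq> fst A \<Longrightarrow> set cs'' \<subseteq> fst A \<Longrightarrow>
      bf A A \<beta>0 (a # cs) (a # cs') \<Longrightarrow> bf A A \<beta>0 (a # cs) (a # cs'') \<Longrightarrow> bf A A \<beta> (a # cs') (a # cs'') \<Longrightarrow>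
      \<gamma> < \<mu> \<Longrightarrow> bf A A \<gamma> (a # cs') (a # cs'')"
      using stable[OF \<open>set cs \<subseteq> fst A\<close>] by blast
    show ?thesis
    proof (intro exI[of _ "max \<beta>0 \<beta>"] conjI allI impI)
      show "max \<beta>0 \<beta> < \<mu>" using \<beta> \<beta>0 by simp
    next
      fix \<gamma> cs' ds
      assume \<gamma>: "\<gamma> < \<mu>" and cs': "set cs' \<subseteq> fst A" "bf A A \<beta>0 (a # cs) (a # cs')"
        "bf A B (max \<beta>0 \<beta>) (a # cs') (b # ds)"
        and "\<exists>cs''. set cs'' \<subseteq> fst A \<and> bf A B (max (max \<beta>0 \<beta>) \<gamma>) (a # cs'') (b # ds)"
      then obtain cs'' where cs'': "set cs'' \<subseteq> fst A" "bf A B (max (max \<beta>0 \<beta>) \<gamma>) (a # cs'') (b # ds)" by blast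
      have "bf A B (max \<beta>0 \<beta>) (a # cs'') (b # ds)" using cs''(2) by (rule bf_mono) simp
      then have *: "bf A A (max \<beta>0 \<beta>) (a # cs') (a # cs'')" by (rule bf_trans[OF cs'(3) bf_sym])
      then have "bf A A \<beta>0 (a # cs) (a # cs'')" using bf_trans[OF cs'(2) bf_mono[OF *]] by simp
      then have "bf A A \<gamma> (a # cs') (a # cs'')"
        using st[OF cs'(1) cs''(1) cs'(2) _ _ \<gamma>] bf_mono[OF *] by simp
      then show "bf A B \<gamma> (a # cs') (b # ds)"
        by (rule bf_trans) (rule bf_mono[OF cs''(2)], simp)
    qed
  qed
  have extend_right: "\<exists>y\<in>fst B. T (cs @ [x]) (ds @ [y])" if T: "T cs ds" and x: "x \<in> fst A" for cs ds x
  proof -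
    have csx: "set (cs @ [x]) \<subseteq> fst A" using T x by (simp add: T_def)
    obtain \<beta> where \<beta>: "\<beta> < \<mu>" and gd: "\<And>\<gamma> cs' ds. \<gamma> < \<mu> \<Longrightarrow> set cs' \<subseteq> fst A \<Longrightarrow>
      bf A A \<beta>0 (a # cs @ [x]) (a # cs') \<Longrightarrow> bf A B \<beta> (a # cs') (b # ds) \<Longrightarrow>
      \<exists>cs''. set cs'' \<subseteq> fst A \<and> bf A B (max \<beta> \<gamma>) (a # cs'') (b # ds) \<Longrightarrow> bf A B \<gamma> (a # cs') (b # ds)"
      using good[OF csx] by blast
    have "bf A B (cord_succ \<beta>) (a # cs) (b # ds)"
      using T \<beta> \<mu> limit_cord_succ by (auto simp: T_def)
    then obtain ys where ys: "length ys = length [x]" "set ys \<subseteq> fst B" "bf A B \<beta> ((a # cs) @ [x]) ((b # ds) @ ys)"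
      using bf_forth[OF _ less_cord_succ, of A B \<beta> "a # cs" "b # ds" "[x]"] x by auto
    then obtain y where y: "ys = [y]" "y \<in> fst B" by (cases ys) auto
    have "bf A B \<gamma> (a # cs @ [x]) (b # ds @ [y])" if \<gamma>: "\<gamma> < \<mu>" for \<gamma>
    proof (rule gd[OF \<gamma> csx])
      show "bf A A \<beta>0 (a # cs @ [x]) (a # cs @ [x])"
        using bf_iso[of id A A "a # cs @ [x]" \<beta>0] csx a by simp
      show "bf A B \<beta> (a # cs @ [x]) (b # ds @ [y])" using ys(3) y by simp
      \<comment> \<open>The better tuple comes from moving back from \<open>y\<close> at a higher
        level; its last entry may differ from \<open>x\<close>.\<close>
      have "bf A B (cord_succ (max \<beta> \<gamma>)) (a # cs) (b # ds)"
        using T \<beta> \<gamma> \<mu> limit_cord_succ by (auto simp: T_def)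
      then obtain xs where xs: "length xs = length [y]" "set xs \<subseteq> fst A" "bf A B (max \<beta> \<gamma>) ((a # cs) @ xs) ((b # ds) @ [y])"
        using bf_back[OF _ less_cord_succ, of A B "max \<beta> \<gamma>" "a # cs" "b # ds" "[y]"] y(2) by auto
      then show "\<exists>cs''. set cs'' \<subseteq> fst A \<and> bf A B (max \<beta> \<gamma>) (a # cs'') (b # ds @ [y])"
        using T by (intro exI[of _ "cs @ xs"]) (auto simp: T_def)
    qed
    then show ?thesis using T x y(2) by (auto simp: T_def)
  qed
  have extend_left: "\<exists>x\<in>fst A. T (cs @ [x]) (ds @ [y])" if T: "T cs ds" and y: "y \<in> fst B" for cs ds y
  proof -
    \<comment> \<open>Each level has its own partner of \<open>y\<close>; what follows finds one
      that works for all levels.\<close>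
    have resp: "\<exists>x\<in>fst A. bf A B \<gamma> (a # cs @ [x]) (b # ds @ [y])" if "\<gamma> < \<mu>" for \<gamma>
    proof -
      have "bf A B (cord_succ \<gamma>) (a # cs) (b # ds)"
        using T that \<mu> limit_cord_succ by (auto simp: T_def)
      then obtain xs where xs: "length xs = length [y]" "set xs \<subseteq> fst A" "bf A B \<gamma> ((a # cs) @ xs) ((b # ds) @ [y])"
        using bf_back[OF _ less_cord_succ, of A B \<gamma> "a # cs" "b # ds" "[y]"] y by auto
      then show ?thesis by (cases xs) auto
    qed
    obtain x0 where x0: "x0 \<in> fst A" "bf A B \<beta>0 (a # cs @ [x0]) (b # ds @ [y])" using resp \<beta>0 by blast
    have csx0: "set (cs @ [x0]) \<subseteq> fst A" using T x0 by (simp add: T_def)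
    obtain \<beta> where \<beta>: "\<beta> < \<mu>" and gd: "\<And>\<gamma> cs' ds. \<gamma> < \<mu> \<Longrightarrow> set cs' \<subseteq> fst A \<Longrightarrow>
      bf A A \<beta>0 (a # cs @ [x0]) (a # cs') \<Longrightarrow> bf A B \<beta> (a # cs') (b # ds) \<Longrightarrow>
      \<exists>cs''. set cs'' \<subseteq> fst A \<and> bf A B (max \<beta> \<gamma>) (a # cs'') (b # ds) \<Longrightarrow> bf A B \<gamma> (a # cs') (b # ds)"
      using good[OF csx0] by blast
    obtain x where x: "x \<in> fst A" "bf A B (max \<beta>0 \<beta>) (a # cs @ [x]) (b # ds @ [y])"
      using resp[of "max \<beta>0 \<beta>"] \<beta>0 \<beta> by auto
    have csx: "set (cs @ [x]) \<subseteq> fst A" using T x by (simp add: T_def)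
    have "bf A B \<gamma> (a # cs @ [x]) (b # ds @ [y])" if \<gamma>: "\<gamma> < \<mu>" for \<gamma>
    proof (rule gd[OF \<gamma> csx])
      show "bf A B \<beta> (a # cs @ [x]) (b # ds @ [y])" using x(2) by (rule bf_mono) simp
      show "bf A A \<beta>0 (a # cs @ [x0]) (a # cs @ [x])"
        by (rule bf_trans[OF x0(2)], rule bf_sym, rule bf_mono[OF x(2)]) simp
      show "\<exists>cs''. set cs'' \<subseteq> fst A \<and> bf A B (max \<beta> \<gamma>) (a # cs'') (b # ds @ [y])"
      proof -
        obtain x' where "x' \<in> fst A" "bf A B (max \<beta> \<gamma>) (a # cs @ [x']) (b # ds @ [y])"
          using resp[of "max \<beta> \<gamma>"] \<beta> \<gamma> by auto
        then show ?thesis using T by (intro exI[of _ "cs @ [x']"]) (simp add: T_def)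
      qed
    qed
    then show ?thesis using T x(1) y by (auto simp: T_def)
  qed
  define P where "P F \<longleftrightarrow> (\<exists>cs ds. T cs ds \<and> F = set (zip cs ds))" for F
  have at': "atomic_eq A B (a # cs) (b # ds)" if "T cs ds" for cs ds
    using that \<beta>0 bf_atomic unfolding T_def by blast
  have len: "length cs = length ds" if "T cs ds" for cs ds
    using at'[OF that] by (simp add: atomic_eq_def)
  have at: "(cs ! i = cs ! j \<longleftrightarrow> ds ! i = ds ! j) \<and> ((cs ! i, cs ! j) \<in> snd A \<longleftrightarrow> (ds ! i, ds ! j) \<in> snd B)"
    if "T cs ds" "i < length cs" "j < length cs" for cs ds i j
    using at'[OF that(1), unfolded atomic_eq_def, THEN conjunct2, rule_format, of "Suc i" "Suc j"] that(2,3)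
    by simp
  have "T [] []" using bf by (simp add: T_def)
  then have P0: "P {}" unfolding P_def by (metis set_empty zip_Nil)
  have pairs: "(x = x' \<longleftrightarrow> y = y') \<and> ((x, x') \<in> snd A \<longleftrightarrow> (y, y') \<in> snd B)"
    if "P F" "(x, y) \<in> F" "(x', y') \<in> F" for F x y x' y'
  proof -
    obtain cs ds where T: "T cs ds" "F = set (zip cs ds)" using \<open>P F\<close> by (auto simp: P_def)
    obtain i where i: "i < length cs" "x = cs ! i" "y = ds ! i"
      using \<open>(x, y) \<in> F\<close> unfolding T(2) set_zip by auto
    obtain j where j: "j < length cs" "x' = cs ! j" "y' = ds ! j"
      using \<open>(x', y') \<in> F\<close> unfolding T(2) set_zip by auto
    show ?thesis using at[OF T(1) i(1) j(1)] i j by simp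
  qed
  obtain g where "bij_betw g (fst A) (fst B)"
    "\<And>x x'. x \<in> fst A \<Longrightarrow> x' \<in> fst A \<Longrightarrow> \<exists>F. P F \<and> (x, g x) \<in> F \<and> (x', g x') \<in> F"
  proof (rule back_and_forth[where P = P, OF cA cB P0])
    show "\<exists>y\<in>fst B. P (insert (x, y) F)" if "P F" "x \<in> fst A" for F x
    proof -
      obtain cs ds where T: "T cs ds" "F = set (zip cs ds)" using \<open>P F\<close> by (auto simp: P_def)
      with extend_right[OF T(1) that(2)] obtain y where y: "y \<in> fst B" "T (cs @ [x]) (ds @ [y])" by blast
      moreover have "insert (x, y) F = set (zip (cs @ [x]) (ds @ [y]))" using T len by simp
      ultimately show ?thesis unfolding P_def by blast
    qed
    show "\<exists>x\<in>fst A. P (insert (x, y) F)" if "P F" "y \<in> fst B" for F y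
    proof -
      obtain cs ds where T: "T cs ds" "F = set (zip cs ds)" using \<open>P F\<close> by (auto simp: P_def)
      with extend_left[OF T(1) that(2)] obtain x where x: "x \<in> fst A" "T (cs @ [x]) (ds @ [y])" by blast
      moreover have "insert (x, y) F = set (zip (cs @ [x]) (ds @ [y]))" using T len by simp
      ultimately show ?thesis unfolding P_def by blast
    qed
  qed (use pairs in blast)+
  then show ?thesis using pairs by meson
qed

section \<open>A criterion for Scott complexity\<close>

lemma isomorphic_refl: "isomorphic A A"
  unfolding isomorphic_def by (intro exI[of _ id]) simp

lemma Scott_sentence_from_parameter:
  fixes A :: struct
  assumes \<mu>: "limit_cord \<mu>" and a: "a \<in> fst A" and \<beta>0: "\<beta>0 < \<mu>"
    and stable: "\<And>cs. set cs \<subseteq> fst A \<Longrightarrow> \<exists>\<beta><\<mu>. \<forall>cs' cs''. set cs' \<subseteq> fst A \<longrightarrow> set cs'' \<subseteq> fst A \<longrightarrow>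
      bf A A \<beta>0 (a # cs) (a # cs') \<longrightarrow> bf A A \<beta>0 (a # cs) (a # cs'') \<longrightarrow> bf A A \<beta> (a # cs') (a # cs'') \<longrightarrow>
      (\<forall>\<gamma><\<mu>. bf A A \<gamma> (a # cs') (a # cs''))"
  shows "has_Scott_sentence_in A (Sigma_class (cord_succ \<mu>))"
proof -
  have cA: "countable (fst A)" by simp
  have "\<exists>g<\<mu>. \<exists>\<phi>. is_Pi g \<phi> \<and> defines_bf A \<beta> [a] \<phi>" if "\<beta> < \<mu>" for \<beta>
    using Scott_formula[OF cA \<mu> that] a by (metis empty_set empty_subsetI insert_subset list.simps(15))
  then obtain g \<Phi> where g: "\<And>\<beta>. \<beta> < \<mu> \<Longrightarrow> g \<beta> < \<mu>"
    and \<Phi>: "\<And>\<beta>. \<beta> < \<mu> \<Longrightarrow> is_Pi (g \<beta>) (\<Phi> \<beta>)" "\<And>\<beta>. \<beta> < \<mu> \<Longrightarrow> defines_bf A \<beta> [a] (\<Phi> \<beta>)"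
    by metis
  \<comment> \<open>Members of a Pi conjunction must be Sigma formulas. A one-element disjunction
    turns a Pi formula into one, a level higher and still below \<mu>.\<close>
  define \<psi> where "\<psi> \<beta> = Disj {0} (\<lambda>_. \<Phi> \<beta>)" for \<beta>
  have sig: "\<exists>\<beta>'<\<mu>. is_Sigma \<beta>' (\<psi> \<beta>)" if "\<beta> \<in> {..<\<mu>}" for \<beta>
  proof -
    have "is_Sigma (cord_succ (g \<beta>)) (Disj {0} (\<lambda>i. foldr Ex ((\<lambda>_. []) i) ((\<lambda>_. \<Phi> \<beta>) i)))"
      using that \<Phi>(1) less_cord_succ by (intro Sigma_pos) auto
    then show ?thesis using limit_cord_succ[OF \<mu> g] that by (auto simp: \<psi>_def)
  qed
  obtain \<beta>1 where "\<beta>1 < \<mu>" using \<beta>0 ..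
  obtain \<chi> where \<chi>: "is_Pi \<mu> \<chi>" "free_vars \<chi> = (\<Union>\<beta>\<in>{..<\<mu>}. free_vars (\<psi> \<beta>) - set [])"
    "\<And>A v. sat A v \<chi> \<longleftrightarrow> (\<forall>\<beta>\<in>{..<\<mu>}. sat A v (foldr All [] (\<psi> \<beta>)))"
  proof (rule Pi_Conj_countable[where \<psi> = \<psi> and ys = "\<lambda>_. []", OF countable_lessThan_cord \<open>\<beta>1 < \<mu>\<close> sig])
    fix \<phi>
    assume "is_Pi \<mu> \<phi>" "free_vars \<phi> = (\<Union>\<beta>\<in>{..<\<mu>}. free_vars (\<psi> \<beta>) - set [])"
      "\<And>A v. sat A v \<phi> \<longleftrightarrow> (\<forall>\<beta>\<in>{..<\<mu>}. sat A v (foldr All [] (\<psi> \<beta>)))"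
    then show thesis by (rule that)
  qed
  \<comment> \<open>Some element realises all types of the parameter below \<mu>: one existential
    quantifier over a Pi formula of level \<mu>.\<close>
  define \<theta> where "\<theta> = Disj {0} (\<lambda>_. Ex 0 \<chi>)"
  have "is_Sigma (cord_succ \<mu>) (Disj {0} (\<lambda>i. foldr Ex ((\<lambda>_. [0]) i) ((\<lambda>_. \<chi>) i)))"
    using \<chi>(1) less_cord_succ by (intro Sigma_pos) auto
  then have \<theta>: "is_Sigma (cord_succ \<mu>) \<theta>" by (simp add: \<theta>_def)
  have "free_vars \<chi> \<subseteq> {0}"
    using defines_bfD(1)[OF \<Phi>(2)] by (fastforce simp: \<chi>(2) \<psi>_def)
  then have sent: "is_sentence \<theta>" by (auto simp: is_sentence_def \<theta>_def)
  have mod: "models B \<theta> \<longleftrightarrow> (\<exists>b\<in>fst B. \<forall>\<beta><\<mu>. bf A B \<beta> [a] [b])" if "structure_ok B" for B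
  proof -
    have "sat B v \<theta> \<longleftrightarrow> (\<exists>b\<in>fst B. \<forall>\<beta><\<mu>. bf A B \<beta> [a] [b])" for v
      using defines_bfD(2)[OF \<Phi>(2)] by (simp add: \<theta>_def \<chi>(3) \<psi>_def Ball_def)
    moreover have "\<exists>v :: nat \<Rightarrow> nat. range v \<subseteq> fst B"
    proof -
      obtain x where "x \<in> fst B" using \<open>structure_ok B\<close> by (auto simp: structure_ok_def)
      then show ?thesis by (intro exI[of _ "\<lambda>_. x"]) auto
    qed
    ultimately show ?thesis by (auto simp: models_def)
  qed
  have "models B \<theta> \<longleftrightarrow> isomorphic B A" if B: "structure_ok B" for B
  proof
    assume "models B \<theta>"
    then obtain b where b: "b \<in> fst B" "\<And>\<beta>. \<beta> < \<mu> \<Longrightarrow> bf A B \<beta> [a] [b]" using mod[OF B] by blast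
    obtain f where f: "bij_betw f (fst A) (fst B)"
      "\<And>x y. x \<in> fst A \<Longrightarrow> y \<in> fst A \<Longrightarrow> (x, y) \<in> snd A \<longleftrightarrow> (f x, f y) \<in> snd B"
      using isomorphic_if_bf[OF \<mu> cA _ a b \<beta>0 stable] by auto
    show "isomorphic B A" unfolding isomorphic_def
    proof (intro exI conjI ballI)
      let ?h = "inv_into (fst A) f"
      show h: "bij_betw ?h (fst B) (fst A)" using f(1) by (rule bij_betw_inv_into)
      show "(x, y) \<in> snd B \<longleftrightarrow> (?h x, ?h y) \<in> snd A" if "x \<in> fst B" "y \<in> fst B" for x y
        using f(2)[of "?h x" "?h y"] that h f(1) by (auto simp: bij_betw_def f_inv_into_f)
    qed
  next
    assume "isomorphic B A"
    then obtain h where h: "bij_betw h (fst B) (fst A)"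
      "\<And>x y. x \<in> fst B \<Longrightarrow> y \<in> fst B \<Longrightarrow> (x, y) \<in> snd B \<longleftrightarrow> (h x, h y) \<in> snd A"
      unfolding isomorphic_def by blast
    obtain b where b: "b \<in> fst B" "h b = a"
      using bij_betw_imp_surj_on[OF h(1)] a by (metis imageE)
    have "bf A B \<beta> [a] [b]" for \<beta>
      using bf_sym[OF bf_iso[OF h, of "[b]"]] b by simp
    then show "models B \<theta>" using mod[OF B] b(1) by blast
  qed
  then show ?thesis
    using \<theta> sent unfolding has_Scott_sentence_in_def is_Scott_sentence_def by auto
qed

text \<open>The classes not above \<open>Sigma_class (cord_succ \<mu>)\<close> are those of index at
  most \<mu> and \<open>Pi_class (cord_succ \<mu>)\<close>. Sentences of the former have the same
  truth value in \<open>A\<close> and \<open>B\<close> by the empty tuple. For the latter, each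
  tuple of \<open>B\<close> has a partner in \<open>A\<close> at level \<mu>, so a universal
  statement true in \<open>A\<close> holds in \<open>B\<close>.\<close>

lemma Sigma_succ_optimal:
  fixes A B :: struct
  assumes \<mu>: "limit_cord \<mu>" and A: "structure_ok A" and B: "structure_ok B" and non: "\<not> isomorphic B A"
    and bf: "\<And>bs. set bs \<subseteq> fst B \<Longrightarrow> \<exists>as. set as \<subseteq> fst A \<and> (\<forall>\<beta><\<mu>. bf A B \<beta> as bs)"
    and c: "has_Scott_sentence_in A c"
  shows "class_le (Sigma_class (cord_succ \<mu>)) c"
proof (rule ccontr)
  assume nle: "\<not> class_le (Sigma_class (cord_succ \<mu>)) c"
  obtain \<phi> where \<phi>: "in_class c \<phi>" "is_sentence \<phi>"
    and Scott: "\<And>C. structure_ok C \<Longrightarrow> models C \<phi> \<longleftrightarrow> isomorphic C A"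
    using c by (auto simp: has_Scott_sentence_in_def is_Scott_sentence_def)
  have bf\<mu>: "\<exists>as. length as = length bs \<and> set as \<subseteq> fst A \<and> bf A B \<mu> as bs" if "set bs \<subseteq> fst B" for bs
    using bf[OF that] bf_limit[OF \<mu>, of A B _ bs] bf_length by blast
  obtain v :: "nat \<Rightarrow> nat" where v: "range v \<subseteq> fst A"
  proof -
    obtain x where "x \<in> fst A" using A by (auto simp: structure_ok_def)
    then show thesis using that[of "\<lambda>_. x"] by auto
  qed
  have "models A \<phi>" using Scott[OF A] isomorphic_refl by blast
  then have sv: "sat A v \<phi>" using v by (auto simp: models_def)
  have bf0: "bf A B \<mu> [] []" using bf\<mu>[of "[]"] by simp
  have \<Sigma>: "sat A v \<psi> \<longleftrightarrow> sat B w \<psi>" if "is_Sigma \<alpha> \<psi>" "\<alpha> \<le> \<mu>" "free_vars \<psi> = {}" for \<alpha> \<psi> w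
    using bf_sat(1)[OF that(1) bf_mono[OF bf0 that(2)]] that(3) by (simp add: covers_def)
  have \<Pi>: "sat A v \<psi> \<longleftrightarrow> sat B w \<psi>" if "is_Pi \<alpha> \<psi>" "\<alpha> \<le> \<mu>" "free_vars \<psi> = {}" for \<alpha> \<psi> w
    using bf_sat(2)[OF that(1) bf_mono[OF bf0 that(2)]] that(3) by (simp add: covers_def)
  have "sat B w \<phi>" if w: "range w \<subseteq> fst B" for w
  proof (cases "class_index c \<le> \<mu>")
    case le: True
    show ?thesis
    proof (cases c)
      case (Sigma_class \<alpha>)
      then show ?thesis using \<Sigma> \<phi> le sv by (auto simp: is_sentence_def)
    next
      case (Pi_class \<alpha>)
      then show ?thesis using \<Pi> \<phi> le sv by (auto simp: is_sentence_def)
    next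
      case (dSigma_class \<alpha>)
      then obtain \<psi> \<chi> where *: "is_Sigma \<alpha> \<psi>" "is_Pi \<alpha> \<chi>" "\<phi> = Conj {0, 1} (\<lambda>i. if i = 0 then \<psi> else \<chi>)"
        using \<phi>(1) by auto
      then show ?thesis using \<Sigma>[of \<alpha> \<psi>] \<Pi>[of \<alpha> \<chi>] \<phi>(2) le sv dSigma_class
        by (auto simp: is_sentence_def)
    qed
  next
    case False
    then have idx: "cord_succ \<mu> \<le> class_index c"
      by (metis less_cord_succ_iff not_le)
    have "c = Pi_class (cord_succ \<mu>)"
      using nle idx by (cases c) (auto simp: class_le_def)
    then have "is_Pi (cord_succ \<mu>) \<phi>" using \<phi>(1) by simp
    then show ?thesis
    proof cases
      case Pi_zero
      then show ?thesis using less_cord_succ not_le by blast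
    next
      case (Pi_pos \<gamma> I \<psi> ys)
      have "sat B (upds w (ys i) ds) (\<psi> i)" if i: "i \<in> I" and ds: "length ds = length (ys i)" "set ds \<subseteq> fst B" for i ds
      proof -
        obtain as where as: "length as = length ds" "set as \<subseteq> fst A" "bf A B \<mu> as ds"
          using bf\<mu>[OF ds(2)] by blast
        obtain \<beta> where \<beta>: "\<beta> \<le> \<mu>" "is_Sigma \<beta> (\<psi> i)"
          using Pi_pos(3)[OF i] by (auto simp: less_cord_succ_iff)
        have "free_vars (\<psi> i) - set (ys i) = {}"
          using \<phi>(2) i unfolding Pi_pos(1) by (auto simp: is_sentence_def)
        then have "covers (free_vars (\<psi> i) - set (ys i)) v w [] []" by (auto simp: covers_def)
        then have "covers (free_vars (\<psi> i)) (upds v (ys i) as) (upds w (ys i) ds) as ds"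
          using covers_upds[of "free_vars (\<psi> i)" "ys i" v w "[]" "[]" as ds] as(1) ds(1)
          by simp
        moreover have "sat A (upds v (ys i) as) (\<psi> i)"
          using sv i as ds(1) unfolding Pi_pos(1) by (auto simp: sat_foldr_All)
        ultimately show ?thesis using bf_sat(1)[OF \<beta>(2) bf_mono[OF as(3) \<beta>(1)]] by blast
      qed
      then show ?thesis unfolding Pi_pos(1) by (auto simp: sat_foldr_All)
    qed
  qed
  then have "models B \<phi>" by (simp add: models_def)
  then show False using Scott[OF B] non by blast
qed

section \<open>Powers of the integers\<close>

instance dual :: (linorder) linorder
proof
  fix x y :: "'a dual"
  show "x \<le> y \<or> y \<le> x" by (simp add: dual_less_eq_iff linear)
qed

text \<open>The order on \<open>\<Rightarrow>\<^sub>0\<close> is decided by the least key at which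
  two functions differ, but in a power of the integers the largest exponent has to decide; hence the
  dual keys.\<close>

type_synonym zpow = "cord dual \<Rightarrow>\<^sub>0 int"

definition co :: "zpow \<Rightarrow> cord \<Rightarrow> int" where
  "co d \<gamma> = Poly_Mapping.lookup d (dual \<gamma>)"

lemma co_simps [simp]: "co 0 \<gamma> = 0" "co (p + q) \<gamma> = co p \<gamma> + co q \<gamma>" "co (p - q) \<gamma> = co p \<gamma> - co q \<gamma>"
  "co (- p) \<gamma> = - co p \<gamma>"
  by (simp_all add: co_def lookup_add lookup_minus lookup_uminus)

definition mon :: "cord \<Rightarrow> int \<Rightarrow> zpow" where
  "mon \<delta> k = Poly_Mapping.single (dual \<delta>) k"

lemma co_mon [simp]: "co (mon \<delta> k) \<gamma> = (if \<gamma> = \<delta> then k else 0)"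
  by (auto simp: co_def mon_def lookup_single when_def)

lemma zpow_eqI: "(\<And>\<gamma>. co p \<gamma> = co q \<gamma>) \<Longrightarrow> p = q"
  by (rule poly_mapping_eqI) (metis co_def dual_undual)

section \<open>Leading terms, and what a bounded level sees of a difference\<close>

definition lead :: "zpow \<Rightarrow> cord \<Rightarrow> int \<Rightarrow> bool" where
  "lead d \<delta> a \<longleftrightarrow> 0 < a \<and> co d \<delta> = a \<and> (\<forall>\<gamma>>\<delta>. co d \<gamma> = 0)"

lemma zpow_pos_iff: "0 < d \<longleftrightarrow> (\<exists>\<delta> a. lead d \<delta> a)"
proof -
  have ex: "(\<exists>k. Q k) \<longleftrightarrow> (\<exists>\<delta>. Q (dual \<delta>))" for Q :: "cord dual \<Rightarrow> bool"
    by (metis dual_undual)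
  have all: "(\<forall>k<dual \<delta>. Q k) \<longleftrightarrow> (\<forall>\<gamma>>\<delta>. Q (dual \<gamma>))" for Q :: "cord dual \<Rightarrow> bool" and \<delta>
    by (metis dual_undual less_dual_iff)
  have "0 < d \<longleftrightarrow> (\<exists>k. 0 < Poly_Mapping.lookup d k \<and> (\<forall>k'<k. 0 = Poly_Mapping.lookup d k'))"
    by (simp add: less_poly_mapping.rep_eq less_fun_def)
  also have "\<dots> \<longleftrightarrow> (\<exists>\<delta>. 0 < Poly_Mapping.lookup d (dual \<delta>) \<and>
      (\<forall>k'<dual \<delta>. 0 = Poly_Mapping.lookup d k'))"
    by (rule ex)
  also have "\<dots> \<longleftrightarrow> (\<exists>\<delta>. 0 < Poly_Mapping.lookup d (dual \<delta>) \<and>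
      (\<forall>\<gamma>>\<delta>. 0 = Poly_Mapping.lookup d (dual \<gamma>)))"
    by (simp only: all)
  finally show ?thesis by (auto simp: lead_def co_def)
qed

lemma lead_pos: "lead d \<delta> a \<Longrightarrow> 0 < d"
  by (auto simp: zpow_pos_iff)

lemma lead_unique: "lead d \<delta> a \<Longrightarrow> lead d \<delta>' a' \<Longrightarrow> \<delta>' = \<delta> \<and> a' = a"
  by (cases \<delta> \<delta>' rule: linorder_cases) (auto simp: lead_def)

lemma lead_mon: "0 < k \<Longrightarrow> lead (mon \<delta> k) \<delta> k"
  by (simp add: lead_def)

lemma lead_add:
  assumes "lead p \<delta> a" "lead q \<epsilon> b"
  shows "lead (p + q) (max \<delta> \<epsilon>) (if \<delta> < \<epsilon> then b else if \<epsilon> < \<delta> then a else a + b)"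
proof (cases \<delta> \<epsilon> rule: linorder_cases)
  case less
  then have "co p \<gamma> = 0" if "\<epsilon> \<le> \<gamma>" for \<gamma>
    using assms(1) that unfolding lead_def by (metis less_le_trans)
  then show ?thesis using less assms(2) by (simp add: lead_def max_absorb2)
next
  case equal
  then show ?thesis using assms by (simp add: lead_def)
next
  case greater
  then have "co q \<gamma> = 0" if "\<delta> \<le> \<gamma>" for \<gamma>
    using assms(2) that unfolding lead_def by (metis less_le_trans)
  moreover have "\<not> \<delta> < \<epsilon>" using greater by simp
  ultimately show ?thesis using greater assms(1) by (simp add: lead_def max_absorb1)
qed

text \<open>For n > 0 this compares with \<open>mon \<delta> n\<close> after all terms of exponent
  below \<delta> have been dropped. For n \<le> 0 only 0 \<le> d remains.\<close>

definition ge :: "cord \<Rightarrow> int \<Rightarrow> zpow \<Rightarrow> bool" where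
  "ge \<delta> n d \<longleftrightarrow> 0 \<le> d \<and> ((\<exists>\<gamma>>\<delta>. co d \<gamma> \<noteq> 0) \<or> n \<le> co d \<delta>)"

lemma ge_lead: "lead d \<delta> a \<Longrightarrow> ge \<epsilon> n d \<longleftrightarrow> n \<le> 0 \<or> \<epsilon> < \<delta> \<or> (\<epsilon> = \<delta> \<and> n \<le> a)"
  using lead_pos[of d \<delta> a] unfolding ge_def lead_def
  by (cases \<epsilon> \<delta> rule: linorder_cases) (auto simp: less_imp_le)

lemma ge_zero: "ge \<epsilon> n 0 \<longleftrightarrow> n \<le> 0"
  by (simp add: ge_def)

lemma ge_neg: "d < 0 \<Longrightarrow> \<not> ge \<epsilon> n d"
  by (auto simp: ge_def not_le)

text \<open>The invariant for corresponding differences of gadget points: units are counted without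
  limit at exponents below \<gamma> and up to N at \<gamma>. Both signs occur, so either order of
  the points is covered.\<close>

definition eqv :: "cord \<Rightarrow> int \<Rightarrow> zpow \<Rightarrow> zpow \<Rightarrow> bool" where
  "eqv \<gamma> N d d' \<longleftrightarrow> (\<forall>\<delta> n. \<delta> < \<gamma> \<or> \<delta> = \<gamma> \<and> n \<le> N \<longrightarrow>
    (ge \<delta> n d \<longleftrightarrow> ge \<delta> n d') \<and> (ge \<delta> n (- d) \<longleftrightarrow> ge \<delta> n (- d')))"

lemma eqv_minus: "eqv \<gamma> N (- d) (- d') \<longleftrightarrow> eqv \<gamma> N d d'"
  by (auto simp: eqv_def)

lemma eqv_refl: "eqv \<gamma> N d d"
  by (simp add: eqv_def)

lemma eqv_sym: "eqv \<gamma> N d d' \<Longrightarrow> eqv \<gamma> N d' d"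
  by (simp add: eqv_def)

lemma eqv_weaken:
  assumes "eqv \<gamma> N d d'" "\<gamma>' < \<gamma> \<or> \<gamma>' = \<gamma> \<and> M \<le> N"
  shows "eqv \<gamma>' M d d'"
  unfolding eqv_def
proof (intro allI impI)
  fix \<delta> n assume "\<delta> < \<gamma>' \<or> \<delta> = \<gamma>' \<and> n \<le> M"
  then have "\<delta> < \<gamma> \<or> \<delta> = \<gamma> \<and> n \<le> N" using assms(2) by auto
  then show "(ge \<delta> n d \<longleftrightarrow> ge \<delta> n d') \<and> (ge \<delta> n (- d) \<longleftrightarrow> ge \<delta> n (- d'))"
    using assms(1)[unfolded eqv_def, rule_format, of \<delta> n] by blast
qed

lemma eqv_sign:
  assumes "eqv \<gamma> N d d'" "0 \<le> N"
  shows "0 \<le> d \<longleftrightarrow> 0 \<le> d'" "0 < d \<longleftrightarrow> 0 < d'" "d = 0 \<longleftrightarrow> d' = 0"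
proof -
  have ge0: "ge \<gamma> 0 x \<longleftrightarrow> 0 \<le> x" for x
  proof (cases "0 < x")
    case True
    then show ?thesis using ge_lead zpow_pos_iff by (metis less_imp_le order_refl)
  qed (auto simp: ge_zero ge_neg not_less le_less)
  have "0 \<le> d \<longleftrightarrow> 0 \<le> d'" "0 \<le> - d \<longleftrightarrow> 0 \<le> - d'"
    using assms ge0 unfolding eqv_def by blast+
  then show "0 \<le> d \<longleftrightarrow> 0 \<le> d'" "0 < d \<longleftrightarrow> 0 < d'" "d = 0 \<longleftrightarrow> d' = 0" by auto
qed

text \<open>\<open>ge\<close> depends on the leading term only. Below \<gamma> the leading terms
  must therefore be equal; from \<gamma> on only the number of units at \<gamma> that they reach is
  compared, up to N.\<close>

lemma eqv_lead:
  assumes p: "lead p \<delta> a" and p': "lead p' \<delta>' a'" and N: "0 < N"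
  shows "eqv \<gamma> N p p' \<longleftrightarrow>
    (if \<delta> < \<gamma> then \<delta>' = \<delta> \<and> a' = a
     else \<gamma> \<le> \<delta>' \<and> (\<forall>n\<le>N. (\<gamma> < \<delta> \<or> n \<le> a) \<longleftrightarrow> (\<gamma> < \<delta>' \<or> n \<le> a')))" (is "_ \<longleftrightarrow> ?R")
proof -
  have a: "0 < a" "0 < a'" using p p' by (auto simp: lead_def)
  have "- p < 0" "- p' < 0" using lead_pos p p' by auto
  then have "eqv \<gamma> N p p' \<longleftrightarrow> (\<forall>\<epsilon> n. \<epsilon> < \<gamma> \<or> \<epsilon> = \<gamma> \<and> n \<le> N \<longrightarrow>
      (n \<le> 0 \<or> \<epsilon> < \<delta> \<or> (\<epsilon> = \<delta> \<and> n \<le> a)) = (n \<le> 0 \<or> \<epsilon> < \<delta>' \<or> (\<epsilon> = \<delta>' \<and> n \<le> a')))" (is "_ \<longleftrightarrow> ?M")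
    by (simp add: eqv_def ge_neg ge_lead[OF p] ge_lead[OF p'])
  also have "?M \<longleftrightarrow> ?R"
  proof
    assume M: ?M
    show ?R
    proof (cases "\<delta> < \<gamma>")
      case True
      have "\<not> \<delta>' < \<delta>"
        using M[rule_format, of \<delta> 1] True a by auto
      moreover have "\<not> \<delta> < \<delta>'"
        using M[rule_format, of \<delta> "a + 1"] True a by auto
      ultimately have "\<delta>' = \<delta>" by simp
      moreover have "a' = a"
        using M[rule_format, of \<delta> a] M[rule_format, of \<delta> a'] True a \<open>\<delta>' = \<delta>\<close> by auto
      ultimately show ?thesis using True by simp
    next
      case False
      have "\<gamma> \<le> \<delta>'"
        using M[rule_format, of \<gamma> 1] False a N by (cases \<gamma> \<delta> rule: linorder_cases) auto
      moreover have "(\<gamma> < \<delta> \<or> n \<le> a) \<longleftrightarrow> (\<gamma> < \<delta>' \<or> n \<le> a')" if "n \<le> N" for n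
        using M[rule_format, of \<gamma> n] that False a \<open>\<gamma> \<le> \<delta>'\<close> by (auto simp: not_less le_less)
      ultimately show ?thesis using False by simp
    qed
  next
    assume R: ?R
    show ?M
    proof (intro allI impI)
      fix \<epsilon> n assume *: "\<epsilon> < \<gamma> \<or> \<epsilon> = \<gamma> \<and> n \<le> N"
      show "(n \<le> 0 \<or> \<epsilon> < \<delta> \<or> (\<epsilon> = \<delta> \<and> n \<le> a)) = (n \<le> 0 \<or> \<epsilon> < \<delta>' \<or> (\<epsilon> = \<delta>' \<and> n \<le> a'))"
      proof (cases "\<delta> < \<gamma>")
        case True
        then show ?thesis using R by simp
      next
        case False
        then have "\<gamma> \<le> \<delta>" "\<gamma> \<le> \<delta>'" "\<forall>n\<le>N. (\<gamma> < \<delta> \<or> n \<le> a) \<longleftrightarrow> (\<gamma> < \<delta>' \<or> n \<le> a')"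
          using R by auto
        then show ?thesis using * a by (auto simp: le_less)
      qed
    qed
  qed
  finally show ?thesis .
qed

text \<open>The leading term of a sum of nonnegative elements is determined by those of the
  summands.\<close>

lemma eqv_add:
  assumes "eqv \<gamma> N p p'" "eqv \<gamma> N q q'" "0 < N" "0 \<le> p" "0 \<le> q"
  shows "eqv \<gamma> N (p + q) (p' + q')"
proof (cases "p = 0 \<or> q = 0")
  case True
  then show ?thesis using eqv_sign(3)[OF assms(1)] eqv_sign(3)[OF assms(2)] assms by auto
next
  case False
  then have "0 < p" "0 < q" "0 < p'" "0 < q'"
    using assms eqv_sign(2)[OF assms(1)] eqv_sign(2)[OF assms(2)] by auto
  then obtain \<delta> a \<epsilon> b \<delta>' a' \<epsilon>' b' where t: "lead p \<delta> a" "lead q \<epsilon> b" "lead p' \<delta>' a'" "lead q' \<epsilon>' b'"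
    unfolding zpow_pos_iff by blast
  then have pos: "0 < a" "0 < b" "0 < a'" "0 < b'" by (auto simp: lead_def)
  note P = assms(1)[unfolded eqv_lead[OF t(1) t(3) assms(3)]]
  note Q = assms(2)[unfolded eqv_lead[OF t(2) t(4) assms(3)]]
  have high: "(\<gamma> < max \<delta> \<epsilon> \<or> n \<le> (if \<delta> < \<epsilon> then b else if \<epsilon> < \<delta> then a else a + b)) \<longleftrightarrow>
      \<gamma> < \<delta> \<or> \<gamma> < \<epsilon> \<or> n \<le> a + b" if "\<gamma> \<le> \<delta>" "\<gamma> \<le> \<epsilon>" for \<delta> \<epsilon> a b and n :: int
    using that by (auto simp: max_def)
  show ?thesis
    unfolding eqv_lead[OF lead_add[OF t(1,2)] lead_add[OF t(3,4)] assms(3)]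
  proof (cases "\<delta> < \<gamma> \<or> \<epsilon> < \<gamma>")
    case True
    show "if max \<delta> \<epsilon> < \<gamma> then max \<delta>' \<epsilon>' = max \<delta> \<epsilon> \<and>
        (if \<delta>' < \<epsilon>' then b' else if \<epsilon>' < \<delta>' then a' else a' + b') = (if \<delta> < \<epsilon> then b else if \<epsilon> < \<delta> then a else a + b)
      else \<gamma> \<le> max \<delta>' \<epsilon>' \<and> (\<forall>n\<le>N. (\<gamma> < max \<delta> \<epsilon> \<or> n \<le> (if \<delta> < \<epsilon> then b else if \<epsilon> < \<delta> then a else a + b)) =
        (\<gamma> < max \<delta>' \<epsilon>' \<or> n \<le> (if \<delta>' < \<epsilon>' then b' else if \<epsilon>' < \<delta>' then a' else a' + b')))"
    proof (cases "\<delta> < \<gamma>")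
      case d: True
      then have 1: "\<delta>' = \<delta>" "a' = a" using P by auto
      show ?thesis
      proof (cases "\<epsilon> < \<gamma>")
        case True
        then have "\<epsilon>' = \<epsilon>" "b' = b" using Q by auto
        with 1 d True show ?thesis by simp
      next
        case False
        then have 2: "\<gamma> \<le> \<epsilon>'" "\<forall>n\<le>N. (\<gamma> < \<epsilon> \<or> n \<le> b) \<longleftrightarrow> (\<gamma> < \<epsilon>' \<or> n \<le> b')" using Q by auto
        have "\<delta> < \<epsilon>" "\<delta> < \<epsilon>'" using d False 2(1) by auto
        then show ?thesis using 1 2 False by (simp add: max_absorb2)
      qed
    next
      case d: False
      then have e: "\<epsilon> < \<gamma>" using True by simp
      then have 1: "\<epsilon>' = \<epsilon>" "b' = b" using Q by auto
      have 2: "\<gamma> \<le> \<delta>'" "\<forall>n\<le>N. (\<gamma> < \<delta> \<or> n \<le> a) \<longleftrightarrow> (\<gamma> < \<delta>' \<or> n \<le> a')" using P d by auto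
      have "\<epsilon> < \<delta>" "\<epsilon> < \<delta>'" using d e 2(1) by auto
      moreover have "\<not> \<delta> < \<epsilon>" "\<not> \<delta>' < \<epsilon>" using calculation by auto
      ultimately show ?thesis using 1 2 d by (simp add: max_absorb1)
    qed
  next
    case False
    then have le: "\<gamma> \<le> \<delta>" "\<gamma> \<le> \<epsilon>" "\<gamma> \<le> \<delta>'" "\<gamma> \<le> \<epsilon>'" and
      P': "\<And>n. n \<le> N \<Longrightarrow> (\<gamma> < \<delta> \<or> n \<le> a) \<longleftrightarrow> (\<gamma> < \<delta>' \<or> n \<le> a')" and
      Q': "\<And>n. n \<le> N \<Longrightarrow> (\<gamma> < \<epsilon> \<or> n \<le> b) \<longleftrightarrow> (\<gamma> < \<epsilon>' \<or> n \<le> b')"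
      using P Q by auto
    have "(\<gamma> < \<delta> \<or> \<gamma> < \<epsilon> \<or> n \<le> a + b) \<longleftrightarrow> (\<gamma> < \<delta>' \<or> \<gamma> < \<epsilon>' \<or> n \<le> a' + b')" if "n \<le> N" for n
    \<comment> \<open>Either one summand reaches the cap N, and then the sums on both sides do, or
      both coefficients lie below N at exponent \<gamma> and are the same on the two sides.\<close>
    proof (cases "(\<gamma> < \<delta> \<or> N \<le> a) \<or> (\<gamma> < \<epsilon> \<or> N \<le> b)")
      case True
      then show ?thesis using P'[of N] Q'[of N] that pos by auto
    next
      case False
      then have "\<not> \<gamma> < \<delta>'" "\<not> \<gamma> < \<epsilon>'" "a = a'" "b = b'"
        using P'[of "a + 1"] P'[of a] P'[of a'] Q'[of "b + 1"] Q'[of b] Q'[of b'] by auto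
      then show ?thesis using False by simp
    qed
    then show "if max \<delta> \<epsilon> < \<gamma> then max \<delta>' \<epsilon>' = max \<delta> \<epsilon> \<and>
        (if \<delta>' < \<epsilon>' then b' else if \<epsilon>' < \<delta>' then a' else a' + b') = (if \<delta> < \<epsilon> then b else if \<epsilon> < \<delta> then a else a + b)
      else \<gamma> \<le> max \<delta>' \<epsilon>' \<and> (\<forall>n\<le>N. (\<gamma> < max \<delta> \<epsilon> \<or> n \<le> (if \<delta> < \<epsilon> then b else if \<epsilon> < \<delta> then a else a + b)) =
        (\<gamma> < max \<delta>' \<epsilon>' \<or> n \<le> (if \<delta>' < \<epsilon>' then b' else if \<epsilon>' < \<delta>' then a' else a' + b')))"
      unfolding high[OF le(1,2)] high[OF le(3,4)] using le by auto
  qed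
qed

text \<open>A canonical monomial in the \<open>eqv\<close> class of a positive element: the exponent
  is capped at \<gamma> and the coefficient there at N. The cap makes it fit into every gadget whose
  exponent exceeds \<gamma>.\<close>

definition mon_approx :: "cord \<Rightarrow> int \<Rightarrow> cord \<Rightarrow> int \<Rightarrow> zpow" where
  "mon_approx \<gamma> N \<delta> a = mon (min \<delta> \<gamma>) (if \<delta> < \<gamma> then a else if \<delta> = \<gamma> then min a N else N)"

lemma lead_mon_approx:
  "lead p \<delta> a \<Longrightarrow> 0 < (N :: int) \<Longrightarrow>
    lead (mon_approx \<gamma> N \<delta> a) (min \<delta> \<gamma>) (if \<delta> < \<gamma> then a else if \<delta> = \<gamma> then min a N else N)"
  unfolding mon_approx_def by (rule lead_mon) (simp add: lead_def)

lemma eqv_mon_approx: "lead p \<delta> a \<Longrightarrow> 0 < N \<Longrightarrow> eqv \<gamma> N p (mon_approx \<gamma> N \<delta> a)"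
  by (subst eqv_lead[OF _ lead_mon_approx]) (auto simp: min_def not_less)

lemma lead_le: "lead p \<delta> a \<Longrightarrow> lead q \<epsilon> b \<Longrightarrow> p \<le> q \<Longrightarrow> \<delta> < \<epsilon> \<or> \<delta> = \<epsilon> \<and> a \<le> b"
proof (rule ccontr)
  assume t: "lead p \<delta> a" "lead q \<epsilon> b" "p \<le> q" and "\<not> (\<delta> < \<epsilon> \<or> \<delta> = \<epsilon> \<and> a \<le> b)"
  then have "\<epsilon> < \<delta> \<or> \<epsilon> = \<delta> \<and> b < a" by auto
  then have "lead (p - q) \<delta> (co (p - q) \<delta>)"
    using t(1,2) by (auto simp: lead_def)
  then show False using lead_pos t(3) by fastforce
qed

lemma lead_diff_mon:
  assumes "lead D \<delta> c" "0 < k" "\<epsilon> < \<delta> \<or> \<epsilon> = \<delta> \<and> k < c"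
  shows "lead (D - mon \<epsilon> k) \<delta> (if \<epsilon> = \<delta> then c - k else c)"
  using assms by (auto simp: lead_def)

text \<open>Halving the bound \<open>N\<close> at every new point replaces the simultaneous choice of several points.
  The smaller of the two parts is matched by a monomial.\<close>

lemma eqv_split_le:
  assumes D: "eqv \<gamma> (2 * N) (p + q) D'" and N: "0 < N" and p: "0 < p" and pq: "p \<le> q"
  obtains \<delta> a p' where "lead p \<delta> a" "p' = mon_approx \<gamma> N \<delta> a" "eqv \<gamma> N p p'" "eqv \<gamma> N q (D' - p')"
    "\<exists>\<delta>'\<ge>min \<delta> \<gamma>. co D' \<delta>' \<noteq> 0"
proof -
  obtain \<delta> a where tp: "lead p \<delta> a" using p zpow_pos_iff by blast
  obtain \<epsilon> b where tq: "lead q \<epsilon> b" using p pq zpow_pos_iff by (metis less_le_trans)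
  have "0 < p + q" using p pq by (simp add: add_pos_pos)
  then have "0 < D'" using eqv_sign(2)[OF D] N by simp
  then obtain \<delta>' c' where tD': "lead D' \<delta>' c'" using zpow_pos_iff by blast
  have pos: "0 < a" "0 < b" "0 < c'" using tp tq tD' by (auto simp: lead_def)
  define \<eta> k where "\<eta> = min \<delta> \<gamma>" and "k = (if \<delta> < \<gamma> then a else if \<delta> = \<gamma> then min a N else N)"
  have k: "0 < k" using pos N by (simp add: k_def)
  have ord: "\<delta> < \<epsilon> \<or> \<delta> = \<epsilon> \<and> a \<le> b" by (rule lead_le[OF tp tq pq])
  have tD: "lead (p + q) \<epsilon> (if \<delta> < \<epsilon> then b else a + b)"
    using lead_add[OF tp tq] ord by (auto simp: max_def split: if_splits)
  have N2: "0 < 2 * N" using N by simp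
  note E = D[unfolded eqv_lead[OF tD tD' N2]]
  have small: "\<delta>' = \<epsilon> \<and> c' = (if \<delta> < \<epsilon> then b else a + b)" "\<eta> = \<delta>" "k = a" if "\<epsilon> < \<gamma>"
    using E that ord by (auto simp: \<eta>_def k_def)
  have large: "\<gamma> \<le> \<delta>'" "(\<gamma> < \<epsilon> \<or> m \<le> (if \<delta> < \<epsilon> then b else a + b)) \<longleftrightarrow> (\<gamma> < \<delta>' \<or> m \<le> c')"
    if "\<not> \<epsilon> < \<gamma>" "m \<le> 2 * N" for m
    using E that by auto
  have \<eta>: "\<eta> \<le> \<gamma>" "\<eta> = \<gamma> \<longleftrightarrow> \<gamma> \<le> \<delta>" "\<gamma> \<le> \<delta> \<Longrightarrow> k \<le> N" "\<gamma> = \<delta> \<Longrightarrow> k = min a N"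
    by (auto simp: \<eta>_def k_def min_def)
  \<comment> \<open>Subtracting the monomial from \<open>D'\<close> must leave a positive rest with
    the same leading exponent. If the exponents coincide, the factor 2 decides: either 2 * N \<le>
    c' while k \<le> N, or c' is at least a + b and k at most a.\<close>
  have cond: "\<eta> < \<delta>' \<or> \<eta> = \<delta>' \<and> k < c'"
  proof (cases "\<epsilon> < \<gamma>")
    case True
    then show ?thesis using small ord pos by auto
  next
    case False
    have "k < c'" if "\<eta> = \<delta>'"
    proof -
      have g: "\<delta>' = \<gamma>" "\<gamma> \<le> \<delta>" "k \<le> N"
        using large(1)[OF False, of 0] N that \<eta> by auto
      show ?thesis
      proof (cases "\<gamma> < \<epsilon> \<or> 2 * N \<le> a + b")
        case True
        have "\<not> \<delta> < \<epsilon> \<or> \<gamma> < \<epsilon>" using g(2) by auto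
        then have "2 * N \<le> c'" using large(2)[OF False, of "2 * N"] True g(1) by auto
        then show ?thesis using g(3) N by simp
      next
        case F: False
        then have "\<delta> = \<gamma>" "\<epsilon> = \<gamma>" using g(2) ord False by auto
        then have "a + b \<le> c'" "k \<le> a" using large(2)[OF False, of "a + b"] F g(1) \<eta>(4) by auto
        then show ?thesis using pos by simp
      qed
    qed
    then show ?thesis using large(1)[OF False, of 0] N \<eta>(1) by (auto simp: le_less)
  qed
  have t': "lead (D' - mon \<eta> k) \<delta>' (if \<eta> = \<delta>' then c' - k else c')"
    by (rule lead_diff_mon[OF tD' k cond])
  have "eqv \<gamma> N q (D' - mon \<eta> k)"
    unfolding eqv_lead[OF tq t' N]
  proof (cases "\<epsilon> < \<gamma>")
    case True
    then show "if \<epsilon> < \<gamma> then \<delta>' = \<epsilon> \<and> (if \<eta> = \<delta>' then c' - k else c') = b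
      else \<gamma> \<le> \<delta>' \<and> (\<forall>n\<le>N. (\<gamma> < \<epsilon> \<or> n \<le> b) = (\<gamma> < \<delta>' \<or> n \<le> (if \<eta> = \<delta>' then c' - k else c')))"
      using small ord by auto
  next
    case False
    have "(\<gamma> < \<epsilon> \<or> n \<le> b) = (\<gamma> < \<delta>' \<or> n \<le> (if \<eta> = \<delta>' then c' - k else c'))" if n: "n \<le> N" for n
    proof (cases "\<gamma> < \<epsilon>")
      case True
      have "\<gamma> < \<delta>' \<or> 2 * N \<le> c'" using large(2)[OF False, of "2 * N"] True by simp
      then show ?thesis using True n N \<eta>(2,3) large(1)[OF False, of 0] by auto
    next
      case e: False
      then have \<epsilon>: "\<epsilon> = \<gamma>" using False by simp
      show ?thesis
      proof (cases "\<delta> < \<epsilon>")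
        case True
        then have "\<eta> \<noteq> \<delta>'" using \<eta>(2) \<eta>(1) \<epsilon> large(1)[OF False, of 0] N by auto
        then show ?thesis using large(2)[OF False, of n] True e n N by simp
      next
        case d: False
        then have \<delta>: "\<delta> = \<gamma>" "a \<le> b" using ord \<epsilon> by auto
        then have \<eta>': "\<eta> = \<gamma>" "k = min a N" using \<eta> by auto
        have L: "m \<le> a + b \<longleftrightarrow> \<gamma> < \<delta>' \<or> m \<le> c'" if "m \<le> 2 * N" for m
          using large(2)[OF False that] \<epsilon> d by simp
        show ?thesis
        proof (cases "2 * N \<le> a + b")
          case True
          then show ?thesis using L[of "2 * N"] \<delta>(2) \<eta>' n N by auto
        next
          case f: False
          then have "\<not> \<gamma> < \<delta>'" "c' = a + b"
            using L[of "a + b + 1"] L[of "a + b"] by auto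
          moreover have "\<delta>' = \<gamma>" using calculation(1) large(1)[OF False, of 0] N by auto
          ultimately show ?thesis using \<eta>' \<epsilon> f \<delta>(2) by auto
        qed
      qed
    qed
    then show "if \<epsilon> < \<gamma> then \<delta>' = \<epsilon> \<and> (if \<eta> = \<delta>' then c' - k else c') = b
      else \<gamma> \<le> \<delta>' \<and> (\<forall>n\<le>N. (\<gamma> < \<epsilon> \<or> n \<le> b) = (\<gamma> < \<delta>' \<or> n \<le> (if \<eta> = \<delta>' then c' - k else c')))"
      using False large(1)[OF False, of 0] N by auto
  qed
  moreover have "mon_approx \<gamma> N \<delta> a = mon \<eta> k" by (simp add: mon_approx_def \<eta>_def k_def)
  moreover have "\<exists>\<delta>''\<ge>min \<delta> \<gamma>. co D' \<delta>'' \<noteq> 0"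
    using cond tD' pos unfolding \<eta>_def[symmetric] lead_def by (intro exI[of _ \<delta>']) auto
  ultimately show thesis using that[OF tp refl] eqv_mon_approx[OF tp N, of \<gamma>] by simp
qed

text \<open>These elements form the power of the integers with exponent \<open>e\<close>, that is,
  the gadget.\<close>

definition supp_below :: "cord \<Rightarrow> zpow \<Rightarrow> bool" where
  "supp_below e d \<longleftrightarrow> (\<forall>\<delta>\<ge>e. co d \<delta> = 0)"

lemma supp_below_simps [simp]:
  "supp_below e 0" "supp_below e p \<Longrightarrow> supp_below e q \<Longrightarrow> supp_below e (p + q)"
  "supp_below e p \<Longrightarrow> supp_below e q \<Longrightarrow> supp_below e (p - q)" "supp_below e (- p) \<longleftrightarrow> supp_below e p"
  "supp_below e (mon \<delta> k) \<longleftrightarrow> \<delta> < e \<or> k = 0"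
  by (auto simp: supp_below_def not_le)

lemma lead_supp_below: "lead p \<delta> a \<Longrightarrow> supp_below e p \<Longrightarrow> \<delta> < e"
  unfolding lead_def supp_below_def by (metis less_irrefl not_le)

lemma supp_below_mon_approx:
  "lead p \<delta> a \<Longrightarrow> supp_below e p \<Longrightarrow> e = e' \<or> \<gamma> < e' \<Longrightarrow> supp_below e' (mon_approx \<gamma> N \<delta> a)"
  by (auto simp: mon_approx_def min_less_iff_disj dest: lead_supp_below)

text \<open>The smaller part becomes a monomial and the larger one the remainder. The monomial stays
  in the gadget because \<open>D'\<close> has a term at its exponent or above.\<close>

lemma eqv_split:
  assumes D: "eqv \<gamma> (2 * N) (p + q) D'" and N: "0 < N" and p: "0 < p" "0 < q"
    and supp: "supp_below e' D'"
  obtains p' where "supp_below e' p'" "eqv \<gamma> N p p'" "eqv \<gamma> N q (D' - p')"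
proof (cases "p \<le> q")
  case True
  obtain \<delta> a p' where p': "p' = mon_approx \<gamma> N \<delta> a" "eqv \<gamma> N p p'" "eqv \<gamma> N q (D' - p')"
    "\<exists>\<delta>'\<ge>min \<delta> \<gamma>. co D' \<delta>' \<noteq> 0"
    using eqv_split_le[OF D N p(1) True] by metis
  then have "min \<delta> \<gamma> < e'" using supp unfolding supp_below_def by (metis le_less_trans not_le)
  then have "supp_below e' p'" by (simp add: p'(1) mon_approx_def)
  then show thesis using p'(2,3) by (rule that)
next
  case False
  then have "q \<le> p" by simp
  obtain \<delta> a q' where q': "q' = mon_approx \<gamma> N \<delta> a" "eqv \<gamma> N q q'" "eqv \<gamma> N p (D' - q')"
    "\<exists>\<delta>'\<ge>min \<delta> \<gamma>. co D' \<delta>' \<noteq> 0"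
    using eqv_split_le[OF D[unfolded add.commute[of p q]] N p(2) \<open>q \<le> p\<close>] by metis
  then have "min \<delta> \<gamma> < e'" using supp unfolding supp_below_def by (metis le_less_trans not_le)
  then have "supp_below e' (D' - q')" using supp by (simp add: q'(1) mon_approx_def)
  then show thesis using q'(3) by (rule that) (simp add: q'(2))
qed

text \<open>Only the nearest neighbours of \<open>x\<close> on either side matter; the differences
  to the other points follow by \<open>eqv_add\<close>. Between two neighbours
  \<open>eqv_split\<close> is applied at the cost of half the budget. Beyond an end, a capped
  monomial is added or subtracted, and it fits because the two exponents are equal or the target
  exceeds \<gamma>.\<close>

lemma gadget_extension:
  assumes fin: "finite F" and N: "0 < N"
    and F: "\<And>f f' h h'. (f, f') \<in> F \<Longrightarrow> (h, h') \<in> F \<Longrightarrow> eqv \<gamma> (2 * N) (f - h) (f' - h')"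
    and supp: "\<And>f f'. (f, f') \<in> F \<Longrightarrow> supp_below e f \<and> supp_below e' f'"
    and x: "supp_below e x" and e: "e = e' \<or> \<gamma> < e'"
  obtains x' where "supp_below e' x'" "\<And>f f'. (f, f') \<in> F \<Longrightarrow> eqv \<gamma> N (x - f) (x' - f')"
proof -
  have N2: "0 < 2 * N" "0 \<le> 2 * N" using N by auto
  have wk: "eqv \<gamma> N d d'" if "eqv \<gamma> (2 * N) d d'" for d d'
    using eqv_weaken[OF that] N by simp
  show thesis
  proof (cases "x \<in> fst ` F")
    case True
    then obtain x' where "(x, x') \<in> F" by auto
    then show ?thesis using that[of x'] F supp wk N by fastforce
  next
    case new: False
    define L where "L = {p \<in> F. fst p < x}"
    define U where "U = {p \<in> F. x < fst p}"
    have LU: "F = L \<union> U" using new unfolding L_def U_def by (auto simp: image_iff)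
    have fin': "finite (fst ` L)" "finite (fst ` U)" using fin by (auto simp: L_def U_def)
    have low: "\<exists>l l'. (l, l') \<in> L \<and> (\<forall>(f, f')\<in>L. f \<le> l)" if "L \<noteq> {}"
    proof -
      have "Max (fst ` L) \<in> fst ` L" using fin'(1) that by (intro Max_in) auto
      then obtain l l' where "(l, l') \<in> L" "l = Max (fst ` L)" by auto
      moreover have "\<forall>(f, f')\<in>L. f \<le> l"
        unfolding calculation(2) by (auto intro!: Max_ge[OF fin'(1)] intro: rev_image_eqI)
      ultimately show ?thesis by blast
    qed
    have up: "\<exists>u u'. (u, u') \<in> U \<and> (\<forall>(f, f')\<in>U. u \<le> f)" if "U \<noteq> {}"
    proof -
      have "Min (fst ` U) \<in> fst ` U" using fin'(2) that by (intro Min_in) auto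
      then obtain u u' where "(u, u') \<in> U" "u = Min (fst ` U)" by auto
      moreover have "\<forall>(f, f')\<in>U. u \<le> f"
        unfolding calculation(2) by (auto intro!: Min_le[OF fin'(2)] intro: rev_image_eqI)
      ultimately show ?thesis by blast
    qed
    have from_low: "eqv \<gamma> N (x - f) (x' - f')"
      if l: "(l, l') \<in> L" "\<forall>(f, f')\<in>L. f \<le> l" and x': "eqv \<gamma> N (x - l) (x' - l')" and f: "(f, f') \<in> L" for l l' x' f f'
    proof -
      have "eqv \<gamma> N (l - f) (l' - f')" using F wk l(1) f LU by auto
      then have "eqv \<gamma> N ((x - l) + (l - f)) ((x' - l') + (l' - f'))"
        using l f by (intro eqv_add[OF x' _ N]) (auto simp: L_def)
      then show ?thesis by simp
    qed
    have from_up: "eqv \<gamma> N (x - f) (x' - f')"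
      if u: "(u, u') \<in> U" "\<forall>(f, f')\<in>U. u \<le> f" and x': "eqv \<gamma> N (u - x) (u' - x')" and f: "(f, f') \<in> U" for u u' x' f f'
    proof -
      have "eqv \<gamma> N (f - u) (f' - u')" using F wk u(1) f LU by auto
      then have "eqv \<gamma> N ((u - x) + (f - u)) ((u' - x') + (f' - u'))"
        using u f by (intro eqv_add[OF x' _ N]) (auto simp: U_def)
      then have "eqv \<gamma> N (- (x - f)) (- (x' - f'))" by simp
      then show ?thesis by (simp only: eqv_minus)
    qed
    show ?thesis
    proof (cases "L = {}")
      case L: True
      show ?thesis
      proof (cases "U = {}")
        case True
        then show ?thesis using that[of 0] L LU by simp
      next
        case False
        then obtain u u' where u: "(u, u') \<in> U" "\<forall>(f, f')\<in>U. u \<le> f" using up by blast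
        then have "0 < u - x" by (auto simp: U_def)
        then obtain \<delta> a where t: "lead (u - x) \<delta> a" using zpow_pos_iff by blast
        have su: "supp_below e u" "supp_below e' u'" using supp u(1) LU by auto
        show ?thesis
        proof (rule that[of "u' - mon_approx \<gamma> N \<delta> a"])
          show "supp_below e' (u' - mon_approx \<gamma> N \<delta> a)"
            using supp_below_mon_approx[OF t _ e] x su by simp
          show "eqv \<gamma> N (x - f) (u' - mon_approx \<gamma> N \<delta> a - f')" if "(f, f') \<in> F" for f f'
            using from_up[OF u] eqv_mon_approx[OF t N] that L LU by simp
        qed
      qed
    next
      case False
      then obtain l l' where l: "(l, l') \<in> L" "\<forall>(f, f')\<in>L. f \<le> l" using low by blast
      then have lx: "0 < x - l" by (auto simp: L_def)
      then obtain \<delta> a where t: "lead (x - l) \<delta> a" using zpow_pos_iff by blast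
      have sl: "supp_below e l" "supp_below e' l'" using supp l(1) LU by auto
      show ?thesis
      proof (cases "U = {}")
        case True
        show ?thesis
        proof (rule that[of "l' + mon_approx \<gamma> N \<delta> a"])
          show "supp_below e' (l' + mon_approx \<gamma> N \<delta> a)"
            using supp_below_mon_approx[OF t _ e] x sl by simp
          show "eqv \<gamma> N (x - f) (l' + mon_approx \<gamma> N \<delta> a - f')" if "(f, f') \<in> F" for f f'
            using from_low[OF l] eqv_mon_approx[OF t N] that True LU by simp
        qed
      next
        case False
        then obtain u u' where u: "(u, u') \<in> U" "\<forall>(f, f')\<in>U. u \<le> f" using up by blast
        then have ux: "0 < u - x" by (auto simp: U_def)
        have "eqv \<gamma> (2 * N) (u - l) (u' - l')" using F u(1) l(1) LU by blast
        then have D: "eqv \<gamma> (2 * N) ((x - l) + (u - x)) (u' - l')" by simp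
        have "supp_below e' (u' - l')" using sl supp[of u u'] u(1) LU by simp
        then obtain p' where p': "supp_below e' p'" "eqv \<gamma> N (x - l) p'" "eqv \<gamma> N (u - x) (u' - l' - p')"
          using eqv_split[OF D N lx ux] by metis
        show ?thesis
        proof (rule that[of "l' + p'"])
          show "supp_below e' (l' + p')" using p'(1) sl by simp
          have 1: "eqv \<gamma> N (x - l) (l' + p' - l')" "eqv \<gamma> N (u - x) (u' - (l' + p'))"
            using p' by (simp_all add: algebra_simps)
          show "eqv \<gamma> N (x - f) (l' + p' - f')" if "(f, f') \<in> F" for f f'
            using from_low[OF l 1(1)] from_up[OF u 1(2)] that LU by blast
        qed
      qed
    qed
  qed
qed

section \<open>Ultrametric index orders\<close>

text \<open>The dyadic rationals and their complement are two disjoint dense sets: dyadic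
  coordinates lead to children in the tree, the others are the places of separators.\<close>

definition node :: "rat \<Rightarrow> bool" where
  "node q \<longleftrightarrow> (\<exists>n. q * 2 ^ n \<in> \<int>)"

lemma node_0: "node 0" and node_1: "node 1"
  by (auto simp: node_def)

text \<open>Otherwise the difference \<open>1 / (3 * 2 ^ m)\<close> would be dyadic as well, and 3
  would divide a power of 2.\<close>

lemma not_node_third:
  assumes "node q"
  shows "\<not> node (q + 1 / (3 * 2 ^ m))"
proof
  assume "node (q + 1 / (3 * 2 ^ m))"
  then obtain n where n: "(q + 1 / (3 * 2 ^ m)) * 2 ^ n \<in> \<int>" by (auto simp: node_def)
  obtain k where k: "q * 2 ^ k \<in> \<int>" using assms by (auto simp: node_def)
  have "(q + 1 / (3 * 2 ^ m)) * 2 ^ n * 2 ^ (k + m) - q * 2 ^ k * 2 ^ (n + m) \<in> \<int>"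
    by (intro Ints_diff Ints_mult n k) (auto intro: Ints_power)
  also have "(q + 1 / (3 * 2 ^ m)) * 2 ^ n * 2 ^ (k + m) - q * 2 ^ k * 2 ^ (n + m) = 2 ^ (n + k) / 3"
    by (simp add: field_simps power_add)
  finally obtain z where "(2 :: rat) ^ (n + k) / 3 = of_int z" by (auto elim: Ints_cases)
  then have "(of_int (2 ^ (n + k)) :: rat) = of_int (3 * z)" by (simp add: field_simps)
  then have "(2 :: int) ^ (n + k) = 3 * z" by (simp only: of_int_eq_iff)
  then have "3 dvd (2 :: int) ^ (n + k)" by simp
  moreover have "(2 :: int) ^ j mod 3 \<noteq> 0" for j
  proof (induction j)
    case (Suc j)
    have "(2 :: int) ^ Suc j mod 3 = 2 * (2 ^ j mod 3) mod 3" by (simp add: mod_simps)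
    moreover have "(2 :: int) ^ j mod 3 = 1 \<or> (2 :: int) ^ j mod 3 = 2"
      using Suc by presburger
    ultimately show ?case by auto
  qed simp
  ultimately show False by (simp add: dvd_eq_mod_eq_0)
qed

lemma dense_node:
  assumes "x < y"
  obtains q where "x < q" "q < y" "node q"
proof -
  obtain n where "1 / (y - x) < of_nat n" using reals_Archimedean2 by blast
  then have n: "1 / (y - x) < 2 ^ n" using of_nat_less_two_power less_trans by blast
  define q where "q = of_int (\<lfloor>x * 2 ^ n\<rfloor> + 1) / (2 ^ n :: rat)"
  have 1: "x * 2 ^ n < of_int (\<lfloor>x * 2 ^ n\<rfloor> + 1)" "of_int (\<lfloor>x * 2 ^ n\<rfloor> + 1) \<le> x * 2 ^ n + 1"
    by linarith+
  have 2: "1 < (y - x) * 2 ^ n" using n assms by (simp add: field_simps)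
  have "x < q" using 1 by (simp add: q_def field_simps)
  moreover have "of_int (\<lfloor>x * 2 ^ n\<rfloor> + 1) < y * 2 ^ n"
    by (rule le_less_trans[OF 1(2)]) (use 2 in \<open>simp add: algebra_simps\<close>)
  then have "q < y" by (simp add: q_def pos_divide_less_eq)
  moreover have "node q" unfolding node_def q_def by (rule exI[of _ n]) simp
  ultimately show thesis by (rule that)
qed

lemma dense_sep:
  assumes "x < y"
  obtains q where "x < q" "q < y" "\<not> node q"
proof -
  obtain q where q: "x < q" "q < y" "node q" using dense_node assms by blast
  obtain n where "1 / (y - q) < of_nat n" using reals_Archimedean2 by blast
  then have n: "1 / (y - q) < 2 ^ n" using of_nat_less_two_power less_trans by blast
  have p: "0 < (2 :: rat) ^ n" by simp
  have "1 < 2 ^ n * (y - q)" using n q(2) by (simp add: field_simps)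
  then have "1 < 3 * 2 ^ n * (y - q)" using p by linarith
  then have "1 / (3 * 2 ^ n) < y - q" by (simp add: field_simps)
  then have "q + 1 / (3 * 2 ^ n) < y" by simp
  moreover have "x < q + 1 / (3 * 2 ^ n)" by (rule less_trans[OF q(1)]) simp
  ultimately show thesis using that not_node_third[OF q(3)] by blast
qed

lemma dense_cut:
  assumes "finite L" "finite U" "\<And>l u. l \<in> L \<Longrightarrow> u \<in> U \<Longrightarrow> l < u"
  obtains q where "\<And>l. l \<in> L \<Longrightarrow> l < q" "\<And>u. u \<in> U \<Longrightarrow> q < u" "node q \<longleftrightarrow> B"
proof -
  have "\<exists>lo hi. lo < hi \<and> (\<forall>l\<in>L. l \<le> lo) \<and> (\<forall>u\<in>U. hi \<le> u)"
  proof (cases "L = {}")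
    case L: True
    show ?thesis
    proof (cases "U = {}")
      case True
      then show ?thesis using L by (intro exI[of _ 0] exI[of _ 1]) simp
    next
      case False
      have "Min U - 1 < Min U" by linarith
      moreover have "\<forall>u\<in>U. Min U \<le> u" using assms(2) by simp
      ultimately show ?thesis using L by blast
    qed
  next
    case L: False
    show ?thesis
    proof (cases "U = {}")
      case True
      have "Max L < Max L + 1" by linarith
      moreover have "\<forall>l\<in>L. l \<le> Max L" using assms(1) by simp
      ultimately show ?thesis using True by blast
    next
      case False
      then show ?thesis using L assms by (intro exI[of _ "Max L"] exI[of _ "Min U"]) simp
    qed
  qed
  then obtain lo hi where lh: "lo < hi" "\<forall>l\<in>L. l \<le> lo" "\<forall>u\<in>U. hi \<le> u" by blast
  obtain q where q: "lo < q" "q < hi" "node q \<longleftrightarrow> B"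
  proof (cases B)
    case True
    obtain q where "lo < q" "q < hi" "node q" using lh(1) by (rule dense_node)
    then show thesis using that True by blast
  next
    case False
    obtain q where "lo < q" "q < hi" "\<not> node q" using lh(1) by (rule dense_sep)
    then show thesis using that False by blast
  qed
  show thesis
  proof (rule that)
    show "l < q" if "l \<in> L" for l using le_less_trans[OF _ q(1)] lh(2) that by blast
    show "q < u" if "u \<in> U" for u using less_le_trans[OF q(2)] lh(3) that by blast
  qed (rule q(3))
qed

text \<open>Finite support keeps the set of branches countable, and the order on such functions is
  lexicographic.\<close>

type_synonym idx = "nat \<Rightarrow>\<^sub>0 rat"

definition agr :: "idx \<Rightarrow> idx \<Rightarrow> nat \<Rightarrow> bool" where
  "agr x y i \<longleftrightarrow> (\<forall>l<i. Poly_Mapping.lookup x l = Poly_Mapping.lookup y l)"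

definition leaf :: "idx \<Rightarrow> bool" where
  "leaf x \<longleftrightarrow> (\<forall>i. node (Poly_Mapping.lookup x i))"

text \<open>The first k coordinates name a node of level k, and coordinate k is a place between its
  children. The zeros behind it leave exactly one index at this place.\<close>

definition sepx :: "nat \<Rightarrow> idx \<Rightarrow> bool" where
  "sepx k x \<longleftrightarrow> (\<forall>i<k. node (Poly_Mapping.lookup x i)) \<and> \<not> node (Poly_Mapping.lookup x k) \<and>
    (\<forall>i>k. Poly_Mapping.lookup x i = 0)"

definition Idx :: "idx set" where
  "Idx = {x. leaf x \<or> (\<exists>k. sepx k x)}"

lemma sepx_unique: "sepx k x \<Longrightarrow> sepx l x \<Longrightarrow> k = l"
  by (cases k l rule: linorder_cases) (auto simp: sepx_def)

lemma leaf_not_sepx: "leaf x \<Longrightarrow> \<not> sepx k x"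
  by (auto simp: leaf_def sepx_def)

lemma leaf_0: "leaf 0"
  by (simp add: leaf_def node_0)

lemma agr_simps [simp]: "agr x x i" "agr x y 0"
  by (auto simp: agr_def)

lemma agr_sym: "agr x y i \<Longrightarrow> agr y x i"
  by (simp add: agr_def)

lemma agr_trans: "agr x y i \<Longrightarrow> agr y z i \<Longrightarrow> agr x z i"
  by (simp add: agr_def)

lemma agr_mono: "agr x y i \<Longrightarrow> j \<le> i \<Longrightarrow> agr x y j"
  by (simp add: agr_def)

lemma agr_Suc: "agr x y (Suc i) \<longleftrightarrow> agr x y i \<and> Poly_Mapping.lookup x i = Poly_Mapping.lookup y i"
  by (auto simp: agr_def less_Suc_eq)

lemma idx_less_iff: "x < y \<longleftrightarrow> (\<exists>k. agr x y k \<and> Poly_Mapping.lookup x k < Poly_Mapping.lookup y k)" for x y :: idx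
  by (auto simp: less_poly_mapping.rep_eq less_fun_def agr_def)

lemma first_difference:
  assumes "x \<noteq> (y :: idx)"
  obtains k where "agr x y k" "Poly_Mapping.lookup x k \<noteq> Poly_Mapping.lookup y k"
proof -
  from assms consider "x < y" | "y < x" by (rule linorder_neqE)
  then show thesis
    by cases (use that idx_less_iff agr_sym in \<open>metis less_irrefl\<close>)+
qed

lemma idx_less_at:
  "agr x y k \<Longrightarrow> Poly_Mapping.lookup x k \<noteq> Poly_Mapping.lookup y k \<Longrightarrow>
    x < y \<longleftrightarrow> Poly_Mapping.lookup x k < Poly_Mapping.lookup y k"
proof -
  assume k: "agr x y k" "Poly_Mapping.lookup x k \<noteq> Poly_Mapping.lookup y k"
  have "m = k" if "agr x y m" "Poly_Mapping.lookup x m < Poly_Mapping.lookup y m" for m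
    using k that by (cases m k rule: linorder_cases) (auto simp: agr_def)
  then show ?thesis using k(1) idx_less_iff by blast
qed

lemma agr_iff_le:
  "agr x y k \<Longrightarrow> Poly_Mapping.lookup x k \<noteq> Poly_Mapping.lookup y k \<Longrightarrow> agr x y i \<longleftrightarrow> i \<le> k"
  by (cases "i \<le> k") (auto simp: agr_def not_le)

lemma agr_all_eq: "(\<And>i. agr x y i) \<Longrightarrow> x = y"
  by (metis first_difference agr_Suc)

text \<open>Balls of the ultrametric are intervals: \<open>z\<close> outside the ball lies on the
  same side of all its elements.\<close>

lemma less_via_agr:
  assumes "agr y x k" "\<not> agr y z k"
  shows "y < z \<longleftrightarrow> x < z" "z < y \<longleftrightarrow> z < x"
proof -
  have "y \<noteq> z" using assms by auto
  then obtain m where m: "agr y z m" "Poly_Mapping.lookup y m \<noteq> Poly_Mapping.lookup z m"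
    by (rule first_difference)
  have "m < k" using agr_iff_le[OF m, of k] assms(2) by simp
  then have "agr x z m" "Poly_Mapping.lookup x m = Poly_Mapping.lookup y m"
    using assms(1) m(1) by (auto simp: agr_def)
  then show "y < z \<longleftrightarrow> x < z" "z < y \<longleftrightarrow> z < x"
    using idx_less_at[OF m] idx_less_at[of x z m] idx_less_at[of z y m] idx_less_at[of z x m] m agr_sym
    by (metis agr_sym)+
qed

section \<open>Finite partial isomorphisms of the index order\<close>

definition good :: "(idx \<times> idx) set \<Rightarrow> bool" where
  "good F \<longleftrightarrow> finite F \<and>
    (\<forall>(x, x')\<in>F. x \<in> Idx \<and> x' \<in> Idx \<and> (leaf x \<longleftrightarrow> leaf x') \<and> (\<forall>k. sepx k x \<longleftrightarrow> sepx k x')) \<and>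
    (\<forall>(x, x')\<in>F. \<forall>(y, y')\<in>F. (x < y \<longleftrightarrow> x' < y') \<and> (\<forall>i. agr x y i \<longleftrightarrow> agr x' y' i))"

lemma goodD:
  assumes "good F" "(x, x') \<in> F"
  shows "x \<in> Idx" "x' \<in> Idx" "leaf x \<longleftrightarrow> leaf x'" "sepx k x \<longleftrightarrow> sepx k x'"
    "(y, y') \<in> F \<Longrightarrow> x < y \<longleftrightarrow> x' < y'" "(y, y') \<in> F \<Longrightarrow> agr x y i \<longleftrightarrow> agr x' y' i"
    "(y, y') \<in> F \<Longrightarrow> x = y \<longleftrightarrow> x' = y'"
proof -
  show "x \<in> Idx" "x' \<in> Idx" "leaf x \<longleftrightarrow> leaf x'" "sepx k x \<longleftrightarrow> sepx k x'"
    using assms by (auto simp: good_def)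
  show ord: "x < y \<longleftrightarrow> x' < y'" if "(y, y') \<in> F"
    using assms that by (fastforce simp: good_def)
  show agr: "agr x y i \<longleftrightarrow> agr x' y' i" if "(y, y') \<in> F" for i
    using assms that by (fastforce simp: good_def)
  show "x = y \<longleftrightarrow> x' = y'" if "(y, y') \<in> F"
    using agr[OF that] agr_all_eq[of x y] agr_all_eq[of x' y'] by (metis agr_simps(1))
qed

lemma goodI:
  assumes "finite F"
    "\<And>x x'. (x, x') \<in> F \<Longrightarrow> x \<in> Idx \<and> x' \<in> Idx \<and> (leaf x \<longleftrightarrow> leaf x') \<and> (\<forall>k. sepx k x \<longleftrightarrow> sepx k x')"
    "\<And>x x' y y'. (x, x') \<in> F \<Longrightarrow> (y, y') \<in> F \<Longrightarrow> (x < y \<longleftrightarrow> x' < y') \<and> (\<forall>i. agr x y i \<longleftrightarrow> agr x' y' i)"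
  shows "good F"
proof -
  have "case p of (x, x') \<Rightarrow> x \<in> Idx \<and> x' \<in> Idx \<and> (leaf x \<longleftrightarrow> leaf x') \<and> (\<forall>k. sepx k x \<longleftrightarrow> sepx k x')"
    if "p \<in> F" for p
    using assms(2) that by (cases p) simp
  moreover have "case p of (x, x') \<Rightarrow> \<forall>(y, y')\<in>F. (x < y \<longleftrightarrow> x' < y') \<and> (\<forall>i. agr x y i \<longleftrightarrow> agr x' y' i)"
    if "p \<in> F" for p
    using assms(3) that by (cases p) fastforce
  ultimately show ?thesis unfolding good_def using assms(1) by simp
qed

lemma good_converse:
  assumes "good F"
  shows "good (F\<inverse>)"
proof (rule goodI)
  show "finite (F\<inverse>)" using assms by (simp add: good_def)
qed (use goodD[OF assms] in \<open>simp_all\<close>)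

lemma ex_idx: "finite {i. g i \<noteq> 0} \<Longrightarrow> \<exists>z :: idx. Poly_Mapping.lookup z = g"
  by (rule exI) (rule lookup_Abs_poly_mapping)

text \<open>The new index branches off from its closest relative \<open>x0'\<close> at level \<open>k\<close>, in the cut prescribed
  by the indices that share the first \<open>k\<close> coordinates.\<close>

lemma good_extension:
  assumes F: "good F" "F \<noteq> {}" and z: "z \<in> Idx"
  obtains z' where "good (insert (z, z') F)" "(z, z') \<in> F \<or> z' \<noteq> 0"
proof (cases "z \<in> fst ` F")
  case True
  then obtain z' where "(z, z') \<in> F" by auto
  then show thesis using F(1) that[of z'] by (simp add: insert_absorb)
next
  case new: False
  have fin: "finite F" using F(1) by (simp add: good_def)
  have "\<exists>k. agr x z k \<and> \<not> agr x z (Suc k)" if "x \<in> fst ` F" for x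
    using first_difference[of x z] new that agr_Suc by metis
  then obtain d where d: "\<And>x. x \<in> fst ` F \<Longrightarrow> agr x z (d x) \<and> \<not> agr x z (Suc (d x))" by metis
  \<comment> \<open>\<open>k\<close> is the longest agreement of \<open>z\<close> with an old index
    and is attained at \<open>x0\<close>. All old indices in the ball of \<open>x0\<close> then
    differ from \<open>z\<close> at coordinate k.\<close>
  define k where "k = Max (d ` fst ` F)"
  have dk: "d x \<le> k" if "x \<in> fst ` F" for x using fin that by (simp add: k_def)
  have "k \<in> d ` fst ` F" using fin F(2) by (auto simp: k_def intro!: Max_in)
  then obtain x0 x0' where x0: "(x0, x0') \<in> F" "d x0 = k" by auto
  have ax0: "agr x0 z k" using d x0 by force
  have nz: "\<not> agr x z (Suc k)" if "(x, x') \<in> F" for x x'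
    using d[of x] dk[of x] agr_mono[of x z "Suc k" "Suc (d x)"] that by force
  have neq: "Poly_Mapping.lookup x k \<noteq> Poly_Mapping.lookup z k" if "(x, x') \<in> F" "agr x x0 k" for x x'
    using nz[OF that(1)] agr_trans[OF that(2) ax0] by (simp add: agr_Suc)
  define L where "L = (\<lambda>(x, x'). Poly_Mapping.lookup x' k) ` {(x, x') \<in> F. agr x x0 k \<and> x < z}"
  define U where "U = (\<lambda>(x, x'). Poly_Mapping.lookup x' k) ` {(x, x') \<in> F. agr x x0 k \<and> z < x}"
  have "l < u" if lu: "l \<in> L" "u \<in> U" for l u
  proof -
    obtain x x' y y' where xy: "(x, x') \<in> F" "(y, y') \<in> F" "agr x x0 k" "agr y x0 k" "x < z" "z < y"
      "l = Poly_Mapping.lookup x' k" "u = Poly_Mapping.lookup y' k"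
      using lu by (auto simp: L_def U_def)
    have az: "agr x z k" "agr z y k" "agr x y k"
      using agr_trans[OF xy(3) ax0] agr_sym[OF agr_trans[OF xy(4) ax0]] agr_trans[OF xy(3) agr_sym[OF xy(4)]]
      by blast+
    have "Poly_Mapping.lookup x k < Poly_Mapping.lookup z k"
      using idx_less_at[OF az(1) neq[OF xy(1,3)]] xy by simp
    also have "\<dots> < Poly_Mapping.lookup y k"
      using idx_less_at[OF az(2) neq[OF xy(2,4), symmetric]] xy by simp
    finally have "\<not> agr x y (Suc k)" by (auto simp: agr_Suc)
    moreover have "x < y" using xy(5,6) by (rule less_trans)
    ultimately have *: "\<not> agr x' y' (Suc k)" "agr x' y' k" "x' < y'"
      using goodD(5,6)[OF F(1) xy(1,2)] az(3) by blast+
    then have "Poly_Mapping.lookup x' k \<noteq> Poly_Mapping.lookup y' k" by (simp add: agr_Suc)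
    from idx_less_at[OF *(2) this] show ?thesis using *(3) xy by simp
  qed
  moreover have "finite L" "finite U" using fin by (auto simp: L_def U_def intro!: finite_subset[OF _ fin])
  ultimately obtain q where q: "\<And>l. l \<in> L \<Longrightarrow> l < q" "\<And>u. u \<in> U \<Longrightarrow> q < u"
      "node q \<longleftrightarrow> node (Poly_Mapping.lookup z k)"
    using dense_cut by metis
  obtain s where s: "\<not> node s" using dense_sep[of 0 1] by auto
  then have s0: "s \<noteq> 0" using node_0 by auto
  \<comment> \<open>A non-dyadic coordinate below k would make \<open>x0'\<close>, hence
    \<open>x0\<close>, a separator of that level. As \<open>z\<close> shares these coordinates with
    \<open>x0\<close>, it would be the same separator, although \<open>z\<close> is new.\<close>
  have node_x0': "node (Poly_Mapping.lookup x0' i)" if "i < k" for i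
  proof (rule ccontr)
    assume nn: "\<not> node (Poly_Mapping.lookup x0' i)"
    then have "\<not> leaf x0'" by (auto simp: leaf_def)
    then obtain l where l: "sepx l x0'" using goodD(2)[OF F(1) x0(1)] by (auto simp: Idx_def)
    have "l = i" using l nn node_0 unfolding sepx_def by (metis linorder_neqE_nat)
    then have l0: "sepx i x0" using l goodD(4)[OF F(1) x0(1)] by simp
    then have "\<not> node (Poly_Mapping.lookup z i)" using ax0 that by (auto simp: sepx_def agr_def)
    then have "\<not> leaf z" by (auto simp: leaf_def)
    then obtain m where m: "sepx m z" using z by (auto simp: Idx_def)
    have "m = i" using m \<open>\<not> node (Poly_Mapping.lookup z i)\<close> node_0 unfolding sepx_def by (metis linorder_neqE_nat)
    have "x0 = z"
    proof (rule agr_all_eq)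
      fix j
      show "agr x0 z j" unfolding agr_def
      proof (intro allI impI)
        fix l
        show "Poly_Mapping.lookup x0 l = Poly_Mapping.lookup z l"
          using l0 m ax0 that unfolding \<open>m = i\<close> sepx_def agr_def by (cases "l \<le> i") auto
      qed
    qed
    then show False using new x0(1) by force
  qed
  have lab: "k \<le> l" if "sepx l z" for l
  proof (rule ccontr)
    assume "\<not> k \<le> l"
    then have lk: "l < k" by simp
    then have nn: "\<not> node (Poly_Mapping.lookup x0 l)" using that ax0 by (auto simp: sepx_def agr_def)
    then have "\<not> leaf x0" by (auto simp: leaf_def)
    then obtain m where m: "sepx m x0" using goodD(1)[OF F(1) x0(1)] by (auto simp: Idx_def)
    have "m = l" using m nn node_0 unfolding sepx_def by (metis linorder_neqE_nat)
    then have "sepx l x0'" using m goodD(4)[OF F(1) x0(1)] by simp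
    then show False using node_x0'[OF lk] by (simp add: sepx_def)
  qed
  \<comment> \<open>The coordinates after k. A leaf gets a 1 at \<open>Suc k\<close>, which keeps
    its image away from 0 even when all other coordinates vanish. A separator gets the non-dyadic
    \<open>s\<close> at its own level, unless that is k, where \<open>q\<close> stands.\<close>
  define t where "t i = (if leaf z then (if i = Suc k then 1 else 0)
    else if sepx i z then s else 0)" for i
  have "finite {i. t i \<noteq> 0}"
  proof (cases "leaf z")
    case True
    then show ?thesis by (auto simp: t_def intro: finite_subset[of _ "{Suc k}"])
  next
    case False
    then obtain l where "sepx l z" using z by (auto simp: Idx_def)
    then show ?thesis using sepx_unique False by (auto simp: t_def intro!: finite_subset[of _ "{l}"])
  qed
  then have "finite {i. (if i < k then Poly_Mapping.lookup x0' i else if i = k then q else t i) \<noteq> 0}"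
    by (rule finite_subset[rotated, OF finite_UnI[OF _ finite_lessThan[of "Suc k"]]]) auto
  from ex_idx[OF this] obtain z' where z': "Poly_Mapping.lookup z' =
      (\<lambda>i. if i < k then Poly_Mapping.lookup x0' i else if i = k then q else t i)" ..
  have kind: "leaf z' \<and> leaf z \<and> z' \<noteq> 0 \<or> (\<exists>l. sepx l z' \<and> sepx l z)"
  proof (cases "leaf z")
    case True
    then have "leaf z'" using node_x0' q(3) node_0 node_1 by (auto simp: leaf_def z' t_def)
    moreover have "z' \<noteq> 0"
    proof
      assume "z' = 0"
      then have "Poly_Mapping.lookup z' (Suc k) = 0" by simp
      then show False using True by (simp add: z' t_def)
    qed
    ultimately show ?thesis using True by simp
  next
    case False
    then obtain l where l: "sepx l z" using z by (auto simp: Idx_def)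
    have t: "t i = (if i = l then s else 0)" for i
      using False l sepx_unique by (auto simp: t_def)
    have "sepx l z'"
    proof (cases "l = k")
      case True
      then show ?thesis using l node_x0' q(3) by (auto simp: sepx_def z' t)
    next
      case False
      then have "k < l" using lab[OF l] by simp
      then show ?thesis using l node_x0' q(3) s node_0 by (auto simp: sepx_def z' t)
    qed
    then show ?thesis using l by blast
  qed
  have z'0: "z' \<noteq> 0" using kind leaf_0 leaf_not_sepx by blast
  have ax0': "agr x0' z' k" by (simp add: agr_def z')
  have zk: "Poly_Mapping.lookup z' k = q" by (simp add: z')
  have rel: "(x < z \<longleftrightarrow> x' < z') \<and> (z < x \<longleftrightarrow> z' < x') \<and> (\<forall>i. agr x z i \<longleftrightarrow> agr x' z' i)" if x: "(x, x') \<in> F" for x x'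
  proof (cases "agr x x0 k")
    case True
    have a: "agr x z k" using True ax0 by (rule agr_trans)
    have "agr x' x0' k" using True goodD(6)[OF F(1) x x0(1)] by blast
    then have a': "agr x' z' k" using ax0' by (rule agr_trans)
    note ne = neq[OF x True]
    have "x < z \<or> z < x" using a ne by (metis linorder_neqE)
    then have "Poly_Mapping.lookup x' k < q \<and> x < z \<or> q < Poly_Mapping.lookup x' k \<and> z < x"
      using q(1,2) x True by (force simp: L_def U_def)
    moreover from this have ne': "Poly_Mapping.lookup x' k \<noteq> Poly_Mapping.lookup z' k" by (auto simp: zk)
    ultimately show ?thesis
      using idx_less_at[OF a' ne'] idx_less_at[OF agr_sym[OF a'] ne'[symmetric]] agr_iff_le[OF a ne] agr_iff_le[OF a' ne']
      by (auto simp: zk)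
  next
    case False
    then have F': "\<not> agr x' x0' k" using goodD(6)[OF F(1) x x0(1)] by blast
    have n: "\<not> agr x0 x k" "\<not> agr x0' x' k" using False F' agr_sym by blast+
    have e: "agr y w i \<longleftrightarrow> agr y v i" if "agr v w k" "\<not> agr y v k" for y v w i
    proof (cases "i \<le> k")
      case True
      then have "agr v w i" using that(1) agr_mono by blast
      then show ?thesis by (simp add: agr_def)
    next
      case False
      then have "\<not> agr y v i" using that(2) agr_mono[of y v i k] by auto
      moreover have "\<not> agr y w i"
        using that agr_mono[of y w i k] agr_trans[OF _ agr_sym[OF that(1)], of y] False by auto
      ultimately show ?thesis by simp
    qed
    note e = e[OF ax0 False] e[OF ax0' F']
    show ?thesis
      using less_via_agr[OF ax0 n(1)] less_via_agr[OF ax0' n(2)] e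
        goodD(5,6)[OF F(1) x x0(1)] goodD(5)[OF F(1) x0(1) x] by simp
  qed
  have z'I: "z' \<in> Idx" using kind by (auto simp: Idx_def)
  have lz: "(leaf z \<longleftrightarrow> leaf z') \<and> (\<forall>k. sepx k z \<longleftrightarrow> sepx k z')"
    using kind leaf_not_sepx sepx_unique by blast
  have "good (insert (z, z') F)"
  proof (rule goodI)
    show "finite (insert (z, z') F)" using fin by simp
    show "x \<in> Idx \<and> x' \<in> Idx \<and> (leaf x \<longleftrightarrow> leaf x') \<and> (\<forall>k. sepx k x \<longleftrightarrow> sepx k x')"
      if "(x, x') \<in> insert (z, z') F" for x x'
    proof (cases "(x, x') \<in> F")
      case True
      then show ?thesis using goodD(1-4)[OF F(1) True] by simp
    next
      case False
      then show ?thesis using that z z'I lz by simp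
    qed
    show "(x < y \<longleftrightarrow> x' < y') \<and> (\<forall>i. agr x y i \<longleftrightarrow> agr x' y' i)"
      if xy: "(x, x') \<in> insert (z, z') F" "(y, y') \<in> insert (z, z') F" for x x' y y'
    proof (cases "(x, x') \<in> F")
      case x: True
      show ?thesis
      proof (cases "(y, y') \<in> F")
        case True
        then show ?thesis using goodD(5,6)[OF F(1) x True] by simp
      next
        case False
        then show ?thesis using xy(2) rel[OF x] by simp
      qed
    next
      case x: False
      then have x: "x = z" "x' = z'" using xy(1) by auto
      show ?thesis
      proof (cases "(y, y') \<in> F")
        case True
        then have "\<forall>i. agr y z i \<longleftrightarrow> agr y' z' i" using rel by blast
        then have "agr z y i \<longleftrightarrow> agr z' y' i" for i
          using agr_sym[of z y i] agr_sym[of y z i] agr_sym[of z' y' i] agr_sym[of y' z' i] by blast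
        then show ?thesis using rel[OF True] x by simp
      next
        case False
        then show ?thesis using xy(2) x by simp
      qed
    qed
  qed
  then show thesis using z'0 that by blast
qed

section \<open>The linear order\<close>

lemma countable_poly_mapping:
  fixes K :: "'a set"
  assumes "countable K"
  shows "countable {p :: 'a \<Rightarrow>\<^sub>0 'b :: {countable, zero}. Poly_Mapping.keys p \<subseteq> K}"
proof -
  define G where "G p = (\<lambda>k. (k, Poly_Mapping.lookup p k)) ` Poly_Mapping.keys p" for p :: "'a \<Rightarrow>\<^sub>0 'b"
  have "inj G"
  proof (rule injI)
    fix p q assume pq: "G p = G q"
    have keys: "Poly_Mapping.keys r = fst ` G r" for r by (force simp: G_def)
    show "p = q"
    proof (rule poly_mapping_eqI)
      fix k
      show "Poly_Mapping.lookup p k = Poly_Mapping.lookup q k"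
      proof (cases "k \<in> Poly_Mapping.keys p")
        case True
        then have "(k, Poly_Mapping.lookup p k) \<in> G q" unfolding pq[symmetric] by (simp add: G_def)
        then show ?thesis by (auto simp: G_def)
      next
        case False
        moreover have "k \<notin> Poly_Mapping.keys q" using False keys pq by metis
        ultimately show ?thesis by (simp add: in_keys_iff)
      qed
    qed
  qed
  then have "inj_on G {p. Poly_Mapping.keys p \<subseteq> K}" by (rule inj_on_subset) simp
  moreover have "countable (G ` {p. Poly_Mapping.keys p \<subseteq> K})"
  proof (rule countable_subset)
    show "G ` {p. Poly_Mapping.keys p \<subseteq> K} \<subseteq> {A. finite A \<and> A \<subseteq> K \<times> UNIV}"
      by (auto simp: G_def)
    show "countable {A. finite A \<and> A \<subseteq> K \<times> (UNIV :: 'b set)}"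
      by (rule countable_Collect_finite_subset) (use assms in simp)
  qed
  ultimately show ?thesis by (rule countable_image_inj_on[rotated])
qed

type_synonym point = "idx \<times> nat \<times> zpow"

text \<open>A node of level \<open>k\<close> carries, between its children, copies of a block of \<open>k + 2\<close> points followed by a
  gadget \<open>\<int>\<close>-power. The exponent marks whether the node lies on the path of the leaf \<open>0\<close>; the two
  exponents at level \<open>k\<close> are indistinguishable below \<open>b k\<close>.\<close>

locale tower =
  fixes \<mu> :: cord and b :: "nat \<Rightarrow> cord"
  assumes limit: "limit_cord \<mu>" and b_less: "b k < \<mu>" and b_pos: "\<exists>\<gamma>. \<gamma> < b k"
    and b_cofinal: "\<beta> < \<mu> \<Longrightarrow> \<exists>K. \<forall>k\<ge>K. \<beta> \<le> b k"
begin

definition e :: "nat \<Rightarrow> idx \<Rightarrow> cord" where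
  "e k x = (if agr x 0 k then b k else cord_succ (b k))"

lemma e_ge: "b k \<le> e k x"
  by (simp add: e_def less_imp_le[OF less_cord_succ])

text \<open>The components are index, position and gadget element, ordered lexicographically. At a
  separator of level k the positions below \<open>k + 2\<close> form the finite block, and position
  \<open>k + 2\<close> is the gadget behind it.\<close>

definition Pts :: "idx set \<Rightarrow> point set" where
  "Pts X = {(x, j, f). x \<in> X \<and> (leaf x \<and> j = 0 \<and> f = 0 \<or>
    (\<exists>k. sepx k x \<and> (j < k + 2 \<and> f = 0 \<or> j = k + 2 \<and> supp_below (e k x) f)))}"

definition M :: "idx set \<Rightarrow> point set \<times> point rel" where
  "M X = (Pts X, {(p, q). p \<in> Pts X \<and> q \<in> Pts X \<and> p \<le> q})"

lemma M_simps [simp]: "fst (M X) = Pts X" "(p, q) \<in> snd (M X) \<longleftrightarrow> p \<in> Pts X \<and> q \<in> Pts X \<and> p \<le> q"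
  by (auto simp: M_def)

lemma Pts_iff: "(x, j, f) \<in> Pts X \<longleftrightarrow> x \<in> X \<and> (leaf x \<and> j = 0 \<and> f = 0 \<or>
    (\<exists>k. sepx k x \<and> (j < k + 2 \<and> f = 0 \<or> j = k + 2 \<and> supp_below (e k x) f)))"
  by (simp add: Pts_def)

text \<open>Exponents may change only where both are at least \<beta>, which is invisible up to
  level \<beta>.\<close>

definition iso_idx :: "cord \<Rightarrow> idx set \<Rightarrow> idx set \<Rightarrow> (idx \<Rightarrow> idx) \<Rightarrow> bool" where
  "iso_idx \<beta> X Y g \<longleftrightarrow> bij_betw g X Y \<and> (\<forall>x\<in>X. \<forall>y\<in>X. x < y \<longleftrightarrow> g x < g y) \<and>
    (\<forall>x\<in>X. (leaf x \<longleftrightarrow> leaf (g x)) \<and> (\<forall>k. (sepx k x \<longleftrightarrow> sepx k (g x)) \<and>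
      (sepx k x \<longrightarrow> e k x = e k (g x) \<or> \<beta> \<le> e k x \<and> \<beta> \<le> e k (g x))))"

lemma iso_idx_inv:
  assumes "iso_idx \<beta> X Y g"
  shows "iso_idx \<beta> Y X (inv_into X g)"
proof -
  have g: "bij_betw g X Y" using assms by (simp add: iso_idx_def)
  have i: "inv_into X g y \<in> X" "g (inv_into X g y) = y" if "y \<in> Y" for y
    using g that by (auto simp: bij_betw_def inv_into_into f_inv_into_f)
  show ?thesis
    unfolding iso_idx_def
  proof (intro conjI ballI allI)
    show "bij_betw (inv_into X g) Y X" using g by (rule bij_betw_inv_into)
    show "(x < y) = (inv_into X g x < inv_into X g y)" if "x \<in> Y" "y \<in> Y" for x y
      using assms i[OF that(1)] i[OF that(2)] by (simp add: iso_idx_def)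
    fix y k assume "y \<in> Y"
    then show "leaf y = leaf (inv_into X g y)" "sepx k y = sepx k (inv_into X g y)"
      "sepx k y \<longrightarrow> e k y = e k (inv_into X g y) \<or> \<beta> \<le> e k y \<and> \<beta> \<le> e k (inv_into X g y)"
      using assms i[of y] unfolding iso_idx_def by metis+
  qed
qed

text \<open>A quadruple \<open>(x, j, f, f')\<close> records a matched pair:
  \<open>(x, j, f)\<close> on the left and, over an index map \<open>g\<close>, the point
  \<open>(g x, j, f')\<close> on the right.\<close>

definition lft :: "idx \<times> nat \<times> zpow \<times> zpow \<Rightarrow> point" where
  "lft = (\<lambda>(x, j, f, f'). (x, j, f))"

definition rgt :: "(idx \<Rightarrow> idx) \<Rightarrow> idx \<times> nat \<times> zpow \<times> zpow \<Rightarrow> point" where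
  "rgt g = (\<lambda>(x, j, f, f'). (g x, j, f'))"

definition swp :: "(idx \<Rightarrow> idx) \<Rightarrow> idx \<times> nat \<times> zpow \<times> zpow \<Rightarrow> idx \<times> nat \<times> zpow \<times> zpow" where
  "swp g = (\<lambda>(x, j, f, f'). (g x, j, f', f))"

lemma lft_rgt_swp [simp]: "lft (x, j, f, f') = (x, j, f)" "rgt g (x, j, f, f') = (g x, j, f')"
  "swp g (x, j, f, f') = (g x, j, f', f)"
  by (simp_all add: lft_def rgt_def swp_def)

text \<open>Index and position of the partner are prescribed by \<open>g\<close>, so apart from
  membership the only condition concerns third components over the same index and position.\<close>

definition matched :: "idx set \<Rightarrow> idx set \<Rightarrow> (idx \<Rightarrow> idx) \<Rightarrow> cord \<Rightarrow> int \<Rightarrow> (idx \<times> nat \<times> zpow \<times> zpow) list \<Rightarrow> bool" where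
  "matched X Y g \<gamma> N ss \<longleftrightarrow>
    (\<forall>x j f f'. (x, j, f, f') \<in> set ss \<longrightarrow> (x, j, f) \<in> Pts X \<and> (g x, j, f') \<in> Pts Y) \<and>
    (\<forall>x j f f' h h'. (x, j, f, f') \<in> set ss \<longrightarrow> (x, j, h, h') \<in> set ss \<longrightarrow> eqv \<gamma> N (f - h) (f' - h'))"

lemma matchedD:
  assumes "matched X Y g \<gamma> N ss" "(x, j, f, f') \<in> set ss"
  shows "(x, j, f) \<in> Pts X" "(g x, j, f') \<in> Pts Y" "(x, j, h, h') \<in> set ss \<Longrightarrow> eqv \<gamma> N (f - h) (f' - h')"
  using assms(1)[unfolded matched_def, THEN conjunct1, rule_format, OF assms(2)]
    assms(1)[unfolded matched_def, THEN conjunct2, rule_format, OF assms(2)] by simp_all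

lemma matchedI:
  assumes "\<And>x j f f'. (x, j, f, f') \<in> set ss \<Longrightarrow> (x, j, f) \<in> Pts X \<and> (g x, j, f') \<in> Pts Y"
    "\<And>x j f f' h h'. (x, j, f, f') \<in> set ss \<Longrightarrow> (x, j, h, h') \<in> set ss \<Longrightarrow> eqv \<gamma> N (f - h) (f' - h')"
  shows "matched X Y g \<gamma> N ss"
  unfolding matched_def by (rule conjI; intro allI impI) (erule assms(1), erule (1) assms(2))

section \<open>Moves in the game over a fixed index map\<close>

lemma matched_weaken:
  assumes "matched X Y g \<gamma> N ss" "\<gamma>' < \<gamma> \<or> \<gamma>' = \<gamma> \<and> N' \<le> N"
  shows "matched X Y g \<gamma>' N' ss"
  by (rule matchedI) (use matchedD[OF assms(1)] eqv_weaken[OF _ assms(2)] in simp_all)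

lemma matched_snoc:
  assumes old: "matched X Y g \<gamma> N ss" and new: "(x, j, f) \<in> Pts X" "(g x, j, f') \<in> Pts Y"
    and eqv: "\<And>h h'. (x, j, h, h') \<in> set ss \<Longrightarrow> eqv \<gamma> N (f - h) (f' - h')"
  shows "matched X Y g \<gamma> N (ss @ [(x, j, f, f')])"
proof (rule matchedI)
  show "(y, i, h) \<in> Pts X \<and> (g y, i, h') \<in> Pts Y" if "(y, i, h, h') \<in> set (ss @ [(x, j, f, f')])" for y i h h'
    using that new matchedD[OF old] by auto
  show "eqv \<gamma> N (h - k) (h' - k')"
    if "(y, i, h, h') \<in> set (ss @ [(x, j, f, f')])" "(y, i, k, k') \<in> set (ss @ [(x, j, f, f')])" for y i h h' k k'
  proof (cases "(y, i, h, h') \<in> set ss")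
    case h: True
    show ?thesis
    proof (cases "(y, i, k, k') \<in> set ss")
      case True
      then show ?thesis using matchedD(3)[OF old h] by blast
    next
      case False
      then have "y = x" "i = j" "k = f" "k' = f'" using that(2) by auto
      then have "eqv \<gamma> N (- (h - k)) (- (h' - k'))" using eqv h by simp
      then show ?thesis by (simp only: eqv_minus)
    qed
  next
    case False
    then have h: "y = x" "i = j" "h = f" "h' = f'" using that(1) by auto
    show ?thesis
    proof (cases "(y, i, k, k') \<in> set ss")
      case True
      then show ?thesis using eqv h by simp
    next
      case False
      then show ?thesis using that(2) h eqv_refl by simp
    qed
  qed
qed

text \<open>Outside the gadgets the reply is forced by \<open>g\<close>. Inside,
  \<open>iso_idx\<close> and \<gamma> < \<beta> supply what \<open>gadget_extension\<close> asks of
  the two exponents.\<close>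

lemma matched_forth:
  assumes iso: "iso_idx \<beta> X Y g" and \<gamma>: "\<gamma> < \<beta>" and m: "matched X Y g \<gamma> (2 * N) ss" and N: "0 < N"
    and p: "p \<in> Pts X"
  shows "\<exists>s. lft s = p \<and> matched X Y g \<gamma> N (ss @ [s])"
proof -
  obtain x j f where pe: "p = (x, j, f)" by (cases p)
  have x: "x \<in> X" using p by (simp add: pe Pts_iff)
  have gx: "g x \<in> Y" using iso x by (auto simp: iso_idx_def bij_betw_def)
  have kind: "leaf x \<longleftrightarrow> leaf (g x)" "sepx k x \<longleftrightarrow> sepx k (g x)"
    "sepx k x \<Longrightarrow> e k x = e k (g x) \<or> \<beta> \<le> e k x \<and> \<beta> \<le> e k (g x)" for k
    using iso x unfolding iso_idx_def by blast+
  have m': "matched X Y g \<gamma> N ss" using matched_weaken[OF m] N by simp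
  show ?thesis
  proof (cases "\<exists>k. sepx k x \<and> j = k + 2")
    case False
    then have f: "f = 0" and "leaf x \<and> j = 0 \<or> (\<exists>k. sepx k x \<and> j < k + 2)"
      using p by (auto simp: pe Pts_iff)
    then have gp: "(g x, j, 0) \<in> Pts Y" using gx kind by (auto simp: Pts_iff)
    have zero: "h = 0" "h' = 0" if "(x, j, h, h') \<in> set ss" for h h'
      using matchedD(1,2)[OF m that] False kind by (auto simp: Pts_iff)
    have "eqv \<gamma> N (f - h) (0 - h')" if "(x, j, h, h') \<in> set ss" for h h'
      using zero[OF that] f eqv_refl by simp
    then have "matched X Y g \<gamma> N (ss @ [(x, j, f, 0)])"
      using p gp by (intro matched_snoc[OF m']) (auto simp: pe)
    then show ?thesis by (intro exI[of _ "(x, j, f, 0)"]) (simp add: pe)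
  next
    case True
    then obtain k where k: "sepx k x" "j = k + 2" by blast
    then have gk: "sepx k (g x)" using kind by simp
    have mem: "(y, k + 2, h) \<in> Pts Z \<longleftrightarrow> y \<in> Z \<and> supp_below (e k y) h" if "sepx k y" for y h Z
      using that sepx_unique leaf_not_sepx by (auto simp: Pts_iff)
    define F where "F = {(h, h'). (x, j, h, h') \<in> set ss}"
    have "F \<subseteq> (\<lambda>(x, j, h, h'). (h, h')) ` set ss" by (force simp: F_def)
    then have fin: "finite F" by (rule finite_subset) simp
    have s: "supp_below (e k x) f" using p mem[OF k(1)] by (simp add: pe k)
    have ee: "e k x = e k (g x) \<or> \<gamma> < e k (g x)" using kind(3)[OF k(1)] \<gamma> by auto
    obtain f' where f': "supp_below (e k (g x)) f'" "\<And>h h'. (h, h') \<in> F \<Longrightarrow> eqv \<gamma> N (f - h) (f' - h')"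
    proof (rule gadget_extension[OF fin N _ _ s ee])
      show "eqv \<gamma> (2 * N) (h - l) (h' - l')" if "(h, h') \<in> F" "(l, l') \<in> F" for h h' l l'
        using that matchedD(3)[OF m] by (simp add: F_def)
      show "supp_below (e k x) h \<and> supp_below (e k (g x)) h'" if "(h, h') \<in> F" for h h'
      proof -
        have h: "(x, k + 2, h, h') \<in> set ss" using that by (simp add: F_def k(2))
        show ?thesis using matchedD(1,2)[OF m h] unfolding mem[OF k(1)] mem[OF gk] by blast
      qed
      fix x' assume "supp_below (e k (g x)) x'" "\<And>h h'. (h, h') \<in> F \<Longrightarrow> eqv \<gamma> N (f - h) (x' - h')"
      then show thesis by (rule that)
    qed
    have "matched X Y g \<gamma> N (ss @ [(x, j, f, f')])"
    proof (rule matched_snoc[OF m'])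
      show "(x, j, f) \<in> Pts X" using p by (simp add: pe)
      show "(g x, j, f') \<in> Pts Y" using f'(1) gx unfolding k(2) mem[OF gk] by simp
      show "eqv \<gamma> N (f - h) (f' - h')" if "(x, j, h, h') \<in> set ss" for h h'
        using f'(2) that by (simp add: F_def)
    qed
    then show ?thesis by (intro exI[of _ "(x, j, f, f')"]) (simp add: pe)
  qed
qed

lemma matched_swp:
  assumes iso: "iso_idx \<beta> X Y g" and m: "matched X Y g \<gamma> N ss"
  shows "matched Y X (inv_into X g) \<gamma> N (map (swp g) ss)"
proof -
  have inj: "inj_on g X" using iso by (simp add: iso_idx_def bij_betw_def)
  have el: "\<exists>x. x \<in> X \<and> y = g x \<and> (x, j, f', f) \<in> set ss" if yy: "(y, j, f, f') \<in> set (map (swp g) ss)" for y j f f'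
  proof -
    obtain s where s: "s \<in> set ss" "swp g s = (y, j, f, f')" using yy by auto
    obtain x i h h' where "s = (x, i, h, h')" by (cases s)
    then show ?thesis using s matchedD(1)[OF m, of x i h h'] by (auto simp: Pts_iff)
  qed
  show ?thesis
  proof (rule matchedI)
    show "(y, j, f) \<in> Pts Y \<and> (inv_into X g y, j, f') \<in> Pts X" if "(y, j, f, f') \<in> set (map (swp g) ss)" for y j f f'
      using el[OF that] matchedD(1,2)[OF m] inj by auto
    show "eqv \<gamma> N (f - h) (f' - h')"
      if y: "(y, j, f, f') \<in> set (map (swp g) ss)" "(y, j, h, h') \<in> set (map (swp g) ss)" for y j f f' h h'
    proof -
      obtain x x' where "x \<in> X" "y = g x" "(x, j, f', f) \<in> set ss" "x' \<in> X" "y = g x'" "(x', j, h', h) \<in> set ss"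
        using el[OF y(1)] el[OF y(2)] by blast
      moreover from this have "x = x'" using inj by (auto simp: inj_on_def)
      ultimately show ?thesis using matchedD(3)[OF m] eqv_sym by blast
    qed
  qed
qed

lemma matched_back:
  assumes iso: "iso_idx \<beta> X Y g" and \<gamma>: "\<gamma> < \<beta>" and m: "matched X Y g \<gamma> (2 * N) ss" and N: "0 < N"
    and p: "p \<in> Pts Y"
  shows "\<exists>s. rgt g s = p \<and> matched X Y g \<gamma> N (ss @ [s])"
proof -
  let ?i = "inv_into X g"
  have iso': "iso_idx \<beta> Y X ?i" by (rule iso_idx_inv[OF iso])
  obtain s where s: "lft s = p" "matched Y X ?i \<gamma> N (map (swp g) ss @ [s])"
    using matched_forth[OF iso' \<gamma> matched_swp[OF iso m] N p] by blast
  obtain y j f f' where se: "s = (y, j, f, f')" by (cases s)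
  have g: "bij_betw g X Y" using iso by (simp add: iso_idx_def)
  have "(y, j, f) \<in> Pts Y" using s(1) p by (simp add: se)
  then have y: "y \<in> Y" by (simp add: Pts_iff)
  have gi: "g (?i y) = y" using g y by (simp add: bij_betw_def f_inv_into_f)
  have "matched X Y g \<gamma> N (ss @ [(?i y, j, f', f)])"
  proof (rule matched_snoc)
    show "matched X Y g \<gamma> N ss" using matched_weaken[OF m] N by simp
    have "(y, j, f, f') \<in> set (map (swp g) ss @ [s])" by (simp add: se)
    note D = matchedD[OF s(2) this]
    show "(?i y, j, f') \<in> Pts X" "(g (?i y), j, f) \<in> Pts Y" using D(1,2) gi by simp_all
    show "eqv \<gamma> N (f' - h) (f - h')" if "(?i y, j, h, h') \<in> set ss" for h h'
    proof -
      have "swp g (?i y, j, h, h') \<in> swp g ` set ss" using that by (rule imageI)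
      then have "(y, j, h', h) \<in> set (map (swp g) ss @ [s])" using gi by simp
      then show ?thesis using D(3) eqv_sym by blast
    qed
  qed
  moreover have "rgt g (?i y, j, f', f) = p" using s(1) gi by (simp add: se)
  ultimately show ?thesis by blast
qed

text \<open>Each point of the tuple halves the budget, so the budget starts at
  \<open>2 ^ length ps * N\<close>.\<close>

lemma matched_forth_list:
  assumes iso: "iso_idx \<beta> X Y g" and \<gamma>: "\<gamma> < \<beta>" and N: "0 < N"
  shows "matched X Y g \<gamma> (2 ^ length ps * N) ss \<Longrightarrow> set ps \<subseteq> Pts X \<Longrightarrow>
    \<exists>ts. map lft ts = ps \<and> matched X Y g \<gamma> N (ss @ ts)"
proof (induction ps arbitrary: ss)
  case (Cons p ps)
  have "matched X Y g \<gamma> (2 * (2 ^ length ps * N)) ss" using Cons.prems(1) by (simp add: mult.assoc)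
  then obtain s where s: "lft s = p" "matched X Y g \<gamma> (2 ^ length ps * N) (ss @ [s])"
    using matched_forth[OF iso \<gamma>, of "2 ^ length ps * N" ss p] N Cons.prems(2) by auto
  obtain ts where "map lft ts = ps" "matched X Y g \<gamma> N ((ss @ [s]) @ ts)"
    using Cons.IH[OF s(2)] Cons.prems(2) by auto
  then show ?case using s(1) by (intro exI[of _ "s # ts"]) simp
qed simp

lemma matched_back_list:
  assumes iso: "iso_idx \<beta> X Y g" and \<gamma>: "\<gamma> < \<beta>" and N: "0 < N"
  shows "matched X Y g \<gamma> (2 ^ length ps * N) ss \<Longrightarrow> set ps \<subseteq> Pts Y \<Longrightarrow>
    \<exists>ts. map (rgt g) ts = ps \<and> matched X Y g \<gamma> N (ss @ ts)"
proof (induction ps arbitrary: ss)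
  case (Cons p ps)
  have "matched X Y g \<gamma> (2 * (2 ^ length ps * N)) ss" using Cons.prems(1) by (simp add: mult.assoc)
  then obtain s where s: "rgt g s = p" "matched X Y g \<gamma> (2 ^ length ps * N) (ss @ [s])"
    using matched_back[OF iso \<gamma>, of "2 ^ length ps * N" ss p] N Cons.prems(2) by auto
  obtain ts where "map (rgt g) ts = ps" "matched X Y g \<gamma> N ((ss @ [s]) @ ts)"
    using Cons.IH[OF s(2)] Cons.prems(2) by auto
  then show ?case using s(1) by (intro exI[of _ "s # ts"]) simp
qed simp

lemma matched_order:
  assumes iso: "iso_idx \<beta> X Y g" and m: "matched X Y g \<gamma> 1 ss" and st: "s \<in> set ss" "t \<in> set ss"
  shows "lft s = lft t \<longleftrightarrow> rgt g s = rgt g t" "lft s \<le> lft t \<longleftrightarrow> rgt g s \<le> rgt g t"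
proof -
  obtain x j f f' y i h h' where e: "s = (x, j, f, f')" "t = (y, i, h, h')" by (cases s; cases t)
  have X: "x \<in> X" "y \<in> X" using matchedD(1)[OF m] st by (auto simp: e Pts_iff)
  then have o: "x < y \<longleftrightarrow> g x < g y" "x = y \<longleftrightarrow> g x = g y"
    using iso by (auto simp: iso_idx_def bij_betw_def inj_on_def)
  have E: "eqv \<gamma> 1 (h - f) (h' - f')" if "x = y" "j = i"
    using matchedD(3)[OF m, of y i h h' f f'] st that by (simp add: e)
  have f: "f = h \<longleftrightarrow> f' = h'" "f \<le> h \<longleftrightarrow> f' \<le> h'" if "x = y" "j = i"
    using eqv_sign(1,3)[OF E[OF that]] by auto
  show "lft s = lft t \<longleftrightarrow> rgt g s = rgt g t" using o f by (auto simp: e)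
  have "(p, q, r) \<le> (p', q', r') \<longleftrightarrow> p < p' \<or> p = p' \<and> (q < q' \<or> q = q' \<and> r \<le> r')"
    for p p' :: idx and q q' :: nat and r r' :: zpow
    by (auto simp: le_less)
  then show "lft s \<le> lft t \<longleftrightarrow> rgt g s \<le> rgt g t" using o f by (auto simp: e)
qed

lemma matched_bf:
  assumes iso: "iso_idx \<beta>0 X Y g"
  shows "\<beta> \<le> \<beta>0 \<Longrightarrow> matched X Y g \<beta> 1 ss \<Longrightarrow> bf (M X) (M Y) \<beta> (map lft ss) (map (rgt g) ss)"
proof (induction \<beta> arbitrary: ss rule: less_induct)
  case (less \<beta>)
  have mem: "lft s \<in> Pts X" "rgt g s \<in> Pts Y" if "s \<in> set ss" for s
  proof -
    obtain x j f f' where s: "s = (x, j, f, f')" by (cases s)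
    show "lft s \<in> Pts X" "rgt g s \<in> Pts Y"
      using matchedD(1,2)[OF less.prems(2) that[unfolded s]] by (simp_all add: s)
  qed
  \<comment> \<open>Falling to a smaller level makes every budget available, which pays for a move
    of any length. Hence budget 1 is enough as the invariant.\<close>
  have low: "matched X Y g \<gamma> N ss" if "\<gamma> < \<beta>" for \<gamma> N
    using matched_weaken[OF less.prems(2)] that by simp
  show ?case
  proof (rule bfI)
    show "atomic_eq (M X) (M Y) (map lft ss) (map (rgt g) ss)"
      unfolding atomic_eq_def
    proof (intro conjI allI impI)
      fix i j assume "i < length (map lft ss)" "j < length (map lft ss)"
      then have ij: "i < length ss" "j < length ss" "ss ! i \<in> set ss" "ss ! j \<in> set ss" by auto
      note o = matched_order[OF iso less.prems(2) ij(3,4)]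
      show "(map lft ss ! i = map lft ss ! j) = (map (rgt g) ss ! i = map (rgt g) ss ! j)"
        using o(1) ij(1,2) by simp
      show "((map lft ss ! i, map lft ss ! j) \<in> snd (M X)) = ((map (rgt g) ss ! i, map (rgt g) ss ! j) \<in> snd (M Y))"
        using o(2) mem ij by simp
    qed simp
  next
    fix \<gamma> cs assume \<gamma>: "\<gamma> < \<beta>" and cs: "set cs \<subseteq> fst (M X)"
    have \<gamma>0: "\<gamma> < \<beta>0" using \<gamma> less.prems(1) by simp
    obtain ts where ts: "map lft ts = cs" "matched X Y g \<gamma> 1 (ss @ ts)"
      using matched_forth_list[OF iso \<gamma>0 _ low[OF \<gamma>], of 1 cs] cs by auto
    have "bf (M X) (M Y) \<gamma> (map lft (ss @ ts)) (map (rgt g) (ss @ ts))"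
      using less.IH[OF \<gamma> _ ts(2)] \<gamma>0 by simp
    moreover have "set (map (rgt g) ts) \<subseteq> Pts Y"
      using matchedD(2)[OF ts(2)] by (force simp: rgt_def)
    ultimately show "\<exists>ds. length ds = length cs \<and> set ds \<subseteq> fst (M Y) \<and>
        bf (M X) (M Y) \<gamma> (map lft ss @ cs) (map (rgt g) ss @ ds)"
      using ts(1) by (intro exI[of _ "map (rgt g) ts"]) auto
  next
    fix \<gamma> ds assume \<gamma>: "\<gamma> < \<beta>" and ds: "set ds \<subseteq> fst (M Y)"
    have \<gamma>0: "\<gamma> < \<beta>0" using \<gamma> less.prems(1) by simp
    obtain ts where ts: "map (rgt g) ts = ds" "matched X Y g \<gamma> 1 (ss @ ts)"
      using matched_back_list[OF iso \<gamma>0 _ low[OF \<gamma>], of 1 ds] ds by auto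
    have "bf (M X) (M Y) \<gamma> (map lft (ss @ ts)) (map (rgt g) (ss @ ts))"
      using less.IH[OF \<gamma> _ ts(2)] \<gamma>0 by simp
    moreover have "set (map lft ts) \<subseteq> Pts X"
      using matchedD(1)[OF ts(2)] by (force simp: lft_def)
    ultimately show "\<exists>cs. length cs = length ds \<and> set cs \<subseteq> fst (M X) \<and>
        bf (M X) (M Y) \<gamma> (map lft ss @ cs) (map (rgt g) ss @ ds)"
      using ts(1) by (intro exI[of _ "map lft ts"]) auto
  qed
qed

section \<open>Countability, and index maps that fix or delete the leaf 0\<close>

lemma countable_Idx: "countable (X :: idx set)"
proof -
  have "countable {p :: idx. Poly_Mapping.keys p \<subseteq> UNIV}" by (rule countable_poly_mapping) simp
  then show ?thesis by (rule countable_subset[rotated]) simp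
qed

lemma e_less: "e k x < \<mu>"
  by (simp add: e_def b_less limit_cord_succ[OF limit b_less])

text \<open>\<open>zpow\<close> is uncountable, as \<open>cord\<close> is, but the exponents
  occurring in points lie below \<mu>.\<close>

lemma countable_Pts: "countable (Pts X)"
proof -
  let ?Z = "{f :: zpow. Poly_Mapping.keys f \<subseteq> dual ` {..<\<mu>}}"
  have "f \<in> ?Z" if "(x, j, f) \<in> Pts X" for x j f
  proof -
    have "f = 0 \<or> (\<exists>k. supp_below (e k x) f)" using that by (auto simp: Pts_iff)
    then have "co f \<delta> = 0" if "\<mu> \<le> \<delta>" for \<delta>
      using that e_less less_le_trans less_imp_le unfolding supp_below_def by (metis co_simps(1))
    then have "k \<in> dual ` {..<\<mu>}" if "k \<in> Poly_Mapping.keys f" for k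
      using that by (metis co_def dual_undual image_eqI in_keys_iff lessThan_iff not_le)
    then show ?thesis by blast
  qed
  then have "Pts X \<subseteq> UNIV \<times> UNIV \<times> ?Z"
    by (intro subsetI) (metis UNIV_I mem_Sigma_iff prod_cases3)
  moreover have cZ: "countable ?Z"
    by (rule countable_poly_mapping) (intro countable_image countable_lessThan_cord)
  moreover have "countable ((UNIV :: idx set) \<times> (UNIV :: nat set) \<times> ?Z)"
    by (intro countable_SIGMA countable_Idx cZ) simp
  ultimately show ?thesis by (blast intro: countable_subset)
qed

text \<open>With \<open>(0, 0)\<close> in it, every approximation preserves agreement with 0 and
  thus the exponents themselves; this is why \<beta> is arbitrary.\<close>

lemma idx_automorphism:
  assumes F: "good F" "(0, 0) \<in> F"
  obtains g where "iso_idx \<beta> Idx Idx g" "\<And>x y. (x, y) \<in> F \<Longrightarrow> g x = y"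
proof -
  have sub: "F \<subseteq> Idx \<times> Idx" using goodD(1,2)[OF F(1)] by auto
  define P where "P G \<longleftrightarrow> good G \<and> F \<subseteq> G" for G
  have PF: "P F" using F(1) by (simp add: P_def)
  obtain g where g: "bij_betw g Idx Idx" "\<And>x y. (x, y) \<in> F \<Longrightarrow> g x = y"
    "\<And>x y. x \<in> Idx \<Longrightarrow> y \<in> Idx \<Longrightarrow> \<exists>G. P G \<and> (x, g x) \<in> G \<and> (y, g y) \<in> G"
  proof (rule back_and_forth[where P = P, OF countable_Idx countable_Idx PF sub])
    show "\<exists>y\<in>Idx. P (insert (x, y) G)" if PG: "P G" "x \<in> Idx" for G x
    proof -
      have G: "good G" "G \<noteq> {}" using PG(1) F(2) by (auto simp: P_def)
      obtain y where y: "good (insert (x, y) G)" using good_extension[OF G PG(2)] by metis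
      then have "y \<in> Idx" using goodD(2)[OF y insertI1] by simp
      then show ?thesis using y PG(1) unfolding P_def by blast
    qed
    show "\<exists>x\<in>Idx. P (insert (x, y) G)" if PG: "P G" "y \<in> Idx" for G y
    proof -
      have G: "good (G\<inverse>)" "G\<inverse> \<noteq> {}" using PG(1) F(2) good_converse by (auto simp: P_def)
      obtain x where x: "good (insert (y, x) (G\<inverse>))" using good_extension[OF G PG(2)] by metis
      have "(insert (y, x) (G\<inverse>))\<inverse> = insert (x, y) G" by auto
      then have x': "good (insert (x, y) G)" using good_converse[OF x] by simp
      then have "x \<in> Idx" using goodD(1)[OF x' insertI1] by simp
      then show ?thesis using x' PG(1) unfolding P_def by blast
    qed
    show "x = x' \<longleftrightarrow> y = y'" if "P G" "(x, y) \<in> G" "(x', y') \<in> G" for G x y x' y'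
      using goodD(7) that unfolding P_def by blast
    fix g assume "bij_betw g Idx Idx" "\<And>x y. (x, y) \<in> F \<Longrightarrow> g x = y"
      "\<And>x y. x \<in> Idx \<Longrightarrow> y \<in> Idx \<Longrightarrow> \<exists>G. P G \<and> (x, g x) \<in> G \<and> (y, g y) \<in> G"
    then show thesis by (rule that)
  qed
  have "iso_idx \<beta> Idx Idx g"
    unfolding iso_idx_def
  proof (intro conjI ballI allI)
    show "bij_betw g Idx Idx" by (rule g(1))
    show "x < y \<longleftrightarrow> g x < g y" if xy: "x \<in> Idx" "y \<in> Idx" for x y
      using g(3)[OF xy] goodD(5) unfolding P_def by blast
    fix x k assume x: "x \<in> Idx"
    obtain G where G: "good G" "F \<subseteq> G" "(x, g x) \<in> G" using g(3)[OF x x] by (auto simp: P_def)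
    show "leaf x = leaf (g x)" "sepx k x = sepx k (g x)" using goodD(3,4)[OF G(1,3)] by auto
    have "agr x 0 k \<longleftrightarrow> agr (g x) 0 k" using goodD(6)[OF G(1,3)] F(2) G(2) by blast
    then show "sepx k x \<longrightarrow> e k x = e k (g x) \<or> \<beta> \<le> e k x \<and> \<beta> \<le> e k (g x)"
      by (simp add: e_def)
  qed
  then show thesis using g(2) that by blast
qed

lemma sepx_agr_0: "sepx k x \<Longrightarrow> agr x 0 K \<Longrightarrow> K \<le> k"
proof (rule ccontr)
  assume "sepx k x" "agr x 0 K" "\<not> K \<le> k"
  then have "\<not> node (Poly_Mapping.lookup x k)" "Poly_Mapping.lookup x k = 0" by (auto simp: sepx_def agr_def)
  then show False using node_0 by simp
qed

text \<open>Inside the ball of the indices that agree with \<open>0\<close> up to \<open>K\<close>, all exponents are large, so there the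
  leaf \<open>0\<close> is an ordinary point and may be deleted.\<close>

lemma idx_delete_0:
  assumes K: "\<And>k. K \<le> k \<Longrightarrow> \<beta> \<le> b k"
  obtains g where "iso_idx \<beta> Idx (Idx - {0}) g" "\<And>x. \<not> agr x 0 K \<Longrightarrow> g x = x"
proof -
  define Ball where "Ball = {x \<in> Idx. agr x 0 K}"
  obtain q where q: "\<not> node q" using dense_sep[of 0 1] by auto
  \<comment> \<open>The pair \<open>(s, s)\<close> is the seed of the construction:
    \<open>good_extension\<close> asks for a nonempty set, and agreement with \<open>s\<close> up to
    \<open>K\<close> keeps all images inside the ball.\<close>
  define s :: idx where "s = Poly_Mapping.single K q"
  have s: "sepx K s" "agr s 0 K"
    using q node_0 by (auto simp: s_def sepx_def agr_def lookup_single when_def)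
  have s0: "s \<noteq> 0" using s(1) leaf_0 leaf_not_sepx by blast
  have sI: "s \<in> Idx" using s(1) by (auto simp: Idx_def)
  define P where "P G \<longleftrightarrow> good G \<and> (s, s) \<in> G \<and> G \<subseteq> Ball \<times> (Ball - {0})" for G
  have sub: "{(s, s)} \<subseteq> Ball \<times> (Ball - {0})" using s s0 sI by (simp add: Ball_def)
  have "good {(s, s)}" by (rule goodI) (use sI in auto)
  then have Ps: "P {(s, s)}" using sub by (simp add: P_def)
  have in_ball: "agr x 0 K \<longleftrightarrow> agr y 0 K" if "good G" "(s, s) \<in> G" "(x, y) \<in> G" for G x y
    using goodD(6)[OF that(1,3,2), of K] s(2) agr_trans agr_sym by blast
  have c: "countable Ball" "countable (Ball - {0})" by (rule countable_Idx)+
  obtain h where h: "bij_betw h Ball (Ball - {0})"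
    "\<And>x y. x \<in> Ball \<Longrightarrow> y \<in> Ball \<Longrightarrow> \<exists>G. P G \<and> (x, h x) \<in> G \<and> (y, h y) \<in> G"
  proof (rule back_and_forth[where P = P, OF c Ps sub])
    show "\<exists>y\<in>Ball - {0}. P (insert (x, y) G)" if PG: "P G" "x \<in> Ball" for G x
    proof -
      have G: "good G" "G \<noteq> {}" using PG(1) by (auto simp: P_def)
      have x: "x \<in> Idx" using PG(2) by (simp add: Ball_def)
      obtain y where y: "good (insert (x, y) G)" "(x, y) \<in> G \<or> y \<noteq> 0" using good_extension[OF G x] by metis
      have "agr x 0 K \<longleftrightarrow> agr y 0 K" by (rule in_ball[OF y(1)]) (use PG(1) in \<open>simp_all add: P_def\<close>)
      moreover have "y \<in> Idx" using goodD(2)[OF y(1) insertI1] by simp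
      ultimately have "y \<in> Ball - {0}" using PG y(2) by (auto simp: Ball_def P_def)
      then show ?thesis using y(1) PG unfolding P_def by blast
    qed
    show "\<exists>x\<in>Ball. P (insert (x, y) G)" if PG: "P G" "y \<in> Ball - {0}" for G y
    proof -
      have G: "good (G\<inverse>)" "G\<inverse> \<noteq> {}" using PG(1) good_converse by (auto simp: P_def)
      have y: "y \<in> Idx" using PG(2) by (simp add: Ball_def)
      obtain x where x: "good (insert (y, x) (G\<inverse>))" using good_extension[OF G y] by metis
      have "(insert (y, x) (G\<inverse>))\<inverse> = insert (x, y) G" by auto
      then have x': "good (insert (x, y) G)" using good_converse[OF x] by simp
      have "agr x 0 K \<longleftrightarrow> agr y 0 K" by (rule in_ball[OF x']) (use PG(1) in \<open>simp_all add: P_def\<close>)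
      moreover have "x \<in> Idx" using goodD(1)[OF x' insertI1] by simp
      ultimately have "x \<in> Ball" using PG by (auto simp: Ball_def P_def)
      then show ?thesis using x' PG unfolding P_def by blast
    qed
    show "x = x' \<longleftrightarrow> y = y'" if "P G" "(x, y) \<in> G" "(x', y') \<in> G" for G x y x' y'
      using goodD(7) that unfolding P_def by blast
    fix h assume "bij_betw h Ball (Ball - {0})"
      "\<And>x y. x \<in> Ball \<Longrightarrow> y \<in> Ball \<Longrightarrow> \<exists>G. P G \<and> (x, h x) \<in> G \<and> (y, h y) \<in> G"
    then show thesis by (rule that)
  qed
  define g where "g x = (if x \<in> Ball then h x else x)" for x
  have h_in: "h x \<in> Ball - {0}" if "x \<in> Ball" for x using h(1) that by (auto simp: bij_betw_def)
  have agr_h: "agr x (h x) K" if "x \<in> Ball" for x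
  proof -
    have "agr x 0 K" "agr (h x) 0 K" using that h_in[OF that] by (auto simp: Ball_def)
    then show ?thesis using agr_trans agr_sym by blast
  qed
  have out: "\<not> agr x y K" if "x \<in> Ball" "y \<in> Idx - Ball" for x y
    using that agr_trans[OF agr_sym, of x y K 0] by (auto simp: Ball_def)
  have "iso_idx \<beta> Idx (Idx - {0}) g"
    unfolding iso_idx_def
  proof (intro conjI ballI allI)
    have "bij_betw g Ball (Ball - {0})" using h(1) by (subst bij_betw_cong[of _ _ h]) (auto simp: g_def)
    moreover have "bij_betw g (Idx - Ball) (Idx - Ball)"
      using bij_betw_cong[of "Idx - Ball" g id] by (simp add: g_def)
    ultimately have "bij_betw g (Ball \<union> (Idx - Ball)) ((Ball - {0}) \<union> (Idx - Ball))"
      by (rule bij_betw_combine) auto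
    moreover have "Ball \<union> (Idx - Ball) = Idx" by (auto simp: Ball_def)
    moreover have "(Ball - {0}) \<union> (Idx - Ball) = Idx - {0}"
      using leaf_0 by (auto simp: Ball_def Idx_def)
    ultimately show "bij_betw g Idx (Idx - {0})" by simp
    show "x < y \<longleftrightarrow> g x < g y" if xy: "x \<in> Idx" "y \<in> Idx" for x y
    proof (cases "x \<in> Ball")
      case x: True
      show ?thesis
      proof (cases "y \<in> Ball")
        case True
        obtain G where "good G" "(x, h x) \<in> G" "(y, h y) \<in> G" using h(2)[OF x True] by (auto simp: P_def)
        then have "x < y \<longleftrightarrow> h x < h y" by (rule goodD(5))
        then show ?thesis using x True by (simp add: g_def)
      next
        case False
        then show ?thesis using less_via_agr(1)[OF agr_h[OF x] out[OF x], of y] x xy by (simp add: g_def)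
      qed
    next
      case x: False
      show ?thesis
      proof (cases "y \<in> Ball")
        case True
        then show ?thesis using less_via_agr(2)[OF agr_h[OF True] out[OF True], of x] x xy by (simp add: g_def)
      next
        case False
        then show ?thesis using x by (simp add: g_def)
      qed
    qed
    fix x k assume x: "x \<in> Idx"
    have "(leaf x = leaf (g x)) \<and> (sepx k x = sepx k (g x)) \<and>
      (sepx k x \<longrightarrow> e k x = e k (g x) \<or> \<beta> \<le> e k x \<and> \<beta> \<le> e k (g x))"
    proof (cases "x \<in> Ball")
      case True
      obtain G where G: "good G" "(x, h x) \<in> G" using h(2)[OF True True] by (auto simp: P_def)
      \<comment> \<open>A separator in the ball has level at least \<open>K\<close>, so either of
        the two exponents it might carry is at least \<beta>.\<close>
      have "\<beta> \<le> e k y" if "sepx k x" for y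
        using K[OF sepx_agr_0[OF that]] True e_ge[of k y] by (auto simp: Ball_def)
      then show ?thesis using goodD(3,4)[OF G] True by (simp add: g_def)
    next
      case False
      then show ?thesis by (simp add: g_def)
    qed
    then show "leaf x = leaf (g x)" "sepx k x = sepx k (g x)"
      "sepx k x \<longrightarrow> e k x = e k (g x) \<or> \<beta> \<le> e k x \<and> \<beta> \<le> e k (g x)" by blast+
  qed
  then show thesis using that by (simp add: g_def Ball_def)
qed

end

section \<open>Recognising blocks\<close>

declare split_paired_All [simp del] split_paired_Ex [simp del]

text \<open>The finite ordinals. \<open>lev 0\<close> also serves as the exponent 0, so
  \<open>mon (lev 0) 1\<close> is the unit step in a gadget.\<close>

primrec lev :: "nat \<Rightarrow> cord" where
  "lev 0 = (LEAST \<alpha>. True)"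
| "lev (Suc n) = cord_succ (lev n)"

lemma lev_0_le: "lev 0 \<le> \<alpha>"
  by (simp add: Least_le)

lemma lev_less_Suc: "lev n < lev (Suc n)"
  by (simp add: less_cord_succ)

lemma lev_mono: "m \<le> n \<Longrightarrow> lev m \<le> lev n"
  by (rule lift_Suc_mono_le) (use lev_less_Suc less_imp_le in blast)+

lemma lev_less_limit: "limit_cord \<mu> \<Longrightarrow> lev n < \<mu>"
proof (induction n)
  case 0
  then obtain \<alpha> where "\<alpha> < \<mu>" by (auto simp: limit_cord_def)
  then show ?case using lev_0_le le_less_trans by blast
qed (simp add: limit_cord_succ)

text \<open>Coordinate l is not dyadic, so \<open>x\<close> is a separator of that level as well,
  and its later coordinates vanish.\<close>

lemma sep_determined:
  assumes "x \<in> Idx" "sepx l z" "agr x z (Suc l)"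
  shows "x = z"
proof -
  have "\<not> node (Poly_Mapping.lookup x l)" using assms(2,3) by (auto simp: agr_def sepx_def)
  moreover from this obtain m where m: "sepx m x" using assms(1) by (auto simp: Idx_def leaf_def)
  ultimately have ml: "m = l"
    using node_0 unfolding sepx_def by (metis linorder_neqE_nat)
  show ?thesis
  proof (rule poly_mapping_eqI)
    fix i
    show "Poly_Mapping.lookup x i = Poly_Mapping.lookup z i"
      using assms(2,3) m unfolding ml by (cases "i \<le> l") (auto simp: agr_def sepx_def)
  qed
qed

lemma agr_between: "x < z \<Longrightarrow> z \<le> y \<Longrightarrow> agr x y k \<Longrightarrow> agr x z k"
  using less_via_agr(1)[of x y k z] by (metis not_le)

text \<open>The interval from \<open>x\<close> to \<open>y\<close> lies in a ball of radius k, and a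
  separator of smaller level in it would equal \<open>x\<close>. With \<open>ex_sep_between\<close>
  this identifies the coordinate where two indices part as the least level of a separator strictly
  between them.\<close>

lemma sep_between_level:
  assumes "x \<in> Idx" "x < z" "z \<le> y" "sepx l z" "agr x y k"
  shows "k \<le> l"
proof (rule ccontr)
  assume "\<not> k \<le> l"
  moreover have "agr x z k" by (rule agr_between[OF assms(2,3,5)])
  ultimately have "agr x z (Suc l)" using agr_mono by (simp add: not_le Suc_le_eq)
  then show False using sep_determined[OF assms(1,4)] assms(2) by simp
qed

lemma ex_sep_between:
  assumes xy: "x \<in> Idx" "y \<in> Idx" "x < y" and k: "agr x y k" "Poly_Mapping.lookup x k \<noteq> Poly_Mapping.lookup y k"
  obtains z where "sepx k z" "x < z" "z < y"
proof -
  have lt: "Poly_Mapping.lookup x k < Poly_Mapping.lookup y k" using idx_less_at[OF k] xy(3) by simp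
  then obtain q where q: "Poly_Mapping.lookup x k < q" "q < Poly_Mapping.lookup y k" "\<not> node q" by (rule dense_sep)
  have nodes: "node (Poly_Mapping.lookup x i)" if "i < k" for i
  proof (rule ccontr)
    assume nn: "\<not> node (Poly_Mapping.lookup x i)"
    then obtain m where m: "sepx m x" using xy(1) by (auto simp: Idx_def leaf_def)
    then have "m = i" using nn node_0 unfolding sepx_def by (metis linorder_neqE_nat)
    moreover have "agr y x (Suc i)" using agr_mono[OF agr_sym[OF k(1)]] that by simp
    ultimately have "y = x" using sep_determined[OF xy(2)] m by blast
    then show False using xy(3) by simp
  qed
  have "finite {i. (if i < k then Poly_Mapping.lookup x i else if i = k then q else 0) \<noteq> 0}"
    by (rule finite_subset[of _ "{..k}"]) auto
  from ex_idx[OF this] obtain z where z: "Poly_Mapping.lookup z =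
      (\<lambda>i. if i < k then Poly_Mapping.lookup x i else if i = k then q else 0)" ..
  have a: "agr x z k" "agr z y k" using k(1) by (auto simp: agr_def z)
  have zk: "Poly_Mapping.lookup z k = q" by (simp add: z)
  show thesis
  proof
    show "sepx k z" using nodes q(3) by (simp add: sepx_def z)
    show "x < z" unfolding idx_less_iff using a(1) q(1) zk by metis
    show "z < y" unfolding idx_less_iff using a(2) q(2) zk by metis
  qed
qed

lemma point_less_iff: "(x, j, f) < (y, i, g) \<longleftrightarrow> x < y \<or> x = y \<and> (j < i \<or> j = i \<and> f < g)"
  for x y :: idx and j i :: nat and f g :: zpow
  by (auto simp: le_less)

definition adj :: "point set \<Rightarrow> point \<Rightarrow> point \<Rightarrow> bool" where
  "adj P p q \<longleftrightarrow> p \<in> P \<and> q \<in> P \<and> p < q \<and> (\<forall>r\<in>P. \<not> (p < r \<and> r < q))"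

text \<open>A maximal finite chain of adjacent points. Length at least 2 excludes the leaves, which
  have no neighbours either.\<close>

definition isblk :: "point set \<Rightarrow> point list \<Rightarrow> bool" where
  "isblk P s \<longleftrightarrow> 2 \<le> length s \<and> (\<forall>i. Suc i < length s \<longrightarrow> adj P (s ! i) (s ! Suc i)) \<and>
    (\<forall>r. \<not> adj P r (s ! 0)) \<and> (\<forall>r. \<not> adj P (s ! (length s - 1)) r)"

section \<open>Adjacency and blocks in the back-and-forth game\<close>

context tower
begin

lemma bf_less:
  assumes "bf (M X) (M Y) \<alpha> ps qs" "set ps \<subseteq> Pts X" "set qs \<subseteq> Pts Y" "i < length ps" "j < length ps"
  shows "ps ! i < ps ! j \<longleftrightarrow> qs ! i < qs ! j"
proof -
  have a: "atomic_eq (M X) (M Y) ps qs" by (rule bf_atomic[OF assms(1)])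
  then have len: "length ps = length qs" by (simp add: atomic_eq_def)
  have "ps ! i \<in> Pts X" "ps ! j \<in> Pts X" "qs ! i \<in> Pts Y" "qs ! j \<in> Pts Y"
    using subsetD[OF assms(2) nth_mem] subsetD[OF assms(3) nth_mem] assms(4,5) len by simp_all
  moreover have "ps ! i = ps ! j \<longleftrightarrow> qs ! i = qs ! j"
    "(ps ! i, ps ! j) \<in> snd (M X) \<longleftrightarrow> (qs ! i, qs ! j) \<in> snd (M Y)"
    using a assms(4,5) unfolding atomic_eq_def by blast+
  ultimately show ?thesis by (auto simp: less_le)
qed

text \<open>A point strictly between the images would, after one move back, yield one strictly
  between the originals.\<close>

lemma bf_adj:
  assumes bf: "bf (M X) (M Y) (lev (Suc n)) ps qs" and sub: "set ps \<subseteq> Pts X" "set qs \<subseteq> Pts Y"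
    and ij: "i < length ps" "j < length ps" and adj: "adj (Pts X) (ps ! i) (ps ! j)"
  shows "adj (Pts Y) (qs ! i) (qs ! j)"
proof -
  have len: "length ps = length qs" using bf_length[OF bf] .
  have mem: "qs ! i \<in> Pts Y" "qs ! j \<in> Pts Y" using subsetD[OF sub(2) nth_mem] ij len by simp_all
  have "qs ! i < qs ! j" using bf_less[OF bf sub ij] adj by (simp add: adj_def)
  moreover have False if r: "r \<in> Pts Y" "qs ! i < r" "r < qs ! j" for r
  proof -
    obtain cs where cs: "length cs = length [r]" "set cs \<subseteq> fst (M X)" "bf (M X) (M Y) (lev n) (ps @ cs) (qs @ [r])"
      using bf_back[OF bf lev_less_Suc, of "[r]"] r(1) by auto
    then obtain c where c: "cs = [c]" "c \<in> Pts X" by (cases cs) auto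
    have sub': "set (ps @ [c]) \<subseteq> Pts X" "set (qs @ [r]) \<subseteq> Pts Y" using sub c r by auto
    note L = bf_less[OF cs(3)[unfolded c(1)] sub']
    have "ps ! i < c" "c < ps ! j"
      using L[of i "length ps"] L[of "length ps" j] r(2,3) ij len by (simp_all add: nth_append)
    then show False using adj c(2) by (auto simp: adj_def)
  qed
  ultimately show ?thesis using mem by (auto simp: adj_def)
qed

text \<open>One round names the neighbour, and one more is kept to transfer the adjacency.\<close>

lemma bf_has_adj:
  assumes bf: "bf (M X) (M Y) (lev (Suc (Suc n))) ps qs" and sub: "set ps \<subseteq> Pts X" "set qs \<subseteq> Pts Y"
    and i: "i < length ps"
  shows "adj (Pts X) (ps ! i) r \<Longrightarrow> \<exists>r. adj (Pts Y) (qs ! i) r"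
    and "adj (Pts X) r (ps ! i) \<Longrightarrow> \<exists>r. adj (Pts Y) r (qs ! i)"
proof -
  have len: "length ps = length qs" using bf_length[OF bf] .
  have *: "\<exists>r'. (adj (Pts X) (ps ! i) r \<longrightarrow> adj (Pts Y) (qs ! i) r') \<and>
      (adj (Pts X) r (ps ! i) \<longrightarrow> adj (Pts Y) r' (qs ! i))" if r: "r \<in> Pts X"
  proof -
    obtain ds where ds: "length ds = length [r]" "set ds \<subseteq> fst (M Y)" "bf (M X) (M Y) (lev (Suc n)) (ps @ [r]) (qs @ ds)"
      using bf_forth[OF bf lev_less_Suc, of "[r]"] r by auto
    then obtain d where d: "ds = [d]" "d \<in> Pts Y" by (cases ds) auto
    have sub': "set (ps @ [r]) \<subseteq> Pts X" "set (qs @ [d]) \<subseteq> Pts Y" using sub d r by auto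
    note A = bf_adj[OF ds(3)[unfolded d(1)] sub']
    show ?thesis
      using A[of i "length ps"] A[of "length ps" i] i len by (intro exI[of _ d]) (simp add: nth_append)
  qed
  show "adj (Pts X) (ps ! i) r \<Longrightarrow> \<exists>r. adj (Pts Y) (qs ! i) r"
    using * unfolding adj_def[of "Pts X"] by blast
  show "adj (Pts X) r (ps ! i) \<Longrightarrow> \<exists>r. adj (Pts Y) r (qs ! i)"
    using * unfolding adj_def[of "Pts X"] by blast
qed

text \<open>The absence of neighbours at the two ends is transferred by applying
  \<open>bf_has_adj\<close> in the opposite direction.\<close>

lemma bf_isblk:
  assumes bf: "bf (M X) (M Y) (lev (Suc (Suc n))) s t" and sub: "set s \<subseteq> Pts X" "set t \<subseteq> Pts Y" and blk: "isblk (Pts X) s"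
  shows "isblk (Pts Y) t"
proof -
  have len: "length s = length t" using bf_length[OF bf] .
  have l2: "2 \<le> length s" using blk by (simp add: isblk_def)
  have bf1: "bf (M X) (M Y) (lev (Suc n)) s t" by (rule bf_mono[OF bf less_imp_le[OF lev_less_Suc]])
  have "t \<noteq> []" using l2 len by auto
  have "adj (Pts Y) (t ! i) (t ! Suc i)" if "Suc i < length t" for i
    using bf_adj[OF bf1 sub, of i "Suc i"] blk that len by (auto simp: isblk_def)
  moreover have "\<not> adj (Pts Y) r (t ! 0)" for r
    using bf_has_adj(2)[OF bf_sym[OF bf] sub(2,1), of 0 r] \<open>t \<noteq> []\<close> blk l2 len by (auto simp: isblk_def)
  moreover have "\<not> adj (Pts Y) (t ! (length t - 1)) r" for r
    using bf_has_adj(1)[OF bf_sym[OF bf] sub(2,1), of "length t - 1" r] \<open>t \<noteq> []\<close> blk l2 len by (auto simp: isblk_def)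
  ultimately show ?thesis using l2 len by (simp add: isblk_def)
qed

lemma bf_add_block:
  assumes bf: "bf (M X) (M Y) (lev (Suc (Suc (Suc n)))) ps qs" and sub: "set ps \<subseteq> Pts X" "set qs \<subseteq> Pts Y"
    and s: "isblk (Pts X) s" "set s \<subseteq> Pts X"
  obtains t where "isblk (Pts Y) t" "set t \<subseteq> Pts Y" "length t = length s"
    "bf (M X) (M Y) (lev (Suc (Suc n))) (ps @ s) (qs @ t)"
proof -
  have len: "length ps = length qs" using bf_length[OF bf] .
  obtain t where t: "length t = length s" "set t \<subseteq> fst (M Y)" "bf (M X) (M Y) (lev (Suc (Suc n))) (ps @ s) (qs @ t)"
    using bf_forth[OF bf lev_less_Suc, of s] s(2) by auto
  let ?ks = "[length ps..<length ps + length s]"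
  have "bf (M X) (M Y) (lev (Suc (Suc n))) (map ((!) (ps @ s)) ?ks) (map ((!) (qs @ t)) ?ks)"
    by (rule bf_reindex[OF t(3)]) auto
  moreover have "map ((!) (ps @ s)) ?ks = s" by (rule nth_equalityI) auto
  moreover have "map ((!) (qs @ t)) ?ks = t" by (rule nth_equalityI) (auto simp: len t(1))
  ultimately have "bf (M X) (M Y) (lev (Suc (Suc n))) s t" by simp
  then have "isblk (Pts Y) t" using bf_isblk s t(2) by auto
  then show thesis using that t by auto
qed

text \<open>Common to \<open>Idx\<close> and \<open>Idx - {0}\<close>, so that both orders are
  treated at once; recognition relies on the separators alone.\<close>

definition full :: "idx set \<Rightarrow> bool" where
  "full X \<longleftrightarrow> X \<subseteq> Idx \<and> (\<forall>x k. sepx k x \<longrightarrow> x \<in> X)"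

lemma Pts_sep: "sepx k x \<Longrightarrow> (x, j, f) \<in> Pts X \<longleftrightarrow> x \<in> X \<and> (j < k + 2 \<and> f = 0 \<or> j = k + 2 \<and> supp_below (e k x) f)"
  using sepx_unique leaf_not_sepx by (auto simp: Pts_iff)

lemma Pts_leaf: "leaf x \<Longrightarrow> (x, j, f) \<in> Pts X \<longleftrightarrow> x \<in> X \<and> j = 0 \<and> f = 0"
  using leaf_not_sepx by (auto simp: Pts_iff)

text \<open>By \<open>b_pos\<close> no gadget is a single point; this is what gives gadget points
  their neighbours.\<close>

lemma lev_0_less_e: "lev 0 < e k x"
proof -
  obtain \<gamma> where "\<gamma> < b k" using b_pos by blast
  then show ?thesis by (rule le_less_trans[OF lev_0_le less_le_trans[OF _ e_ge]])
qed

lemma adj_same_index: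
  assumes X: "full X" and a: "adj (Pts X) (x, j, f) (y, i, g)"
  shows "x = y"
proof (rule ccontr)
  assume "x \<noteq> y"
  then have xy: "x < y" using a by (auto simp: adj_def point_less_iff)
  have "x \<in> Idx" "y \<in> Idx" using a X by (auto simp: adj_def full_def Pts_iff)
  moreover obtain k where "agr x y k" "Poly_Mapping.lookup x k \<noteq> Poly_Mapping.lookup y k"
    using first_difference[OF \<open>x \<noteq> y\<close>] .
  ultimately obtain z where z: "sepx k z" "x < z" "z < y" using ex_sep_between xy by metis
  then have "(z, 0, 0) \<in> Pts X" using X by (auto simp: Pts_sep full_def)
  then show False using a z(2,3) by (auto simp: adj_def point_less_iff)
qed

lemma adj_block: "sepx k x \<Longrightarrow> x \<in> X \<Longrightarrow> Suc j < k + 2 \<Longrightarrow> adj (Pts X) (x, j, 0) (x, Suc j, 0)"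
  by (auto simp: adj_def Pts_sep point_less_iff)

text \<open>A point strictly between would split the unit \<open>mon (lev 0) 1\<close> into two
  positive parts, with positive integer coefficients at exponent 0 that add up to 1.\<close>

lemma adj_gadget:
  assumes "sepx k x" "(x, k + 2, f) \<in> Pts X"
  shows "adj (Pts X) (x, k + 2, f - mon (lev 0) 1) (x, k + 2, f)"
  unfolding adj_def
proof (intro conjI ballI notI)
  have "supp_below (e k x) (mon (lev 0) 1)" using lev_0_less_e by simp
  then show "(x, k + 2, f - mon (lev 0) 1) \<in> Pts X"
    using assms by (simp add: Pts_sep)
  have m: "0 < mon (lev 0) 1" using lead_pos[OF lead_mon] by simp
  then show "(x, k + 2, f - mon (lev 0) 1) < (x, k + 2, f)" by (simp add: point_less_iff)
  fix r assume r: "r \<in> Pts X" "(x, k + 2, f - mon (lev 0) 1) < r \<and> r < (x, k + 2, f)"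
  obtain y i h where re: "r = (y, i, h)" by (cases r)
  have h: "f - mon (lev 0) 1 < h" "h < f" using r(2) by (auto simp: re point_less_iff simp del: less_prod_simp)
  then have "0 < f - h" "0 < mon (lev 0) 1 - (f - h)" by (simp_all add: algebra_simps)
  then obtain \<delta> a \<epsilon> c where t: "lead (f - h) \<delta> a" "lead (mon (lev 0) 1 - (f - h)) \<epsilon> c" by (auto simp: zpow_pos_iff)
  have "lead ((f - h) + (mon (lev 0) 1 - (f - h))) (max \<delta> \<epsilon>) (if \<delta> < \<epsilon> then c else if \<epsilon> < \<delta> then a else a + c)"
    by (rule lead_add[OF t])
  then have "lead (mon (lev 0) 1) (max \<delta> \<epsilon>) (if \<delta> < \<epsilon> then c else if \<epsilon> < \<delta> then a else a + c)" by simp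
  then have "max \<delta> \<epsilon> = lev 0" "(if \<delta> < \<epsilon> then c else if \<epsilon> < \<delta> then a else a + c) = 1"
    using lead_unique[OF lead_mon[of 1 "lev 0"]] by auto
  moreover have "0 < a" "0 < c" using t by (auto simp: lead_def)
  moreover have "\<delta> = lev 0" "\<epsilon> = lev 0" using calculation(1) lev_0_le[of \<delta>] lev_0_le[of \<epsilon>] by (auto simp: max_def split: if_splits)
  ultimately show False by simp
qed (use assms in simp)

text \<open>The gadget behind the block has no first point, so the last point of the block has no
  successor.\<close>

lemma adj_block_succ:
  assumes X: "full X" and k: "sepx k x" "j < k + 2" and a: "adj (Pts X) (x, j, f) q"
  shows "Suc j < k + 2 \<and> q = (x, Suc j, 0)"
proof -
  obtain y i g where q: "q = (y, i, g)" by (cases q)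
  then have y: "y = x" using adj_same_index[OF X] a by blast
  have mem: "(x, i, g) \<in> Pts X" "x \<in> X" "f = 0" using a k by (auto simp: adj_def q y Pts_sep)
  have ji: "j < i"
  proof -
    have "(x, j, f) < (x, i, g)" using a by (simp add: adj_def q y)
    then have "j < i \<or> j = i \<and> f < g" unfolding point_less_iff by blast
    then show ?thesis using mem(1,3) k by (auto simp: Pts_sep)
  qed
  show ?thesis
  proof (cases "Suc j < k + 2")
    case True
    then have "(x, Suc j, 0) \<in> Pts X" using mem(2) k(1) by (simp add: Pts_sep)
    moreover have "(x, j, f) < (x, Suc j, 0)" by (simp add: point_less_iff)
    ultimately have "\<not> (x, Suc j, 0) < (x, i, g)" using a unfolding adj_def q y by blast
    then have "i = Suc j" using ji by (auto simp: point_less_iff simp del: less_prod_simp)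
    then show ?thesis using True mem(1) k by (simp add: Pts_sep q y)
  next
    case False
    then have i: "i = k + 2" using mem(1) k ji by (auto simp: Pts_sep)
    have "adj (Pts X) (x, k + 2, g - mon (lev 0) 1) (x, k + 2, g)"
      using adj_gadget[OF k(1)] mem(1) i by simp
    moreover have "(x, j, f) < (x, k + 2, g - mon (lev 0) 1)" using k(2) by (simp add: point_less_iff)
    ultimately have False using a by (auto simp: adj_def q y i)
    then show ?thesis ..
  qed
qed

lemma leaf_not_adj:
  assumes X: "full X" and x: "leaf x"
  shows "\<not> adj (Pts X) (x, j, f) q" "\<not> adj (Pts X) q (x, j, f)"
proof -
  obtain y i g where q: "q = (y, i, g)" by (cases q)
  have *: "\<not> (x, i, g) < (x, j, f)" if "(x, i, g) \<in> Pts X" "(x, j, f) \<in> Pts X" for i j g f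
    using that Pts_leaf[OF x] by simp
  show "\<not> adj (Pts X) (x, j, f) q"
    using adj_same_index[OF X, of x j f y i g] * unfolding q adj_def by blast
  show "\<not> adj (Pts X) q (x, j, f)"
    using adj_same_index[OF X, of y i g x j f] * unfolding q adj_def by blast
qed

text \<open>The first point of such a chain has a successor, so it is not a leaf, and no
  predecessor, so it is not in a gadget. It is therefore the first point of a block, and the chain
  runs through that block to its end.\<close>

lemma isblk_iff:
  assumes X: "full X"
  shows "isblk (Pts X) s \<longleftrightarrow> (\<exists>x k. sepx k x \<and> s = map (\<lambda>j. (x, j, 0)) [0..<k + 2])"
proof
  assume s: "isblk (Pts X) s"
  then have l2: "2 \<le> length s" by (simp add: isblk_def)
  have adj: "adj (Pts X) (s ! i) (s ! Suc i)" if "Suc i < length s" for i using s that by (simp add: isblk_def)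
  obtain x j f where s0: "s ! 0 = (x, j, f)" by (cases "s ! 0")
  have mem: "(x, j, f) \<in> Pts X" using adj[of 0] l2 s0 by (auto simp: adj_def)
  have "\<not> leaf x" using leaf_not_adj(1)[OF X, of x j f "s ! 1"] adj[of 0] l2 s0 by auto
  then obtain k where k: "sepx k x" using mem by (auto simp: Pts_iff)
  have pre: "\<not> adj (Pts X) r (x, j, f)" for r using s s0 by (simp add: isblk_def)
  have x: "x \<in> X" using mem by (simp add: Pts_iff)
  have "j \<noteq> k + 2" using adj_gadget[OF k] pre mem by blast
  then have f: "f = 0" "j < k + 2" using mem k by (auto simp: Pts_sep)
  have j: "j = 0"
  proof (rule ccontr)
    assume "j \<noteq> 0"
    then have "adj (Pts X) (x, j - 1, 0) (x, Suc (j - 1), 0)" using f by (intro adj_block[OF k x]) auto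
    then show False using pre f \<open>j \<noteq> 0\<close> by simp
  qed
  have nth: "i < length s \<Longrightarrow> i < k + 2 \<and> s ! i = (x, i, 0)" for i
  proof (induction i)
    case (Suc i)
    then show ?case using adj_block_succ[OF X k, of i 0 "s ! Suc i"] adj[of i] by auto
  qed (use s0 f j in simp)
  have "length s = k + 2"
  proof (rule ccontr)
    assume "length s \<noteq> k + 2"
    moreover have last: "length s - 1 < k + 2 \<and> s ! (length s - 1) = (x, length s - 1, 0)" using nth l2 by simp
    ultimately have "Suc (length s - 1) < k + 2" using l2 by arith
    then have "adj (Pts X) (s ! (length s - 1)) (x, Suc (length s - 1), 0)"
      using adj_block[OF k x] last by simp
    then show False using s by (simp add: isblk_def)
  qed
  then have "s = map (\<lambda>j. (x, j, 0)) [0..<k + 2]"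
    using nth by (intro nth_equalityI) (auto simp del: upt_Suc)
  then show "\<exists>x k. sepx k x \<and> s = map (\<lambda>j. (x, j, 0)) [0..<k + 2]" using k by blast
next
  assume "\<exists>x k. sepx k x \<and> s = map (\<lambda>j. (x, j, 0)) [0..<k + 2]"
  then obtain x k where k: "sepx k x" and s: "s = map (\<lambda>j. (x, j, 0)) [0..<k + 2]" by blast
  have x: "x \<in> X" using X k by (auto simp: full_def)
  have nth: "s ! i = (x, i, 0)" if "i < k + 2" for i using that by (simp add: s del: upt_Suc)
  have len: "length s = k + 2" by (simp add: s)
  show "isblk (Pts X) s"
    unfolding isblk_def
  proof (intro conjI allI impI notI)
    show "2 \<le> length s" by (simp add: len)
    show "adj (Pts X) (s ! i) (s ! Suc i)" if "Suc i < length s" for i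
      using adj_block[OF k x, of i] that by (simp add: nth len)
    show False if "adj (Pts X) r (s ! 0)" for r
    proof -
      obtain y i h where r: "r = (y, i, h)" by (cases r)
      have "y = x" using adj_same_index[OF X] that by (simp add: nth r)
      then show False using that k by (auto simp: adj_def nth r point_less_iff Pts_sep)
    qed
    show False if "adj (Pts X) (s ! (length s - 1)) r" for r
      using adj_block_succ[OF X k, of "k + 1" 0 r] that by (simp add: nth len)
  qed
qed


lemma block_mem: "full X \<Longrightarrow> sepx k x \<Longrightarrow> set (map (\<lambda>j. (x, j, 0)) [0..<k + 2]) \<subseteq> Pts X"
  by (auto simp: full_def Pts_sep)

text \<open>The indices of two points \<open>p < q\<close> are compared through the sizes of the blocks between \<open>p\<close> and \<open>q\<close>.\<close>

lemma same_index_iff: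
  assumes X: "full X" and p: "p \<in> Pts X" and q: "q \<in> Pts X" and pq: "p < q"
  shows "fst p = fst q \<longleftrightarrow> \<not> (\<exists>s. isblk (Pts X) s \<and> (\<forall>r\<in>set s. p < r \<and> r < q))"
    and "fst p \<noteq> fst q \<Longrightarrow> agr (fst p) (fst q) i \<longleftrightarrow>
      (\<forall>s. isblk (Pts X) s \<longrightarrow> (\<forall>r\<in>set s. p < r \<and> r < q) \<longrightarrow> i + 2 \<le> length s)"
proof -
  obtain x j f y l g where e: "p = (x, j, f)" "q = (y, l, g)" by (cases p; cases q)
  have I: "x \<in> Idx" "y \<in> Idx" using p q X by (auto simp: e Pts_iff full_def)
  have le: "x \<le> y" using pq by (auto simp: e)
  \<comment> \<open>The case z = y occurs: the block of \<open>y\<close> lies below \<open>q\<close>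
    when \<open>q\<close> is in its gadget. The block of \<open>x\<close> is excluded, since its
    first point is not above \<open>p\<close>.\<close>
  have blk: "x < z \<and> z \<le> y" if z: "sepx k z" "\<forall>r\<in>set (map (\<lambda>j. (z, j, 0)) [0..<k + 2]). p < r \<and> r < q" for z k
  proof -
    have r: "(x, j, f) < (z, m, 0) \<and> (z, m, 0) < (y, l, g)" if "m < k + 2" for m
      using z(2) that by (simp add: e del: upt_Suc less_prod_simp)
    have "x \<noteq> z"
    proof
      assume "x = z"
      then have "j < k + 2 \<and> f = 0 \<or> j = k + 2" using p z(1) by (auto simp: e Pts_sep)
      then show False
      proof
        assume "j < k + 2 \<and> f = 0"
        then show False using r[of 0] \<open>x = z\<close> by (auto simp: point_less_iff simp del: less_prod_simp)
      next
        assume "j = k + 2"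
        then show False using r[of 0] \<open>x = z\<close> by (auto simp: point_less_iff simp del: less_prod_simp)
      qed
    qed
    then show ?thesis using r[of 0] by (auto simp: point_less_iff simp del: less_prod_simp)
  qed
  have neq: "\<exists>k z. agr x y k \<and> Poly_Mapping.lookup x k \<noteq> Poly_Mapping.lookup y k \<and> sepx k z \<and> x < z \<and> z < y" if xy: "x \<noteq> y"
  proof -
    have lt: "x < y" using le xy by simp
    obtain k where k: "agr x y k" "Poly_Mapping.lookup x k \<noteq> Poly_Mapping.lookup y k"
      using xy by (rule first_difference)
    obtain z where "sepx k z" "x < z" "z < y" using ex_sep_between[OF I lt k] .
    then show ?thesis using k by blast
  qed
  have inside: "isblk (Pts X) (map (\<lambda>j. (z, j, 0)) [0..<k + 2])"
    "\<forall>r\<in>set (map (\<lambda>j. (z, j, 0)) [0..<k + 2]). p < r \<and> r < q" if "sepx k z" "x < z" "z < y" for k z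
    using that unfolding isblk_iff[OF X] by (blast, auto simp: e)
  show "fst p = fst q \<longleftrightarrow> \<not> (\<exists>s. isblk (Pts X) s \<and> (\<forall>r\<in>set s. p < r \<and> r < q))"
  proof
    assume "fst p = fst q"
    then have "x = y" by (simp add: e)
    then show "\<not> (\<exists>s. isblk (Pts X) s \<and> (\<forall>r\<in>set s. p < r \<and> r < q))"
      using blk unfolding isblk_iff[OF X] by fastforce
  next
    assume none: "\<not> (\<exists>s. isblk (Pts X) s \<and> (\<forall>r\<in>set s. p < r \<and> r < q))"
    show "fst p = fst q"
    proof (rule ccontr)
      assume "fst p \<noteq> fst q"
      then obtain k z where "sepx k z" "x < z" "z < y" using neq by (auto simp: e)
      then show False using inside none by blast
    qed
  qed
  assume "fst p \<noteq> fst q"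
  then have xy: "x \<noteq> y" by (simp add: e)
  show "agr (fst p) (fst q) i \<longleftrightarrow>
      (\<forall>s. isblk (Pts X) s \<longrightarrow> (\<forall>r\<in>set s. p < r \<and> r < q) \<longrightarrow> i + 2 \<le> length s)"
  proof
    assume a: "agr (fst p) (fst q) i"
    show "\<forall>s. isblk (Pts X) s \<longrightarrow> (\<forall>r\<in>set s. p < r \<and> r < q) \<longrightarrow> i + 2 \<le> length s"
    proof (intro allI impI)
      fix s assume s: "isblk (Pts X) s" "\<forall>r\<in>set s. p < r \<and> r < q"
      obtain z k where z: "sepx k z" "s = map (\<lambda>j. (z, j, 0)) [0..<k + 2]" using s(1) isblk_iff[OF X] by blast
      have "x < z \<and> z \<le> y" using blk[OF z(1)] s(2) z(2) by simp
      moreover have "agr x y i" using a by (simp add: e)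
      ultimately have "i \<le> k" using sep_between_level[OF I(1) _ _ z(1)] by blast
      then show "i + 2 \<le> length s" by (simp add: z(2))
    qed
  next
    assume A: "\<forall>s. isblk (Pts X) s \<longrightarrow> (\<forall>r\<in>set s. p < r \<and> r < q) \<longrightarrow> i + 2 \<le> length s"
    obtain k z where k: "agr x y k" "sepx k z" "x < z" "z < y" using neq[OF xy] by blast
    have "i + 2 \<le> length (map (\<lambda>j. (z, j, 0 :: zpow)) [0..<k + 2])" using A inside[OF k(2-4)] by blast
    then have "i \<le> k" by simp
    then show "agr (fst p) (fst q) i" using agr_mono[OF k(1)] by (simp add: e)
  qed
qed

text \<open>Level 3 is one round to name the block plus the two levels that \<open>bf_isblk\<close>
  spends on certifying it.\<close>

lemma bf_block_between:
  assumes bf: "bf (M X) (M Y) (lev 3) [p, q] [p', q']" and sub: "{p, q} \<subseteq> Pts X" "{p', q'} \<subseteq> Pts Y"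
    and X: "full X" and s: "isblk (Pts X) s" "\<forall>r\<in>set s. p < r \<and> r < q"
  shows "\<exists>t. isblk (Pts Y) t \<and> length t = length s \<and> (\<forall>r\<in>set t. p' < r \<and> r < q')"
proof -
  have sX: "set s \<subseteq> Pts X" using s(1) block_mem[OF X] unfolding isblk_iff[OF X] by blast
  have bf': "bf (M X) (M Y) (lev (Suc (Suc (Suc 0)))) [p, q] [p', q']" using bf by (simp add: numeral_3_eq_3)
  obtain t where t: "isblk (Pts Y) t" "set t \<subseteq> Pts Y" "length t = length s"
    "bf (M X) (M Y) (lev (Suc (Suc 0))) ([p, q] @ s) ([p', q'] @ t)"
    using bf_add_block[OF bf' _ _ s(1) sX] sub by auto
  have "p' < r \<and> r < q'" if r: "r \<in> set t" for r
  proof -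
    obtain i where i: "i < length t" "r = t ! i" using r by (auto simp: in_set_conv_nth)
    have L: "([p, q] @ s) ! k < ([p, q] @ s) ! l \<longleftrightarrow> ([p', q'] @ t) ! k < ([p', q'] @ t) ! l"
      if "k < length s + 2" "l < length s + 2" for k l
      by (rule bf_less[OF t(4)]) (use sub sX t(2) that in auto)
    have "p < s ! i \<and> s ! i < q" using s(2) i(1) t(3) by simp
    then show ?thesis using L[of 0 "i + 2"] L[of "i + 2" 1] i t(3) by simp
  qed
  then show ?thesis using t by blast
qed

lemma bf_index_less:
  assumes bf: "bf (M X) (M Y) (lev 3) [p, q] [p', q']" and sub: "{p, q} \<subseteq> Pts X" "{p', q'} \<subseteq> Pts Y"
    and X: "full X" and Y: "full Y" and pq: "p < q"
  shows "p' < q'" "fst p = fst q \<longleftrightarrow> fst p' = fst q'" "agr (fst p) (fst q) i \<longleftrightarrow> agr (fst p') (fst q') i"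
proof -
  show pq': "p' < q'" using bf_less[OF bf, of 0 1] sub pq by simp
  have XY: "\<exists>t. isblk (Pts Y) t \<and> length t = length s \<and> (\<forall>r\<in>set t. p' < r \<and> r < q')"
    if "isblk (Pts X) s" "\<forall>r\<in>set s. p < r \<and> r < q" for s
    by (rule bf_block_between[OF bf sub X that])
  have YX: "\<exists>s. isblk (Pts X) s \<and> length s = length t \<and> (\<forall>r\<in>set s. p < r \<and> r < q)"
    if "isblk (Pts Y) t" "\<forall>r\<in>set t. p' < r \<and> r < q'" for t
    by (rule bf_block_between[OF bf_sym[OF bf] sub(2,1) Y that])
  have mem: "p \<in> Pts X" "q \<in> Pts X" "p' \<in> Pts Y" "q' \<in> Pts Y" using sub by auto
  show E: "fst p = fst q \<longleftrightarrow> fst p' = fst q'"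
    unfolding same_index_iff(1)[OF X mem(1,2) pq] same_index_iff(1)[OF Y mem(3,4) pq'] using XY YX by blast
  show "agr (fst p) (fst q) i \<longleftrightarrow> agr (fst p') (fst q') i"
  proof (cases "fst p = fst q")
    case True
    then show ?thesis using E by simp
  next
    case False
    then have F: "fst p' \<noteq> fst q'" using E by simp
    show ?thesis
      unfolding same_index_iff(2)[OF X mem(1,2) pq False] same_index_iff(2)[OF Y mem(3,4) pq' F]
    proof (intro iffI allI impI)
      fix t assume A: "\<forall>s. isblk (Pts X) s \<longrightarrow> (\<forall>r\<in>set s. p < r \<and> r < q) \<longrightarrow> i + 2 \<le> length s"
        and t: "isblk (Pts Y) t" "\<forall>r\<in>set t. p' < r \<and> r < q'"
      obtain s where s: "isblk (Pts X) s" "length s = length t" "\<forall>r\<in>set s. p < r \<and> r < q" using YX[OF t] by blast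
      have "i + 2 \<le> length s" using A s(1,3) by blast
      then show "i + 2 \<le> length t" using s(2) by simp
    next
      fix s assume A: "\<forall>t. isblk (Pts Y) t \<longrightarrow> (\<forall>r\<in>set t. p' < r \<and> r < q') \<longrightarrow> i + 2 \<le> length t"
        and s: "isblk (Pts X) s" "\<forall>r\<in>set s. p < r \<and> r < q"
      obtain t where t: "isblk (Pts Y) t" "length t = length s" "\<forall>r\<in>set t. p' < r \<and> r < q'" using XY[OF s] by blast
      have "i + 2 \<le> length t" using A t(1,3) by blast
      then show "i + 2 \<le> length s" using t(2) by simp
    qed
  qed
qed

lemma bf_pair:
  assumes "bf A B \<alpha> ps qs" "i < length ps" "j < length ps"
  shows "bf A B \<alpha> [ps ! i, ps ! j] [qs ! i, qs ! j]"
  using bf_reindex[OF assms(1), of "[i, j]"] assms(2,3) by simp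

lemma bf_index:
  assumes bf: "bf (M X) (M Y) (lev 3) ps qs" and sub: "set ps \<subseteq> Pts X" "set qs \<subseteq> Pts Y"
    and X: "full X" and Y: "full Y" and ij: "i < length ps" "j < length ps"
  shows "fst (ps ! i) = fst (ps ! j) \<longleftrightarrow> fst (qs ! i) = fst (qs ! j)"
    "fst (ps ! i) < fst (ps ! j) \<longleftrightarrow> fst (qs ! i) < fst (qs ! j)"
    "agr (fst (ps ! i)) (fst (ps ! j)) k \<longleftrightarrow> agr (fst (qs ! i)) (fst (qs ! j)) k"
proof -
  have len: "length ps = length qs" using bf_length[OF bf] .
  have sub': "{ps ! i, ps ! j} \<subseteq> Pts X" "{qs ! i, qs ! j} \<subseteq> Pts Y" "{ps ! j, ps ! i} \<subseteq> Pts X" "{qs ! j, qs ! i} \<subseteq> Pts Y"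
    using sub ij len by auto
  have lt: "ps ! i < ps ! j \<longleftrightarrow> qs ! i < qs ! j" "ps ! j < ps ! i \<longleftrightarrow> qs ! j < qs ! i"
    using bf_less[OF bf sub] ij by blast+
  have "(fst (ps ! i) = fst (ps ! j) \<longleftrightarrow> fst (qs ! i) = fst (qs ! j)) \<and>
    (fst (ps ! i) < fst (ps ! j) \<longleftrightarrow> fst (qs ! i) < fst (qs ! j)) \<and>
    (agr (fst (ps ! i)) (fst (ps ! j)) k \<longleftrightarrow> agr (fst (qs ! i)) (fst (qs ! j)) k)"
  proof (cases "ps ! i" "ps ! j" rule: linorder_cases)
    case less
    note I = bf_index_less[OF bf_pair[OF bf ij] sub'(1,2) X Y less]
    have "fst (ps ! i) < fst (ps ! j) \<longleftrightarrow> fst (ps ! i) \<noteq> fst (ps ! j)" "fst (qs ! i) < fst (qs ! j) \<longleftrightarrow> fst (qs ! i) \<noteq> fst (qs ! j)"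
      using less I(1) by (auto simp: less_prod_def)
    then show ?thesis using I by blast
  next
    case equal
    then have "qs ! i = qs ! j" using lt by auto
    then show ?thesis using equal by simp
  next
    case greater
    note I = bf_index_less[OF bf_pair[OF bf ij(2,1)] sub'(3,4) X Y greater]
    have "\<not> fst (ps ! i) < fst (ps ! j)" "\<not> fst (qs ! i) < fst (qs ! j)"
      using greater I(1) by (auto simp: less_prod_def)
    moreover have "agr (fst (ps ! i)) (fst (ps ! j)) k \<longleftrightarrow> agr (fst (qs ! i)) (fst (qs ! j)) k"
      using I(3)[of k] agr_sym by blast
    ultimately show ?thesis using I(2) by metis
  qed
  then show "fst (ps ! i) = fst (ps ! j) \<longleftrightarrow> fst (qs ! i) = fst (qs ! j)"
    "fst (ps ! i) < fst (ps ! j) \<longleftrightarrow> fst (qs ! i) < fst (qs ! j)"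
    "agr (fst (ps ! i)) (fst (ps ! j)) k \<longleftrightarrow> agr (fst (qs ! i)) (fst (qs ! j)) k" by blast+
qed

section \<open>Recognising leaves, tree levels and positions\<close>

definition in_block :: "idx set \<Rightarrow> nat \<Rightarrow> nat \<Rightarrow> point \<Rightarrow> bool" where
  "in_block X n j p \<longleftrightarrow> (\<exists>s. isblk (Pts X) s \<and> length s = n \<and> j < n \<and> s ! j = p)"

lemma in_block_iff:
  assumes "full X"
  shows "in_block X n j p \<longleftrightarrow> (\<exists>k. sepx k (fst p) \<and> n = k + 2 \<and> j < n \<and> p = (fst p, j, 0))"
proof
  assume "in_block X n j p"
  then obtain s where s: "isblk (Pts X) s" "length s = n" "j < n" "s ! j = p" by (auto simp: in_block_def)
  then obtain x k where "sepx k x" "s = map (\<lambda>j. (x, j, 0)) [0..<k + 2]" using isblk_iff[OF assms] by blast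
  with s show "\<exists>k. sepx k (fst p) \<and> n = k + 2 \<and> j < n \<and> p = (fst p, j, 0)"
    by (intro exI[of _ k]) (auto simp del: upt_Suc)
next
  assume "\<exists>k. sepx k (fst p) \<and> n = k + 2 \<and> j < n \<and> p = (fst p, j, 0)"
  then obtain k where k: "sepx k (fst p)" "n = k + 2" "j < n" "p = (fst p, j, 0)" by blast
  have "isblk (Pts X) (map (\<lambda>j. (fst p, j, 0)) [0..<k + 2])" using isblk_iff[OF assms] k(1) by blast
  moreover have "map (\<lambda>j. (fst p, j, 0)) [0..<k + 2] ! j = p" using k(2-4) by (simp del: upt_Suc)
  ultimately show "in_block X n j p" unfolding in_block_def using k(2,3)
    by (intro exI[of _ "map (\<lambda>j. (fst p, j, 0)) [0..<k + 2]"]) simp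
qed

lemma bf_in_block:
  assumes bf: "bf (M X) (M Y) (lev 3) [p] [p']" and mem: "p \<in> Pts X" "p' \<in> Pts Y"
    and X: "full X" and blk: "in_block X n j p"
  shows "in_block Y n j p'"
proof -
  obtain s where s: "isblk (Pts X) s" "length s = n" "j < n" "s ! j = p" using blk by (auto simp: in_block_def)
  have sX: "set s \<subseteq> Pts X" using s(1) block_mem[OF X] unfolding isblk_iff[OF X] by blast
  have bf': "bf (M X) (M Y) (lev (Suc (Suc (Suc 0)))) [p] [p']" using bf by (simp add: numeral_3_eq_3)
  obtain t where t: "isblk (Pts Y) t" "set t \<subseteq> Pts Y" "length t = length s"
    "bf (M X) (M Y) (lev (Suc (Suc 0))) ([p] @ s) ([p'] @ t)"
    using bf_add_block[OF bf' _ _ s(1) sX] mem by auto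
  have "([p] @ s) ! 0 = ([p] @ s) ! Suc j \<longleftrightarrow> ([p'] @ t) ! 0 = ([p'] @ t) ! Suc j"
    using bf_atomic[OF t(4)] s(2,3) unfolding atomic_eq_def by (metis append_Cons length_Cons Suc_mono zero_less_Suc append_Nil)
  then have "t ! j = p'" using s(4) by simp
  then show ?thesis using t s unfolding in_block_def by blast
qed

text \<open>Points of a gadget have predecessors and points of a block lie in a block; a leaf has
  neither property.\<close>

lemma leaf_iff:
  assumes X: "full X" and p: "p \<in> Pts X"
  shows "leaf (fst p) \<longleftrightarrow> \<not> (\<exists>r. adj (Pts X) r p) \<and> \<not> (\<exists>n j. in_block X n j p)"
proof -
  obtain x j f where e: "p = (x, j, f)" by (cases p)
  show ?thesis
  proof (cases "leaf x")
    case True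
    then show ?thesis using leaf_not_adj(2)[OF X True] leaf_not_sepx by (auto simp: e in_block_iff[OF X])
  next
    case False
    then obtain k where k: "sepx k x" using p by (auto simp: e Pts_iff)
    show ?thesis
    proof (cases "j = k + 2")
      case True
      then show ?thesis using adj_gadget[OF k] p False by (auto simp: e)
    next
      case F: False
      then have "j < k + 2" "f = 0" using p k by (auto simp: e Pts_sep)
      then have "in_block X (k + 2) j p" using k by (simp add: in_block_iff[OF X] e)
      then show ?thesis using False by (auto simp: e)
    qed
  qed
qed

lemma bf_leaf:
  assumes bf: "bf (M X) (M Y) (lev 3) [p] [p']" and mem: "p \<in> Pts X" "p' \<in> Pts Y"
    and X: "full X" and Y: "full Y"
  shows "leaf (fst p) \<longleftrightarrow> leaf (fst p')"
proof -
  have bf': "bf (M X) (M Y) (lev (Suc (Suc 0))) [p] [p']"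
    by (rule bf_mono[OF bf lev_mono]) simp
  have "(\<exists>r. adj (Pts X) r p) \<longleftrightarrow> (\<exists>r. adj (Pts Y) r p')"
    using bf_has_adj(2)[OF bf', of 0] bf_has_adj(2)[OF bf_sym[OF bf'], of 0] mem by auto
  moreover have "in_block X n j p \<longleftrightarrow> in_block Y n j p'" for n j
    using bf_in_block[OF bf mem X] bf_in_block[OF bf_sym[OF bf] mem(2,1) Y] by blast
  ultimately show ?thesis unfolding leaf_iff[OF X mem(1)] leaf_iff[OF Y mem(2)] by simp
qed

text \<open>A block point gives away its tree level by the length of its block. For a gadget point,
  one round names the block with the same index, and level 3 then confirms that the indices agree on
  the other side; hence level 4.\<close>

lemma bf_kind:
  assumes bf: "bf (M X) (M Y) (lev 4) [p] [p']" and mem: "p \<in> Pts X" "p' \<in> Pts Y"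
    and X: "full X" and Y: "full Y" and k: "sepx k (fst p)"
  shows "sepx k (fst p') \<and> fst (snd p') = fst (snd p)"
proof -
  have bf3: "bf (M X) (M Y) (lev 3) [p] [p']" by (rule bf_mono[OF bf lev_mono]) simp
  have blk: "in_block X n j p \<longleftrightarrow> in_block Y n j p'" for n j
    using bf_in_block[OF bf3 mem X] bf_in_block[OF bf_sym[OF bf3] mem(2,1) Y] by blast
  obtain x j f where e: "p = (x, j, f)" by (cases p)
  obtain x' j' f' where e': "p' = (x', j', f')" by (cases p')
  have kx: "sepx k x" using k by (simp add: e)
  show ?thesis
  proof (cases "j = k + 2")
    case False
    then have "in_block X (k + 2) j p" using mem(1) kx by (auto simp: in_block_iff[OF X] e Pts_sep)
    then have "in_block Y (k + 2) j p'" using blk by simp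
    then show ?thesis by (auto simp: in_block_iff[OF Y] e e')
  next
    case True
    have nb: "\<not> in_block Y n i p'" for n i
      using blk[of n i] True kx sepx_unique by (auto simp: in_block_iff[OF X] e)
    let ?s = "map (\<lambda>j. (x, j, 0 :: zpow)) [0..<k + 2]"
    have s: "isblk (Pts X) ?s" "set ?s \<subseteq> Pts X" using isblk_iff[OF X] kx block_mem[OF X kx] by blast+
    have bf': "bf (M X) (M Y) (lev (Suc (Suc (Suc (Suc 0))))) [p] [p']" using bf by (simp add: eval_nat_numeral)
    obtain t where t: "isblk (Pts Y) t" "set t \<subseteq> Pts Y" "length t = length ?s"
      "bf (M X) (M Y) (lev (Suc (Suc (Suc 0)))) ([p] @ ?s) ([p'] @ t)"
      using bf_add_block[OF bf' _ _ s] mem by auto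
    obtain y l where y: "sepx l y" "t = map (\<lambda>j. (y, j, 0)) [0..<l + 2]" using t(1) isblk_iff[OF Y] by blast
    then have lk: "l = k" using t(3) by simp
    have "fst (([p] @ ?s) ! 0) = fst (([p] @ ?s) ! 1) \<longleftrightarrow> fst (([p'] @ t) ! 0) = fst (([p'] @ t) ! 1)"
      by (rule bf_index(1)[OF _ _ _ X Y]) (use t(2,4) s(2) mem in \<open>simp_all add: numeral_3_eq_3\<close>)
    moreover have "?s ! 0 = (x, 0, 0)" "t ! 0 = (y, 0, 0)" by (simp_all add: y(2) del: upt_Suc)
    ultimately have "x' = y" by (simp add: e e' del: upt_Suc)
    then have kx': "sepx k x'" using y(1) lk by simp
    then have "j' = k + 2" using nb mem(2) by (auto simp: in_block_iff[OF Y] e' Pts_sep)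
    then show ?thesis using True kx' by (simp add: e e')
  qed
qed

end

section \<open>Recognising differences in gadgets\<close>

lemma ge_add:
  assumes "ge \<delta> i p" "ge \<delta> j q" "0 < i" "0 < j"
  shows "ge \<delta> (i + j) (p + q)"
proof -
  have "0 < p" "0 < q" using assms ge_zero by (auto simp: ge_def less_le)
  then obtain \<epsilon> a \<eta> c where t: "lead p \<epsilon> a" "lead q \<eta> c" using zpow_pos_iff by blast
  show ?thesis
    using assms ge_lead[OF t(1), of \<delta> i] ge_lead[OF t(2), of \<delta> j] unfolding ge_lead[OF lead_add[OF t]]
    by (cases \<epsilon> \<eta> rule: linorder_cases) auto
qed

lemma ge_chain:
  assumes "\<And>i. i < n \<Longrightarrow> ge \<delta> 1 (u (Suc i) - u i)" "0 < n"
  shows "ge \<delta> (int n) (u n - u 0)"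
  using assms
proof (induction n)
  case (Suc n)
  show ?case
  proof (cases "n = 0")
    case True
    then show ?thesis using Suc.prems(1)[of 0] by simp
  next
    case False
    then have "ge \<delta> (int n + 1) ((u n - u 0) + (u (Suc n) - u n))"
      using Suc by (intro ge_add) auto
    then show ?thesis by (simp add: add.commute)
  qed
qed simp

lemma mon_simps: "mon \<delta> 0 = 0" "mon \<delta> a - mon \<delta> c = mon \<delta> (a - c)"
  by (rule zpow_eqI; simp)+

text \<open>All steps but the last are exactly one unit at \<delta>; the last takes the rest, which
  is still at least a unit.\<close>

lemma ex_chain:
  assumes d: "ge \<delta> (int n) d" and n: "0 < n"
  obtains u where "u 0 = 0" "u n = d" "\<And>i. i < n \<Longrightarrow> u i = mon \<delta> (int i)"
    "\<And>i. i < n \<Longrightarrow> ge \<delta> 1 (u (Suc i) - u i)"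
proof -
  define u where "u i = (if i < n then mon \<delta> (int i) else d)" for i
  have "0 \<le> d" using d by (simp add: ge_def)
  moreover have "d \<noteq> 0" using d n by (auto simp: ge_zero)
  ultimately have "0 < d" by simp
  then obtain \<epsilon> a where t: "lead d \<epsilon> a" using zpow_pos_iff by blast
  have dt: "\<delta> < \<epsilon> \<or> \<delta> = \<epsilon> \<and> int n \<le> a" using d n ge_lead[OF t, of \<delta> "int n"] by auto
  have one: "ge \<delta> 1 (mon \<delta> 1)" using ge_lead[OF lead_mon[of 1 \<delta>]] by simp
  have "ge \<delta> 1 (u (Suc i) - u i)" if "i < n" for i
  proof (cases "Suc i < n")
    case True
    then show ?thesis using one by (simp add: u_def mon_simps)
  next
    case False
    then have ui: "u (Suc i) - u i = d - mon \<delta> (int i)" using that by (simp add: u_def)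
    show ?thesis
    proof (cases "i = 0")
      case True
      then show ?thesis using dt n ui ge_lead[OF t] by (auto simp: mon_simps)
    next
      case i: False
      have "lead (d - mon \<delta> (int i)) \<epsilon> (if \<delta> = \<epsilon> then a - int i else a)"
        using dt i that by (intro lead_diff_mon[OF t]) auto
      from ge_lead[OF this, of \<delta> 1] show ?thesis using dt that ui by auto
    qed
  qed
  moreover have "u 0 = 0" "u n = d" using n by (simp_all add: u_def mon_simps)
  ultimately show thesis using that[of u] by (simp add: u_def)
qed

context tower
begin

definition preserves :: "cord \<Rightarrow> bool" where
  "preserves \<delta> \<longleftrightarrow> (\<forall>X Y x k f g x' k' f' g'. sepx k x \<longrightarrow> sepx k' x' \<longrightarrow>
    {(x, k + 2, f), (x, k + 2, g)} \<subseteq> Pts X \<longrightarrow> {(x', k' + 2, f'), (x', k' + 2, g')} \<subseteq> Pts Y \<longrightarrow> f < g \<longrightarrow>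
    bf (M X) (M Y) \<delta> [(x, k + 2, f), (x, k + 2, g)] [(x', k' + 2, f'), (x', k' + 2, g')] \<longrightarrow>
    ge \<delta> 1 (g - f) \<longrightarrow> ge \<delta> 1 (g' - f'))"

text \<open>A difference of at least \<open>n\<close> units at \<open>\<gamma>\<close> is witnessed by \<open>n - 1\<close> intermediate points.\<close>

lemma preserves_multiple:
  assumes pres: "preserves \<gamma>" and \<gamma>: "\<gamma> < \<delta>" and k: "sepx k x" "sepx k' x'"
    and mem: "{(x, k + 2, f), (x, k + 2, g)} \<subseteq> Pts X" "{(x', k' + 2, f'), (x', k' + 2, g')} \<subseteq> Pts Y"
    and bf: "bf (M X) (M Y) \<delta> [(x, k + 2, f), (x, k + 2, g)] [(x', k' + 2, f'), (x', k' + 2, g')]"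
    and n: "0 < n" and d: "ge \<gamma> (int n) (g - f)"
  shows "ge \<gamma> (int n) (g' - f')"
proof -
  obtain u where u: "u 0 = 0" "u n = g - f" "\<And>i. i < n \<Longrightarrow> u i = mon \<gamma> (int i)"
    "\<And>i. i < n \<Longrightarrow> ge \<gamma> 1 (u (Suc i) - u i)"
    using ex_chain[OF d n] by metis
  have pos: "u i < u (Suc i)" if "i < n" for i
    using u(4)[OF that] ge_zero[of \<gamma> 1] by (auto simp: ge_def less_le)
  have mono: "u i < u j" if "i < j" "j \<le> n" for i j
    using that
  proof (induction j)
    case (Suc j)
    then show ?case using pos[of j] by (cases "i = j") (auto intro: less_trans)
  qed simp
  have "0 < g - f" using mono[of 0 n] u n by simp
  then obtain \<epsilon> a where t: "lead (g - f) \<epsilon> a" using zpow_pos_iff by blast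
  have supp: "supp_below (e k x) f" "supp_below (e k x) g" using mem(1) k(1) by (auto simp: Pts_sep)
  have "\<gamma> \<le> \<epsilon>" using d n ge_lead[OF t, of \<gamma> "int n"] by auto
  also have "\<epsilon> < e k x" using lead_supp_below[OF t] supp by simp
  finally have \<gamma>e: "\<gamma> < e k x" .
  have xX: "x \<in> X" using mem(1) k(1) by (simp add: Pts_sep)
  define P where "P i = (x, k + 2, f + u i)" for i
  have PX: "P i \<in> Pts X" if "i \<le> n" for i
    using that u(2,3) supp \<gamma>e xX mem(1) k(1) by (cases "i = n") (auto simp: P_def Pts_sep)
  have P0n: "P 0 = (x, k + 2, f)" "P n = (x, k + 2, g)" by (simp_all add: P_def u)
  let ?cs = "map P [1..<n]"
  have "set ?cs \<subseteq> fst (M X)" using PX by auto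
  then obtain ds where ds: "length ds = length ?cs" "set ds \<subseteq> fst (M Y)"
    "bf (M X) (M Y) \<gamma> ([P 0, P n] @ ?cs) ([(x', k' + 2, f'), (x', k' + 2, g')] @ ds)"
    using bf_forth[OF bf \<gamma>] unfolding P0n by metis
  \<comment> \<open>The end points stand first in the list \<open>[P 0, P n] @ ?cs\<close>, so an
    inner point \<open>P i\<close> sits at place \<open>Suc i\<close>.\<close>
  define slot where "slot i = (if i = 0 then 0 else if i = n then 1 else Suc i)" for i
  define Q where "Q i = ([(x', k' + 2, f'), (x', k' + 2, g')] @ ds) ! slot i" for i
  have len: "length ds = n - 1" using ds(1) by simp
  have slot_less: "slot i < n + 1" if "i \<le> n" for i using that n by (auto simp: slot_def)
  have P_nth: "([P 0, P n] @ ?cs) ! slot i = P i" if "i \<le> n" for i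
    using that n by (auto simp: slot_def nth_append simp del: upt_Suc)
  have QY: "Q i \<in> Pts Y" if "i \<le> n" for i
  proof -
    have "set ([(x', k' + 2, f'), (x', k' + 2, g')] @ ds) \<subseteq> Pts Y" using mem(2) ds(2) by auto
    moreover have "Q i \<in> set ([(x', k' + 2, f'), (x', k' + 2, g')] @ ds)"
      unfolding Q_def by (rule nth_mem) (use slot_less[OF that] len n in simp)
    ultimately show ?thesis by blast
  qed
  have Q0n: "Q 0 = (x', k' + 2, f')" "Q n = (x', k' + 2, g')" using n by (simp_all add: Q_def slot_def)
  have sub: "set ([P 0, P n] @ ?cs) \<subseteq> Pts X" using PX by auto
  have subY: "set ([(x', k' + 2, f'), (x', k' + 2, g')] @ ds) \<subseteq> Pts Y" using mem(2) ds(2) by auto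
  have less: "Q i < Q j" if "i < j" "j \<le> n" for i j
  proof -
    have "P i < P j" using mono[OF that] by (simp add: P_def point_less_iff)
    then show ?thesis
      using bf_less[OF ds(3) sub subY, of "slot i" "slot j"] slot_less[of i] slot_less[of j] that n
        P_nth[of i] P_nth[of j] by (simp add: Q_def)
  qed
  \<comment> \<open>Points between two points of one gadget lie in that gadget, as the order is
    lexicographic.\<close>
  have Q_form: "\<exists>h. Q i = (x', k' + 2, h)" if i: "i \<le> n" for i
  proof -
    consider "i = 0" | "i = n" | "0 < i" "i < n" using i by arith
    then show ?thesis
    proof cases
      case 3
      obtain y j h where y: "Q i = (y, j, h)" by (cases "Q i")
      have "(x', k' + 2, f') < (y, j, h)" "(y, j, h) < (x', k' + 2, g')"
        using less[of 0 i] less[of i n] 3 Q0n y by auto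
      then show ?thesis unfolding point_less_iff y by auto
    qed (use Q0n in auto)
  qed
  define h where "h i = snd (snd (Q i))" for i
  have Qh: "Q i = (x', k' + 2, h i)" if "i \<le> n" for i using Q_form[OF that] by (auto simp: h_def)
  have "ge \<gamma> 1 (h (Suc i) - h i)" if i: "i < n" for i
  proof -
    have "bf (M X) (M Y) \<gamma> [P i, P (Suc i)] [Q i, Q (Suc i)]"
      using bf_pair[OF ds(3), of "slot i" "slot (Suc i)"] slot_less[of i] slot_less[of "Suc i"] i n
        P_nth[of i] P_nth[of "Suc i"] by (simp add: Q_def)
    moreover have "{P i, P (Suc i)} \<subseteq> Pts X" "{Q i, Q (Suc i)} \<subseteq> Pts Y" using PX QY i by auto
    moreover have "ge \<gamma> 1 ((f + u (Suc i)) - (f + u i))" "f + u i < f + u (Suc i)" using u(4)[OF i] pos[OF i] by simp_all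
    ultimately show ?thesis
      using pres k i unfolding preserves_def P_def
      by (metis Qh Suc_leI less_imp_le)
  qed
  then have "ge \<gamma> (int n) (h n - h 0)" using n by (rule ge_chain)
  moreover have "h n = g'" "h 0 = f'" using Q0n by (simp_all add: h_def)
  ultimately show ?thesis by simp
qed

text \<open>Suppose the image difference has leading coefficient a at an exponent \<gamma> <
  \<delta>. The original difference has at least a + 1 units at \<gamma>, and level \<delta> >
  \<gamma> transfers this count, which is one too many.\<close>

lemma preserves_all: "preserves \<delta>"
proof (induction \<delta> rule: less_induct)
  case (less \<delta>)
  show ?case
    unfolding preserves_def
  proof (intro allI impI)
    fix X Y x k f g x' k' f' g'
    assume k: "sepx k x" "sepx k' x'"
      and mem: "{(x, k + 2, f), (x, k + 2, g)} \<subseteq> Pts X" "{(x', k' + 2, f'), (x', k' + 2, g')} \<subseteq> Pts Y"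
      and fg: "f < g"
      and bf: "bf (M X) (M Y) \<delta> [(x, k + 2, f), (x, k + 2, g)] [(x', k' + 2, f'), (x', k' + 2, g')]"
      and d: "ge \<delta> 1 (g - f)"
    have "(x', k' + 2, f') < (x', k' + 2, g')"
      using bf_less[OF bf, of 0 1] mem fg by (simp add: point_less_iff)
    then have "0 < g' - f'" by (simp add: point_less_iff)
    then obtain \<gamma> a where t: "lead (g' - f') \<gamma> a" using zpow_pos_iff by blast
    then have a: "0 < a" by (simp add: lead_def)
    show "ge \<delta> 1 (g' - f')"
    proof (rule ccontr)
      assume "\<not> ge \<delta> 1 (g' - f')"
      then have \<gamma>: "\<gamma> < \<delta>" using ge_lead[OF t, of \<delta> 1] a by auto
      have "0 < g - f" using fg by simp
      then obtain \<epsilon> c where t0: "lead (g - f) \<epsilon> c" using zpow_pos_iff by blast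
      then have "\<delta> \<le> \<epsilon>" using d ge_lead[OF t0, of \<delta> 1] by auto
      then have "ge \<gamma> (int (nat (a + 1))) (g - f)" using \<gamma> ge_lead[OF t0] by auto
      then have "ge \<gamma> (int (nat (a + 1))) (g' - f')"
        using a by (intro preserves_multiple[OF less.IH[OF \<gamma>] \<gamma> k mem bf]) auto
      then show False using ge_lead[OF t, of \<gamma> "a + 1"] a by auto
    qed
  qed
qed

lemma bf_gadget_ge:
  assumes k: "sepx k x" "sepx k' x'"
    and mem: "{(x, k + 2, f), (x, k + 2, g)} \<subseteq> Pts X" "{(x', k' + 2, f'), (x', k' + 2, g')} \<subseteq> Pts Y"
    and bf: "bf (M X) (M Y) \<delta> [(x, k + 2, f), (x, k + 2, g)] [(x', k' + 2, f'), (x', k' + 2, g')]"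
    and fg: "f < g" and \<gamma>: "\<gamma> < \<delta>"
  shows "ge \<gamma> n (g - f) \<longleftrightarrow> ge \<gamma> n (g' - f')"
proof (cases "0 < n")
  case True
  then show ?thesis
    using preserves_multiple[OF preserves_all \<gamma> k mem bf, of "nat n"]
      preserves_multiple[OF preserves_all \<gamma> k(2,1) mem(2,1) bf_sym[OF bf], of "nat n"] by auto
next
  case False
  have "(x', k' + 2, f') < (x', k' + 2, g')"
    using bf_less[OF bf, of 0 1] mem fg by (simp add: point_less_iff)
  then have "0 < g' - f'" "0 < g - f" using fg by (simp_all add: point_less_iff)
  then show ?thesis using False ge_lead zpow_pos_iff by (metis not_less)
qed

text \<open>All leading exponents lie below \<delta>, so the counts recognised at level \<delta>
  already fix the leading term, and \<gamma> and N are arbitrary.\<close>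

lemma bf_gadget_eqv_less:
  assumes k: "sepx k x" "sepx k' x'"
    and mem: "{(x, k + 2, f), (x, k + 2, g)} \<subseteq> Pts X" "{(x', k' + 2, f'), (x', k' + 2, g')} \<subseteq> Pts Y"
    and bf: "bf (M X) (M Y) \<delta> [(x, k + 2, f), (x, k + 2, g)] [(x', k' + 2, f'), (x', k' + 2, g')]"
    and e: "e k x \<le> \<delta>" "e k' x' \<le> \<delta>" and fg: "f < g"
  shows "eqv \<gamma> N (g - f) (g' - f')"
proof -
  have "(x', k' + 2, f') < (x', k' + 2, g')"
    using bf_less[OF bf, of 0 1] mem fg by (simp add: point_less_iff)
  then have pos: "0 < g - f" "0 < g' - f'" using fg by (simp_all add: point_less_iff)
  then obtain \<epsilon> a \<epsilon>' a' where t: "lead (g - f) \<epsilon> a" "lead (g' - f') \<epsilon>' a'" using zpow_pos_iff by blast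
  have "supp_below (e k x) (g - f)" "supp_below (e k' x') (g' - f')" using mem k by (auto simp: Pts_sep)
  then have "\<epsilon> < \<delta>" "\<epsilon>' < \<delta>" using lead_supp_below t e less_le_trans by blast+
  then have "ge \<eta> n (g - f) \<longleftrightarrow> ge \<eta> n (g' - f')" for \<eta> n
    using bf_gadget_ge[OF k mem bf fg, of \<eta> n] ge_lead[OF t(1), of \<eta> n] ge_lead[OF t(2), of \<eta> n]
    by (cases "\<eta> < \<delta>") auto
  moreover have "\<not> ge \<eta> n (- (g - f))" "\<not> ge \<eta> n (- (g' - f'))" for \<eta> n
    using pos by (intro ge_neg; simp)+
  ultimately show ?thesis by (simp add: eqv_def)
qed

lemma bf_gadget_eqv:
  assumes k: "sepx k x" "sepx k' x'"
    and mem: "{(x, k + 2, f), (x, k + 2, g)} \<subseteq> Pts X" "{(x', k' + 2, f'), (x', k' + 2, g')} \<subseteq> Pts Y"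
    and bf: "bf (M X) (M Y) \<delta> [(x, k + 2, f), (x, k + 2, g)] [(x', k' + 2, f'), (x', k' + 2, g')]"
    and e: "e k x \<le> \<delta>" "e k' x' \<le> \<delta>"
  shows "eqv \<gamma> N (f - g) (f' - g')"
proof (cases f g rule: linorder_cases)
  case less
  then have "eqv \<gamma> N (- (f - g)) (- (f' - g'))" using bf_gadget_eqv_less[OF k mem bf e] by simp
  then show ?thesis by (simp only: eqv_minus)
next
  case equal
  then have "f' = g'" 
    using bf_atomic[OF bf, unfolded atomic_eq_def, THEN conjunct2, rule_format, of 0 1] by simp
  then show ?thesis using equal by (simp add: eqv_refl)
next
  case greater
  have b: "bf (M X) (M Y) \<delta> [(x, k + 2, g), (x, k + 2, f)] [(x', k' + 2, g'), (x', k' + 2, f')]"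
    using bf_pair[OF bf, of 1 0] by simp
  have m: "{(x, k + 2, g), (x, k + 2, f)} \<subseteq> Pts X" "{(x', k' + 2, g'), (x', k' + 2, f')} \<subseteq> Pts Y"
    using mem by auto
  show ?thesis by (rule bf_gadget_eqv_less[OF k m b e greater])
qed

end

section \<open>The Scott complexity of the order\<close>

context tower
begin

lemma full_Idx: "full Idx" and full_delete: "full (Idx - {0})"
proof -
  show "full Idx" by (auto simp: full_def Idx_def)
  have "\<not> sepx k 0" for k using leaf_not_sepx[OF leaf_0] .
  then show "full (Idx - {0})" by (auto simp: full_def Idx_def)
qed

definition root :: point where
  "root = (0, 0, 0)"

lemma root_mem: "root \<in> Pts Idx"
  using leaf_0 by (simp add: root_def Pts_leaf Idx_def)

lemma bf_single:
  assumes "bf A B \<alpha> ps qs" "i < length ps"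
  shows "bf A B \<alpha> [ps ! i] [qs ! i]"
  using bf_reindex[OF assms(1), of "[i]"] assms(2) by simp

text \<open>A tuple containing the root has only exponents determined by its labels, so bounded recognition
  suffices to extend the matching of indices to an automorphism.\<close>

lemma bf_root_stable:
  assumes P: "set P \<subseteq> Pts Idx" and Q: "set Q \<subseteq> Pts Idx" and P0: "P \<noteq> []" "P ! 0 = root" "Q ! 0 = root"
    and bf: "bf (M Idx) (M Idx) \<beta> P Q" and \<beta>: "lev 4 \<le> \<beta>"
    and lab: "\<And>p k. p \<in> set P \<Longrightarrow> sepx k (fst p) \<Longrightarrow> cord_succ (b k) \<le> \<beta>"
  shows "bf (M Idx) (M Idx) \<gamma> P Q"
proof -
  let ?n = "length P"
  have len: "length Q = ?n" using bf_length[OF bf] by simp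
  have bf4: "bf (M Idx) (M Idx) (lev 4) P Q" by (rule bf_mono[OF bf \<beta>])
  have "lev 3 \<le> lev 4" by (rule lev_mono) simp
  then have bf3: "bf (M Idx) (M Idx) (lev 3) P Q" by (rule bf_mono[OF bf4])
  have mem: "P ! i \<in> Pts Idx" "Q ! i \<in> Pts Idx" if "i < ?n" for i
    using P Q that len by (auto simp: subset_iff simp del: split_paired_All)
  note idx = bf_index[OF bf3 P Q full_Idx full_Idx]
  have kind: "(leaf (fst (P ! i)) \<longleftrightarrow> leaf (fst (Q ! i))) \<and> (\<forall>k. sepx k (fst (P ! i)) \<longleftrightarrow> sepx k (fst (Q ! i))) \<and>
    fst (snd (Q ! i)) = fst (snd (P ! i))" if i: "i < ?n" for i
  proof -
    note 3 = bf_single[OF bf3 i] and 4 = bf_single[OF bf4 i]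
    have l: "leaf (fst (P ! i)) \<longleftrightarrow> leaf (fst (Q ! i))" by (rule bf_leaf[OF 3 mem[OF i] full_Idx full_Idx])
    have s1: "sepx k (fst (Q ! i)) \<and> fst (snd (Q ! i)) = fst (snd (P ! i))" if "sepx k (fst (P ! i))" for k
      by (rule bf_kind[OF 4 mem[OF i] full_Idx full_Idx that])
    have s2: "sepx k (fst (P ! i))" if "sepx k (fst (Q ! i))" for k
      using bf_kind[OF bf_sym[OF 4] mem(2,1)[OF i] full_Idx full_Idx that] by blast
    have "fst (snd (Q ! i)) = fst (snd (P ! i))"
    proof (cases "leaf (fst (P ! i))")
      case True
      then show ?thesis using l mem[OF i] Pts_leaf
        by (cases "P ! i"; cases "Q ! i") auto
    next
      case False
      then obtain k where "sepx k (fst (P ! i))" using mem(1)[OF i] by (cases "P ! i") (auto simp: Pts_iff)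
      then show ?thesis using s1 by blast
    qed
    then show ?thesis using l s1 s2 by blast
  qed
  define F where "F = (\<lambda>i. (fst (P ! i), fst (Q ! i))) ` {..<?n}"
  have "good F"
  proof (rule goodI)
    show "finite F" by (simp add: F_def)
    show "x \<in> Idx \<and> x' \<in> Idx \<and> (leaf x \<longleftrightarrow> leaf x') \<and> (\<forall>k. sepx k x \<longleftrightarrow> sepx k x')" if x: "(x, x') \<in> F" for x x'
    proof -
      obtain i where i: "i < ?n" "x = fst (P ! i)" "x' = fst (Q ! i)" using x by (auto simp: F_def)
      have "x \<in> Idx" "x' \<in> Idx" using mem[OF i(1)] i(2,3) by (cases "P ! i"; cases "Q ! i"; simp add: Pts_iff)+
      then show ?thesis using kind[OF i(1)] i by blast
    qed
    show "(x < y \<longleftrightarrow> x' < y') \<and> (\<forall>i. agr x y i \<longleftrightarrow> agr x' y' i)" if "(x, x') \<in> F" "(y, y') \<in> F" for x x' y y'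
      using that idx(2,3) by (auto simp: F_def)
  qed
  moreover have "(0, 0) \<in> F" using P0 by (auto simp: F_def root_def intro!: image_eqI[of _ _ 0])
  ultimately obtain g where g: "iso_idx \<gamma> Idx Idx g" "\<And>x y. (x, y) \<in> F \<Longrightarrow> g x = y"
    using idx_automorphism by metis
  have gP: "g (fst (P ! i)) = fst (Q ! i)" if "i < ?n" for i using g(2) that by (auto simp: F_def)
  define s where "s i = (fst (P ! i), fst (snd (P ! i)), snd (snd (P ! i)), snd (snd (Q ! i)))" for i
  have ls: "lft (s i) = P ! i" for i by (simp add: s_def)
  have rs: "rgt g (s i) = Q ! i" if "i < ?n" for i
    using kind[OF that] gP[OF that] by (simp add: s_def prod_eq_iff)
  have "matched Idx Idx g \<gamma> 1 (map s [0..<?n])"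
  proof (rule matchedI)
    fix x j f f' assume "(x, j, f, f') \<in> set (map s [0..<?n])"
    then obtain i where i: "i < ?n" "s i = (x, j, f, f')" by auto
    have "(x, j, f) = P ! i" "(g x, j, f') = Q ! i" using ls[of i] rs[OF i(1)] by (simp_all add: i(2))
    then show "(x, j, f) \<in> Pts Idx \<and> (g x, j, f') \<in> Pts Idx" using mem[OF i(1)] by simp
  next
    fix x j f f' h h'
    assume "(x, j, f, f') \<in> set (map s [0..<?n])" "(x, j, h, h') \<in> set (map s [0..<?n])"
    then obtain i l where i: "i < ?n" "s i = (x, j, f, f')" and l: "l < ?n" "s l = (x, j, h, h')" by auto
    have Pi: "P ! i = (x, j, f)" "Q ! i = (g x, j, f')" using ls[of i] rs[OF i(1)] by (simp_all add: i(2))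
    have Pl: "P ! l = (x, j, h)" "Q ! l = (g x, j, h')" using ls[of l] rs[OF l(1)] by (simp_all add: l(2))
    note m = mem[OF i(1), unfolded Pi] mem[OF l(1), unfolded Pl]
    have kx: "(leaf x \<longleftrightarrow> leaf (g x)) \<and> (\<forall>k. sepx k x \<longleftrightarrow> sepx k (g x))" using kind[OF i(1)] by (simp add: Pi)
    show "eqv \<gamma> 1 (f - h) (f' - h')"
    proof (cases "\<exists>k. sepx k x \<and> j = k + 2")
      case True
      then obtain k where k: "sepx k x" "j = k + 2" by blast
      have "cord_succ (b k) \<le> \<beta>" using lab[OF nth_mem[OF i(1)]] k(1) by (simp add: Pi)
      \<comment> \<open>Both possible exponents at tree level k are at most
        \<open>cord_succ (b k)\<close>, so \<beta> decides all differences in these gadgets.\<close>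
      then have e: "e k x \<le> \<beta>" "e k (g x) \<le> \<beta>"
        using less_imp_le[OF less_cord_succ[of "b k"]] by (auto simp: e_def)
      have b: "bf (M Idx) (M Idx) \<beta> [(x, k + 2, f), (x, k + 2, h)] [(g x, k + 2, f'), (g x, k + 2, h')]"
        using bf_pair[OF bf i(1) l(1)] by (simp add: Pi Pl k(2))
      show ?thesis
        by (rule bf_gadget_eqv[OF k(1) _ _ _ b e]) (use kx k m in auto)
    next
      case False
      then have "f = 0" "h = 0" "f' = 0" "h' = 0" using m kx unfolding Pts_iff by blast+
      then show ?thesis by (simp add: eqv_refl)
    qed
  qed
  then have "bf (M Idx) (M Idx) \<gamma> (map lft (map s [0..<?n])) (map (rgt g) (map s [0..<?n]))"
    by (rule matched_bf[OF g(1) order_refl])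
  moreover have "map lft (map s [0..<?n]) = P" by (rule nth_equalityI) (simp_all add: ls)
  moreover have "map (rgt g) (map s [0..<?n]) = Q" by (rule nth_equalityI) (simp_all add: rs len)
  ultimately show ?thesis by simp
qed

text \<open>The bound \<beta> is computed from the tree levels of the points of \<open>cs\<close>.
  Agreement with \<open>cs\<close> at level 4 forces the same tree levels on \<open>ps\<close>, by
  \<open>bf_kind\<close>, so the bound fits \<open>ps\<close> as well.\<close>

lemma stable:
  assumes cs: "set cs \<subseteq> Pts Idx"
  shows "\<exists>\<beta><\<mu>. \<forall>ps qs. set ps \<subseteq> Pts Idx \<longrightarrow> set qs \<subseteq> Pts Idx \<longrightarrow>
    bf (M Idx) (M Idx) (lev 4) (root # cs) (root # ps) \<longrightarrow> bf (M Idx) (M Idx) \<beta> (root # ps) (root # qs) \<longrightarrow>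
    (\<forall>\<gamma><\<mu>. bf (M Idx) (M Idx) \<gamma> (root # ps) (root # qs))"
proof -
  define L where "L = (\<Union>p\<in>set cs. {k. sepx k (fst p)})"
  have "finite {k. sepx k x}" for x
  proof (cases "\<exists>k. sepx k x")
    case True
    then obtain k where "sepx k x" ..
    then have "{k. sepx k x} \<subseteq> {k}" using sepx_unique by blast
    then show ?thesis by (rule finite_subset) simp
  qed simp
  then have fin: "finite (insert (lev 4) ((\<lambda>k. cord_succ (b k)) ` L))" by (simp add: L_def)
  define \<beta> where "\<beta> = Max (insert (lev 4) ((\<lambda>k. cord_succ (b k)) ` L))"
  have "\<beta> \<in> insert (lev 4) ((\<lambda>k. cord_succ (b k)) ` L)" unfolding \<beta>_def by (rule Max_in[OF fin]) simp
  then have "\<beta> < \<mu>" using lev_less_limit[OF limit] limit_cord_succ[OF limit b_less] by auto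
  have le: "lev 4 \<le> \<beta>" "\<And>k. k \<in> L \<Longrightarrow> cord_succ (b k) \<le> \<beta>"
    unfolding \<beta>_def by (rule Max_ge[OF fin]; simp)+
  have "bf (M Idx) (M Idx) \<gamma> (root # ps) (root # qs)"
    if ps: "set ps \<subseteq> Pts Idx" and qs: "set qs \<subseteq> Pts Idx" and c: "bf (M Idx) (M Idx) (lev 4) (root # cs) (root # ps)"
      and bf: "bf (M Idx) (M Idx) \<beta> (root # ps) (root # qs)" for ps qs \<gamma>
  proof (rule bf_root_stable[OF _ _ _ _ _ bf le(1)])
    show "set (root # ps) \<subseteq> Pts Idx" "set (root # qs) \<subseteq> Pts Idx" using root_mem ps qs by auto
    show "cord_succ (b k) \<le> \<beta>" if p: "p \<in> set (root # ps)" "sepx k (fst p)" for p k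
    proof -
      have "p \<noteq> root" using p(2) leaf_0 leaf_not_sepx by (auto simp: root_def)
      then obtain i where i: "i < length ps" "p = ps ! i" using p(1) by (auto simp: in_set_conv_nth)
      have len: "length cs = length ps" using bf_length[OF c] by simp
      have "bf (M Idx) (M Idx) (lev 4) [cs ! i] [ps ! i]"
        using bf_single[OF c, of "Suc i"] i(1) len by simp
      moreover have "ps ! i \<in> Pts Idx" "cs ! i \<in> Pts Idx"
        using subsetD[OF ps nth_mem] subsetD[OF cs nth_mem] i(1) len by simp_all
      ultimately have "sepx k (fst (cs ! i))"
        using bf_kind[OF bf_sym, of Idx Idx "cs ! i" "ps ! i" k] full_Idx i(2) p(2) by blast
      then have "k \<in> L" using i(1) len by (auto simp: L_def)
      then show ?thesis by (rule le(2))
    qed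
  qed simp_all
  then show ?thesis using \<open>\<beta> < \<mu>\<close> by blast
qed

text \<open>The finitely many indices of \<open>ps\<close> differ from 0, so some \<open>K\<close>
  puts all of them outside the ball around 0. With \<open>K\<close> large enough for the exponents
  too, \<open>idx_delete_0\<close> removes 0 without moving \<open>ps\<close>.\<close>

lemma bf_delete:
  assumes ps: "set ps \<subseteq> Pts (Idx - {0})" and \<beta>: "\<beta> < \<mu>"
  shows "bf (M Idx) (M (Idx - {0})) \<beta> ps ps"
proof -
  obtain K1 where K1: "\<forall>k\<ge>K1. \<beta> \<le> b k" using b_cofinal[OF \<beta>] by blast
  have "\<exists>n. \<not> agr (fst p) 0 n" if "p \<in> set ps" for p
  proof -
    have "fst p \<noteq> 0" using ps that by (cases p) (auto simp: Pts_iff)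
    then show ?thesis using agr_all_eq by blast
  qed
  then obtain d where d: "\<And>p. p \<in> set ps \<Longrightarrow> \<not> agr (fst p) 0 (d p)" by metis
  define K where "K = Max (insert K1 (d ` set ps))"
  have K: "K1 \<le> K" "\<And>p. p \<in> set ps \<Longrightarrow> d p \<le> K" by (simp_all add: K_def)
  obtain g where g: "iso_idx \<beta> Idx (Idx - {0}) g" "\<And>x. \<not> agr x 0 K \<Longrightarrow> g x = x"
  proof (rule idx_delete_0[of K \<beta>])
    show "\<beta> \<le> b k" if "K \<le> k" for k using K1 K(1) that by simp
  qed blast
  have fixed: "g (fst p) = fst p" if "p \<in> set ps" for p
    using g(2) d[OF that] agr_mono[OF _ K(2)[OF that]] by blast
  define s where "s p = (fst p, fst (snd p), snd (snd p), snd (snd p))" for p :: point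
  have "matched Idx (Idx - {0}) g \<beta> 1 (map s ps)"
  proof (rule matchedI)
    fix x j f f' assume "(x, j, f, f') \<in> set (map s ps)"
    then obtain p where p: "p \<in> set ps" "p = (x, j, f)" "f' = f" by (auto simp: s_def)
    then have "(x, j, f) \<in> Pts (Idx - {0})" "g x = x" using ps fixed[OF p(1)] by auto
    then show "(x, j, f) \<in> Pts Idx \<and> (g x, j, f') \<in> Pts (Idx - {0})" using p(3) by (auto simp: Pts_iff)
  next
    fix x j f f' h h' assume "(x, j, f, f') \<in> set (map s ps)" "(x, j, h, h') \<in> set (map s ps)"
    then have "f' = f" "h' = h" by (auto simp: s_def)
    then show "eqv \<beta> 1 (f - h) (f' - h')" by (simp add: eqv_refl)
  qed
  then have "bf (M Idx) (M (Idx - {0})) \<beta> (map lft (map s ps)) (map (rgt g) (map s ps))"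
    by (rule matched_bf[OF g(1) order_refl])
  moreover have "map lft (map s ps) = ps" by (rule nth_equalityI) (simp_all add: s_def)
  moreover have "map (rgt g) (map s ps) = ps" by (rule nth_equalityI) (simp_all add: s_def fixed)
  ultimately show ?thesis by simp
qed

text \<open>An isomorphism would send some leaf \<open>y \<noteq> 0\<close> to the root. Just after \<open>y\<close> has left the path of \<open>0\<close>,
  the gadgets around \<open>y\<close> have the larger of the two exponents.\<close>

lemma not_isomorphic_delete:
  assumes \<phi>: "bij_betw \<phi> (Pts (Idx - {0})) (Pts Idx)"
    and ord: "\<And>p q. p \<in> Pts (Idx - {0}) \<Longrightarrow> q \<in> Pts (Idx - {0}) \<Longrightarrow> p \<le> q \<longleftrightarrow> \<phi> p \<le> \<phi> q"
  shows False
proof -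
  let ?Y = "Idx - {0 :: idx}"
  have into: "\<phi> p \<in> Pts Idx" if "p \<in> Pts ?Y" for p using \<phi> that by (auto simp: bij_betw_def)
  have bf: "bf (M ?Y) (M Idx) \<alpha> ps (map \<phi> ps)" if "set ps \<subseteq> Pts ?Y" for ps \<alpha>
    by (rule bf_iso) (use \<phi> ord into that in simp_all)
  have surj: "\<exists>p\<in>Pts ?Y. \<phi> p = q" if "q \<in> Pts Idx" for q
    using \<phi> that unfolding bij_betw_def by (metis imageE)
  obtain y0 where y0: "y0 \<in> Pts ?Y" "\<phi> y0 = root" using surj[OF root_mem] by blast
  have "fst y0 \<noteq> 0" using y0(1) by (cases y0) (simp add: Pts_iff)
  then obtain n where n: "agr (fst y0) 0 n" "Poly_Mapping.lookup (fst y0) n \<noteq> Poly_Mapping.lookup 0 n"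
    by (rule first_difference)
  \<comment> \<open>One more than the first difference: a node of level k is on the path of 0 when
    its first k coordinates vanish, and those of \<open>y0\<close> no longer do.\<close>
  define k where "k = Suc n"
  have yk: "\<not> agr (fst y0) 0 k" using n(2) by (simp add: k_def agr_Suc)
  obtain q where q: "\<not> node q" using dense_sep[of 0 1] by auto
  \<comment> \<open>A separator of level k at the node on the path of 0, so the gadget of
    \<open>(x, k + 2, 0)\<close> has exponent \<open>b k\<close>.\<close>
  define x :: idx where "x = Poly_Mapping.single k q"
  have x: "sepx k x" "agr x 0 k"
    using q node_0 by (auto simp: x_def sepx_def agr_def lookup_single when_def)
  have xI: "x \<in> Idx" using x(1) by (auto simp: Idx_def)
  have p: "(x, k + 2, 0) \<in> Pts Idx" using x(1) xI by (simp add: Pts_sep)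
  obtain p1 where p1: "p1 \<in> Pts ?Y" "\<phi> p1 = (x, k + 2, 0)" using surj[OF p] by blast
  have "bf (M ?Y) (M Idx) (lev 4) [p1] [(x, k + 2, 0)]" using bf[of "[p1]" "lev 4"] p1 by simp
  from bf_kind[OF bf_sym[OF this] p p1(1) full_Idx full_delete, of k] x(1)
  have kind: "sepx k (fst p1)" "fst (snd p1) = k + 2" by simp_all
  define x1 f1 where "x1 = fst p1" and "f1 = snd (snd p1)"
  have p1e: "p1 = (x1, k + 2, f1)" using kind(2) by (simp add: x1_def f1_def prod_eq_iff)
  have k1: "sepx k x1" using kind(1) by (simp add: x1_def)
  have "agr (fst y0) x1 k \<longleftrightarrow> agr 0 x k"
    using bf_index(3)[OF bf[of "[y0, p1]"] _ _ full_delete full_Idx, of 0 1 k] y0 p1 p root_mem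
    by (simp add: root_def p1e)
  then have "agr (fst y0) x1 k" using x(2) agr_sym by blast
  then have "\<not> agr x1 0 k" using yk agr_trans by blast
  then have e1: "e k x1 = cord_succ (b k)" by (simp add: e_def)
  have e0: "e k x = b k" using x(2) by (simp add: e_def)
  \<comment> \<open>One unit at exponent \<open>b k\<close> fits into the gadget of exponent
    \<open>cord_succ (b k)\<close>, while all differences in the gadget of the image have smaller
    leading exponents.\<close>
  define q1 where "q1 = (x1, k + 2, f1 + mon (b k) 1)"
  have q1: "q1 \<in> Pts ?Y" using p1(1) k1 e1 less_cord_succ by (simp add: q1_def p1e Pts_sep)
  obtain x2 j2 g2 where q2: "\<phi> q1 = (x2, j2, g2)" by (cases "\<phi> q1")
  have q2m: "(x2, j2, g2) \<in> Pts Idx" using into[OF q1] q2 by simp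
  have "bf (M ?Y) (M Idx) (lev 4) [q1] [(x2, j2, g2)]" using bf[of "[q1]" "lev 4"] q1 q2 by simp
  from bf_kind[OF this q1 q2m full_delete full_Idx, of k] k1 have j2: "j2 = k + 2" by (simp add: q1_def)
  have "fst p1 = fst q1 \<longleftrightarrow> x = x2"
    using bf_index(1)[OF bf[of "[p1, q1]"] _ _ full_delete full_Idx, of 0 1] p1 q1 q2 q2m p by simp
  then have x2: "x2 = x" by (simp add: p1e q1_def)
  have mpos: "0 < mon (b k) 1" using lead_pos[OF lead_mon] by simp
  have b: "bf (M ?Y) (M Idx) (cord_succ (b k)) [(x1, k + 2, f1), (x1, k + 2, f1 + mon (b k) 1)] [(x, k + 2, 0), (x, k + 2, g2)]"
    using bf[of "[p1, q1]" "cord_succ (b k)"] p1 q1 q2 by (simp add: p1e q1_def x2 j2)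
  have m1: "{(x1, k + 2, f1), (x1, k + 2, f1 + mon (b k) 1)} \<subseteq> Pts ?Y" using p1(1) q1 by (simp add: p1e q1_def)
  have m2: "{(x, k + 2, 0), (x, k + 2, g2)} \<subseteq> Pts Idx" using p q2m by (simp add: x2 j2)
  have "ge (b k) 1 (f1 + mon (b k) 1 - f1) \<longleftrightarrow> ge (b k) 1 (g2 - 0)"
    by (rule bf_gadget_ge[OF k1 x(1) m1 m2 b _ less_cord_succ]) (use mpos in simp)
  moreover have "ge (b k) 1 (mon (b k) 1)" using ge_lead[OF lead_mon[of 1 "b k"]] by simp
  ultimately have g2: "ge (b k) 1 g2" by simp
  then have "0 < g2" using ge_zero[of "b k" 1] by (auto simp: ge_def less_le)
  then obtain \<epsilon> a where t: "lead g2 \<epsilon> a" using zpow_pos_iff by blast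
  have "supp_below (b k) g2" using m2 x(1) e0 by (simp add: Pts_sep)
  then have "\<epsilon> < b k" by (rule lead_supp_below[OF t])
  then show False using g2 ge_lead[OF t, of "b k" 1] by auto
qed

definition enc :: "point \<Rightarrow> nat" where
  "enc = to_nat_on (Pts Idx)"

text \<open>Both orders are coded through the one enumeration of \<open>Pts Idx\<close>, so the
  smaller order is a substructure and each of its tuples is its own partner in the larger
  one.\<close>

definition N :: "idx set \<Rightarrow> struct" where
  "N X = (enc ` Pts X, {(enc p, enc q) |p q. p \<in> Pts X \<and> q \<in> Pts X \<and> p \<le> q})"

lemma Pts_mono: "X \<subseteq> Y \<Longrightarrow> Pts X \<subseteq> Pts Y"
  by (auto simp: Pts_def)

lemma enc_inj: "inj_on enc (Pts Idx)"
  unfolding enc_def by (rule inj_on_to_nat_on[OF countable_Pts])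

lemma enc_rel:
  assumes "X \<subseteq> Idx" "p \<in> Pts X" "q \<in> Pts X"
  shows "(enc p, enc q) \<in> snd (N X) \<longleftrightarrow> p \<le> q"
proof -
  have "inj_on enc (Pts X)" using enc_inj Pts_mono[OF assms(1)] inj_on_subset by blast
  then show ?thesis using assms(2,3) unfolding N_def snd_conv by (auto simp: inj_on_def)
qed

lemma enc_bij: "X \<subseteq> Idx \<Longrightarrow> bij_betw enc (Pts X) (fst (N X))"
  using inj_on_subset[OF enc_inj Pts_mono] by (simp add: bij_betw_def N_def)

lemma bf_enc: "X \<subseteq> Idx \<Longrightarrow> set ps \<subseteq> Pts X \<Longrightarrow> bf (M X) (N X) \<alpha> ps (map enc ps)"
  by (rule bf_iso) (simp_all add: enc_bij enc_rel)

lemma bf_N: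
  assumes XY: "X \<subseteq> Idx" "Y \<subseteq> Idx" and ps: "set ps \<subseteq> Pts X" "set qs \<subseteq> Pts Y"
  shows "bf (N X) (N Y) \<alpha> (map enc ps) (map enc qs) \<longleftrightarrow> bf (M X) (M Y) \<alpha> ps qs"
proof
  assume "bf (M X) (M Y) \<alpha> ps qs"
  then show "bf (N X) (N Y) \<alpha> (map enc ps) (map enc qs)"
    by (rule bf_trans[OF bf_trans[OF bf_sym[OF bf_enc[OF XY(1) ps(1)]]] bf_enc[OF XY(2) ps(2)]])
next
  assume "bf (N X) (N Y) \<alpha> (map enc ps) (map enc qs)"
  then show "bf (M X) (M Y) \<alpha> ps qs"
    by (rule bf_trans[OF bf_trans[OF bf_enc[OF XY(1) ps(1)]] bf_sym[OF bf_enc[OF XY(2) ps(2)]]])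
qed

lemma ex_enc: "set cs \<subseteq> fst (N X) \<Longrightarrow> \<exists>ps. set ps \<subseteq> Pts X \<and> cs = map enc ps"
proof -
  assume "set cs \<subseteq> fst (N X)"
  then have cs: "c \<in> enc ` Pts X" if "c \<in> set cs" for c using that by (auto simp: N_def)
  let ?ps = "map (inv_into (Pts X) enc) cs"
  have "cs = map enc ?ps" using cs by (simp add: map_idI f_inv_into_f)
  moreover have "set ?ps \<subseteq> Pts X" by (simp add: image_subset_iff inv_into_into cs)
  ultimately show ?thesis by blast
qed

lemma linear_order_N: "linear_order_on (fst (N Idx)) (snd (N Idx))"
proof -
  have el: "\<exists>p\<in>Pts Idx. x = enc p" if "x \<in> fst (N Idx)" for x using that by (auto simp: N_def)
  have rel: "(enc p, enc q) \<in> snd (N Idx) \<longleftrightarrow> p \<le> q" if "p \<in> Pts Idx" "q \<in> Pts Idx" for p q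
    using that by (rule enc_rel[OF order_refl])
  have sub: "snd (N Idx) \<subseteq> fst (N Idx) \<times> fst (N Idx)" by (auto simp: N_def)
  have "refl_on (fst (N Idx)) (snd (N Idx))"
  proof (unfold refl_on_def, rule ballI)
    fix x assume "x \<in> fst (N Idx)"
    then obtain p where "p \<in> Pts Idx" "x = enc p" using el by blast
    then show "(x, x) \<in> snd (N Idx)" using rel[of p p] by simp
  qed
  moreover have "trans (snd (N Idx))"
  proof (rule transI)
    fix x y z assume xyz: "(x, y) \<in> snd (N Idx)" "(y, z) \<in> snd (N Idx)"
    then have m: "x \<in> fst (N Idx)" "y \<in> fst (N Idx)" "z \<in> fst (N Idx)" using sub by auto
    obtain p where p: "p \<in> Pts Idx" "x = enc p" using el[OF m(1)] ..
    obtain q where q: "q \<in> Pts Idx" "y = enc q" using el[OF m(2)] ..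
    obtain r where r: "r \<in> Pts Idx" "z = enc r" using el[OF m(3)] ..
    have "p \<le> q" "q \<le> r" using xyz rel p q r by simp_all
    then have "p \<le> r" by (rule order_trans)
    then show "(x, z) \<in> snd (N Idx)" using rel p r by simp
  qed
  moreover have "antisym (snd (N Idx))"
  proof (rule antisymI)
    fix x y assume xy: "(x, y) \<in> snd (N Idx)" "(y, x) \<in> snd (N Idx)"
    then have m: "x \<in> fst (N Idx)" "y \<in> fst (N Idx)" using sub by auto
    obtain p where p: "p \<in> Pts Idx" "x = enc p" using el[OF m(1)] ..
    obtain q where q: "q \<in> Pts Idx" "y = enc q" using el[OF m(2)] ..
    have "p \<le> q" "q \<le> p" using xy rel p q by simp_all
    then have "p = q" by (rule antisym)
    then show "x = y" using p q by simp
  qed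
  moreover have "total_on (fst (N Idx)) (snd (N Idx))"
  proof (unfold total_on_def, intro ballI impI)
    fix x y assume m: "x \<in> fst (N Idx)" "y \<in> fst (N Idx)"
    obtain p where p: "p \<in> Pts Idx" "x = enc p" using el[OF m(1)] ..
    obtain q where q: "q \<in> Pts Idx" "y = enc q" using el[OF m(2)] ..
    show "(x, y) \<in> snd (N Idx) \<or> (y, x) \<in> snd (N Idx)"
      using rel[OF p(1) q(1)] rel[OF q(1) p(1)] p q linear[of p q] by auto
  qed
  ultimately show ?thesis using sub by (simp add: order_on_defs)
qed

text \<open>The parameter is the code of the root, and the fixed level of the criterion is
  \<open>lev 4\<close>, where \<open>bf_kind\<close> reads off tree levels. The competing structure
  is the order without the root.\<close>

lemma Scott_complexity_N: "has_Scott_complexity (N Idx) (Sigma_class (cord_succ \<mu>))"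
proof -
  let ?Y = "Idx - {0 :: idx}"
  have \<Sigma>: "has_Scott_sentence_in (N Idx) (Sigma_class (cord_succ \<mu>))"
  proof (rule Scott_sentence_from_parameter[OF limit _ lev_less_limit[OF limit]])
    show "enc root \<in> fst (N Idx)" using root_mem by (simp add: N_def)
    fix cs assume "set cs \<subseteq> fst (N Idx)"
    then obtain ps where ps: "set ps \<subseteq> Pts Idx" "cs = map enc ps" using ex_enc by blast
    obtain \<beta> where \<beta>: "\<beta> < \<mu>" and st: "\<And>qs rs \<gamma>. set qs \<subseteq> Pts Idx \<Longrightarrow> set rs \<subseteq> Pts Idx \<Longrightarrow>
      bf (M Idx) (M Idx) (lev 4) (root # ps) (root # qs) \<Longrightarrow> bf (M Idx) (M Idx) \<beta> (root # qs) (root # rs) \<Longrightarrow>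
      \<gamma> < \<mu> \<Longrightarrow> bf (M Idx) (M Idx) \<gamma> (root # qs) (root # rs)"
      using stable[OF ps(1)] by blast
    have tr: "bf (N Idx) (N Idx) \<alpha> (enc root # map enc qs) (enc root # map enc rs) \<longleftrightarrow>
      bf (M Idx) (M Idx) \<alpha> (root # qs) (root # rs)" if "set qs \<subseteq> Pts Idx" "set rs \<subseteq> Pts Idx" for \<alpha> qs rs
      using bf_N[of Idx Idx "root # qs" "root # rs" \<alpha>] that root_mem by simp
    show "\<exists>\<beta><\<mu>. \<forall>cs' cs''. set cs' \<subseteq> fst (N Idx) \<longrightarrow> set cs'' \<subseteq> fst (N Idx) \<longrightarrow>
      bf (N Idx) (N Idx) (lev 4) (enc root # cs) (enc root # cs') \<longrightarrow>
      bf (N Idx) (N Idx) (lev 4) (enc root # cs) (enc root # cs'') \<longrightarrow>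
      bf (N Idx) (N Idx) \<beta> (enc root # cs') (enc root # cs'') \<longrightarrow>
      (\<forall>\<gamma><\<mu>. bf (N Idx) (N Idx) \<gamma> (enc root # cs') (enc root # cs''))"
    proof (intro exI[of _ \<beta>] conjI allI impI \<beta>)
      fix cs' cs'' \<gamma>
      assume *: "set cs' \<subseteq> fst (N Idx)" "set cs'' \<subseteq> fst (N Idx)"
        "bf (N Idx) (N Idx) (lev 4) (enc root # cs) (enc root # cs')"
        "bf (N Idx) (N Idx) \<beta> (enc root # cs') (enc root # cs'')" "\<gamma> < \<mu>"
      obtain qs where qs: "set qs \<subseteq> Pts Idx" "cs' = map enc qs" using ex_enc[OF *(1)] by blast
      obtain rs where rs: "set rs \<subseteq> Pts Idx" "cs'' = map enc rs" using ex_enc[OF *(2)] by blast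
      show "bf (N Idx) (N Idx) \<gamma> (enc root # cs') (enc root # cs'')"
        using st[OF qs(1) rs(1) _ _ *(5)] *(3,4) tr ps qs rs by simp
    qed
  qed
  have ok: "structure_ok (N Idx)" using root_mem by (auto simp: structure_ok_def N_def)
  have "\<exists>x. x \<in> Pts ?Y"
  proof -
    obtain q where q: "\<not> node q" using dense_sep[of 0 1] by auto
    have s: "sepx 0 (Poly_Mapping.single 0 q)" using q by (auto simp: sepx_def lookup_single when_def)
    then have "Poly_Mapping.single 0 q \<in> ?Y" using full_delete by (auto simp: full_def)
    then show ?thesis using s by (intro exI[of _ "(Poly_Mapping.single 0 q, 0, 0)"]) (simp add: Pts_sep)
  qed
  then have okY: "structure_ok (N ?Y)" by (auto simp: structure_ok_def N_def)
  have non: "\<not> isomorphic (N ?Y) (N Idx)"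
  proof
    assume "isomorphic (N ?Y) (N Idx)"
    then obtain f where f: "bij_betw f (fst (N ?Y)) (fst (N Idx))"
      "\<And>x y. x \<in> fst (N ?Y) \<Longrightarrow> y \<in> fst (N ?Y) \<Longrightarrow> (x, y) \<in> snd (N ?Y) \<longleftrightarrow> (f x, f y) \<in> snd (N Idx)"
      by (auto simp: isomorphic_def)
    have cY: "bij_betw enc (Pts ?Y) (fst (N ?Y))" by (rule enc_bij) auto
    have cI: "bij_betw enc (Pts Idx) (fst (N Idx))" by (rule enc_bij) simp
    let ?\<phi> = "inv_into (Pts Idx) enc \<circ> (f \<circ> enc)"
    have \<phi>: "bij_betw ?\<phi> (Pts ?Y) (Pts Idx)"
      by (rule bij_betw_trans[OF bij_betw_trans[OF cY f(1)] bij_betw_inv_into[OF cI]])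
    show False
    proof (rule not_isomorphic_delete[OF \<phi>])
      fix p q assume pq: "p \<in> Pts ?Y" "q \<in> Pts ?Y"
      have m: "enc p \<in> fst (N ?Y)" "enc q \<in> fst (N ?Y)" using pq by (simp_all add: N_def)
      have i: "enc (?\<phi> r) = f (enc r)" if "r \<in> Pts ?Y" for r
      proof -
        have "f (enc r) \<in> enc ` Pts Idx"
          using f(1) cI that by (auto simp: bij_betw_def N_def)
        then show ?thesis by (simp add: f_inv_into_f)
      qed
      have r: "?\<phi> p \<in> Pts Idx" "?\<phi> q \<in> Pts Idx" using \<phi> pq unfolding bij_betw_def by blast+
      have "p \<le> q \<longleftrightarrow> (enc p, enc q) \<in> snd (N ?Y)" using enc_rel[of ?Y p q] pq by auto
      also have "\<dots> \<longleftrightarrow> (enc (?\<phi> p), enc (?\<phi> q)) \<in> snd (N Idx)"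
        using f(2)[OF m] i[OF pq(1)] i[OF pq(2)] by simp
      also have "\<dots> \<longleftrightarrow> ?\<phi> p \<le> ?\<phi> q" by (rule enc_rel[OF _ r]) simp
      finally show "p \<le> q \<longleftrightarrow> ?\<phi> p \<le> ?\<phi> q" .
    qed
  qed
  have bf: "\<exists>as. set as \<subseteq> fst (N Idx) \<and> (\<forall>\<beta><\<mu>. bf (N Idx) (N ?Y) \<beta> as bs)" if bs: "set bs \<subseteq> fst (N ?Y)" for bs
  proof -
    obtain ps where ps: "set ps \<subseteq> Pts ?Y" "bs = map enc ps" using ex_enc[OF bs] by blast
    have psI: "set ps \<subseteq> Pts Idx" using ps(1) Pts_mono[of ?Y Idx] by auto
    have "bf (N Idx) (N ?Y) \<beta> bs bs" if "\<beta> < \<mu>" for \<beta>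
      using bf_N[of Idx ?Y ps ps \<beta>] bf_delete[OF ps(1) that] psI ps by auto
    moreover have "set bs \<subseteq> fst (N Idx)" using psI ps(2) by (auto simp: N_def)
    ultimately show ?thesis by blast
  qed
  show ?thesis
    unfolding has_Scott_complexity_def
    using \<Sigma> Sigma_succ_optimal[OF limit ok okY non bf] by blast
qed

end

text \<open>The running maximum of an enumeration of the ordinals below \<mu> is eventually at least
  any given one of them; \<open>lev 1\<close> secures \<open>b_pos\<close>.\<close>

lemma ex_tower:
  assumes "limit_cord \<mu>"
  obtains b where "tower \<mu> b"
proof -
  have ne: "{..<\<mu>} \<noteq> {}" using lev_less_limit[OF assms, of 0] by blast
  define c where "c = from_nat_into {..<\<mu>}"
  have c: "c n < \<mu>" for n using from_nat_into[OF ne] by (simp add: c_def)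
  have surj: "\<exists>n. c n = \<beta>" if "\<beta> < \<mu>" for \<beta>
    using from_nat_into_surj[OF countable_lessThan_cord, of \<beta> \<mu>] that by (auto simp: c_def)
  define b where "b n = Max (insert (lev 1) (c ` {..n}))" for n
  have "tower \<mu> b"
  proof
    fix k and \<beta>
    have "b k \<in> insert (lev 1) (c ` {..k})" unfolding b_def by (rule Max_in) auto
    then show "b k < \<mu>" using c lev_less_limit[OF assms, of 1] by (elim insertE imageE) simp_all
    have "lev 1 \<le> b k" by (simp add: b_def)
    then show "\<exists>\<gamma>. \<gamma> < b k" using lev_less_Suc[of 0] by (auto intro: less_le_trans)
    assume "\<beta> < \<mu>"
    then obtain K where "c K = \<beta>" using surj by blast
    then have "\<beta> \<le> b k" if "K \<le> k" for k unfolding b_def using that by (intro Max_ge) auto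
    then show "\<exists>K. \<forall>k\<ge>K. \<beta> \<le> b k" by blast
  qed (rule assms)
  then show thesis by (rule that)
qed

theorem theorem1p3:
  fixes \<mu> :: cord
  assumes "limit_cord \<mu>"
  shows "\<exists>A r. structure_ok (A, r) \<and> linear_order_on A r \<and>
    has_Scott_complexity (A, r) (Sigma_class (cord_succ \<mu>))"
proof -
  obtain b where "tower \<mu> b" using ex_tower[OF assms] .
  then interpret tower \<mu> b .
  have "structure_ok (N Idx)" using root_mem by (auto simp: structure_ok_def N_def)
  then show ?thesis
    using linear_order_N Scott_complexity_N by (intro exI[of _ "fst (N Idx)"] exI[of _ "snd (N Idx)"]) simp
qed

end
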